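(* Let $r,s,t$ be nonnegative integers and let $k=r+s+t$. Then $$ gr_k(K_{3}:r\cdot B_{3}^{+}, s\cdot S_{3}^{+}, t\cdot K_3)=\begin{cases} 17^{\frac{r}{2}}\cdot 5^{\frac{t}{2}}+1, &\text{if $s=0$ and $r, t$ are even,}\\ 2\cdot17^{\frac{r}{2}}\cdot 5^{\frac{t-1}{2}}+1, &\text{if $s=0$, $r$ is even and $t$ is odd,}\\ 8\cdot17^{\frac{r-1}{2}}\cdot 5^{\frac{t-1}{2}}+1, &\text{if $s=0$ and $r, t$ are odd,}\\ 4\cdot17^{\frac{r-1}{2}}\cdot 5^{\frac{t}{2}}+1, &\text{if $s=0$, $r$ is odd and $t$ is even,}\\ 6\cdot17^{\frac{r}{2}}\cdot 5^{\frac{s+t-2}{2}}+1, &\text{if $s\ge 1$, $r$ is even and $s+t$ is even,}\\ 3\cdot17^{\frac{r}{2}}\cdot 5^{\frac{s+t-1}{2}}+1, &\text{if $s\ge 1$, $r$ is even and $s+t$ is odd,}\\ 48\cdot 17^{\frac{r-1}{2}}\cdot 5^{\frac{s+t-3}{2}}+1, &\text{if $s\ge 1$, $r$ is odd, $t\geq1$ and $s+t$ is odd,}\\ 48\cdot 17^{\frac{r-1}{2}}\cdot 5^{\frac{s-3}{2}}+1, &\text{if $r, s$ are odd, $s\geq3$ and $t=0$,}\\ 9\cdot17^{\frac{r-1}{2}}+1, &\text{if $r$ is odd, $s=1$ and $t=0$,}\\ 24\cdot 17^{\frac{r-1}{2}}\cdot 5^{\frac{s+t-2}{2}}+1, &\text{if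 $s\ge 1$, $r$ is odd and $s+t$ is even.} \end{cases} $$
   Context: All graphs are finite and simple. A Gallai coloring is an edge coloring of a complete graph containing no rainbow triangle (a triangle whose three edges receive three distinct colors). For graphs $H_1,\dots,H_k$, the Gallai-Ramsey number $gr_k(K_3:H_1,\dots,H_k)$ is the smallest integer $n$ such that every Gallai coloring of the edges of $K_n$ with colors from $\{1,\dots,k\}$ contains, for some $i\in\{1,\dots,k\}$, a copy of $H_i$ all of whose edges have color $i$. The notation $gr_k(K_3: r\cdot G_1, s\cdot G_2, t\cdot G_3)$ with $k=r+s+t$ means $gr_k(K_3:H_1,\dots,H_k)$ with $H_1=\dots=H_r=G_1$, $H_{r+1}=\dots=H_{r+s}=G_2$, $H_{r+s+1}=\dots=H_{k}=G_3$. $K_3$ is the triangle. $S_3^+$ is the graph obtained from the star $K_{1,3}$ by adding one edge between two of its leaves (a triangle with one pendant edge). $B_3^+$ is the graph obtained from the book graph $B_3=K_2\vee\overline{K_3}$ (three triangles sharing a common edge; 5 vertices, 7 edges) by adding one edge between two of its vertices of degree two; it has 5 vertices and 8 edges. *)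

theory Defs
  imports "HOL-Library.Ramsey"
begin

text \<open>A graph is a pair of a vertex set and a set of two-element edges. The edge set of the
  complete graph on \<open>V\<close> is \<open>nsets V 2\<close>, the set of two-element subsets of \<open>V\<close>, so an edge
  coloring of the complete graph on \<open>n\<close> vertices is a function on \<open>nsets {..<n} 2\<close>.\<close>

type_synonym 'a graph = "'a set \<times> 'a set set"

abbreviation verts :: "'a graph \<Rightarrow> 'a set" where
  "verts H \<equiv> fst H"

abbreviation edges :: "'a graph \<Rightarrow> 'a set set" where
  "edges H \<equiv> snd H"

definition add_edge :: "'a \<Rightarrow> 'a \<Rightarrow> 'a graph \<Rightarrow> 'a graph" where
  "add_edge u v H = (verts H, insert {u, v} (edges H))"

definition complete_graph :: "nat \<Rightarrow> nat graph" where
  "complete_graph n = ({..<n}, nsets {..<n} 2)"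

text \<open>The star \<open>K\<^bsub>1,m\<^esub>\<close> with center \<open>0\<close> and leaves \<open>1, \<dots>, m\<close>.\<close>

definition star_graph :: "nat \<Rightarrow> nat graph" where
  "star_graph m = ({0..m}, {{0, i} | i. i \<in> {1..m}})"

text \<open>The book \<open>B\<^sub>m\<close>, the join of \<open>K\<^sub>2\<close> on \<open>{0, 1}\<close> (the spine) with \<open>m\<close> independent
  vertices \<open>2, \<dots>, m + 1\<close>.\<close>

definition book_graph :: "nat \<Rightarrow> nat graph" where
  "book_graph m = ({..<m + 2}, insert {0, 1} {{u, v} | u v. u \<in> {0, 1} \<and> v \<in> {2..<m + 2}})"

definition S3_plus :: "nat graph" where
  "S3_plus = add_edge 1 2 (star_graph 3)"

definition B3_plus :: "nat graph" where
  "B3_plus = add_edge 2 3 (book_graph 3)"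

definition gallai_coloring :: "nat \<Rightarrow> nat \<Rightarrow> (nat set \<Rightarrow> nat) \<Rightarrow> bool" where
  "gallai_coloring n k c \<longleftrightarrow>
     c \<in> nsets {..<n} 2 \<rightarrow> {1..k} \<and>
     \<not> (\<exists>x\<in>{..<n}. \<exists>y\<in>{..<n}. \<exists>z\<in>{..<n}. x \<noteq> y \<and> y \<noteq> z \<and> x \<noteq> z \<and>
         c {x, y} \<noteq> c {y, z} \<and> c {y, z} \<noteq> c {x, z} \<and> c {x, y} \<noteq> c {x, z})"

text \<open>A copy need not be induced: only the edges of \<open>H\<close> are required to have color \<open>i\<close>.\<close>

definition mono_copy :: "nat \<Rightarrow> (nat set \<Rightarrow> nat) \<Rightarrow> nat \<Rightarrow> 'a graph \<Rightarrow> bool" where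
  "mono_copy n c i H \<longleftrightarrow>
     (\<exists>f. inj_on f (verts H) \<and> f ` verts H \<subseteq> {..<n} \<and> (\<forall>e\<in>edges H. c (f ` e) = i))"

text \<open>The number below exists for all finite graphs, by Ramsey's theorem.\<close>

definition gallai_ramsey :: "nat \<Rightarrow> (nat \<Rightarrow> 'a graph) \<Rightarrow> nat" where
  "gallai_ramsey k H =
     (LEAST n. \<forall>c. gallai_coloring n k c \<longrightarrow> (\<exists>i\<in>{1..k}. mono_copy n c i (H i)))"

text \<open>The sequence \<open>r \<cdot> G1, s \<cdot> G2, t \<cdot> G3\<close>, indexed from \<open>1\<close> to \<open>r + s + t\<close>
  (so \<open>t\<close> is determined by the length of the sequence).\<close>

definition three_blocks :: "nat \<Rightarrow> 'a graph \<Rightarrow> nat \<Rightarrow> 'a graph \<Rightarrow> 'a graph \<Rightarrow> nat \<Rightarrow> 'a graph" where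
  "three_blocks r G1 s G2 G3 i = (if i \<le> r then G1 else if i \<le> r + s then G2 else G3)"

end

(* Upper bound: by induction on the vertex set, tracking for every color which of the constraints
   B3+, S3+, K3 or "no edge" the induced coloring obeys.  If two sets are completely joined in one
   color, the constraint on that color drops inside them.  Otherwise there is a Gallai partition
   into at least four parts using two colors i and j between the parts, in which S3+ is as
   restrictive as K3, and every part has neighbours in both colors, so the constraints on i and j
   drop inside the parts.  Counting parts, weighted by how much i and j may still be used inside
   them, as in the proofs of R(4,4) <= 18, R(3,4) <= 9 and R(3,3) <= 6, bounds the number of
   vertices; a K4 in a B3+-free color forces so many edges of the other color that it can be removed
   at small cost.

   Lower bound: start from a point, a K4 in a B3+ color or a K3 in an S3+ color (no further vertex
   in its block completes a copy) and repeatedly substitute it into the extremal colorings on 17, 8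
   and 5 vertices and monochromatic complete graphs on 3 and 2 vertices. *)

theory Submission
  imports Defs "HOL-Library.Disjoint_Sets"
begin

section \<open>The bound and its recurrences\<close>

text \<open>S3+ cannot be treated separately: a vertex joined to a set in a B3+-free color leaves
  that set S3+-free, so S3+ arises in the induction even when s = 0. Hence the induction runs over
  all assignments of constraints to colors at once. The obstacle in the two-color case is that parts
  need not be light. If all are, one vertex per part reduces the count to a classical Ramsey bound
  of 17, 8 or 5 parts. A part that uses i or j inside may be larger, but an edge inside it lowers
  the clique number of its neighbourhood by two instead of one. That this trade stays within the
  bound depends on the growth of the bound when one K3 color is added. The factor is 2 or 5/2,
  except at r odd, s = 1, t = 0: there three triangles joined in the B3+ color give 9, while one
  more K3 color allows 3 * 8 = 24, and two more give 48. The ratios 24/9 = 8/3 and 48/9 = 16/3 are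
  the worst case and the source of the constants in the weighted count.\<close>

definition tri_bound :: "nat \<Rightarrow> nat" where
  "tri_bound n = (if even n then 1 else 2) * 5 ^ (n div 2)"

text \<open>The factors are sizes of extremal pieces: 17 for two B3+ colors, 4 for a K4 in a B3+
  color left over, 3 for a K3 in a single S3+ color, while the other S3+ colors count as K3 colors.
  A B3+ color left over next to an S3+ color gives 24 = 8 * 3, or 9 = 3 * 3 if no K3 or second S3+
  color is there to form the coloring on 8 vertices.\<close>

definition gr_bound :: "nat \<Rightarrow> nat \<Rightarrow> nat \<Rightarrow> nat" where
  "gr_bound r s t = 17 ^ (r div 2) *
     (if s = 0 then (if even r then 1 else 4) * tri_bound t
      else if even r then 3 * tri_bound (s + t - 1)
      else if s + t = 1 then 9 else 24 * tri_bound (s + t - 2))"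

lemma tri_bound_simps [simp]:
  "tri_bound 0 = 1" "tri_bound (Suc 0) = 2" "tri_bound (Suc (Suc n)) = 5 * tri_bound n"
  by (simp_all add: tri_bound_def)

text \<open>The ratio of consecutive values alternates between 2 and 5/2; with these estimates all
  later comparisons become linear.\<close>

lemma tri_bound_Suc: "2 * tri_bound n \<le> tri_bound (Suc n)"
    "2 * tri_bound (Suc n) \<le> 5 * tri_bound n"
  "tri_bound (Suc n) \<le> 3 * tri_bound n"
  by (auto simp: tri_bound_def elim!: evenE oddE)

lemma tri_bound_pos: "1 \<le> tri_bound n"
  by (simp add: tri_bound_def)

text \<open>Within a case nearly all values of \<open>gr_bound\<close> near the given arguments are
  fixed multiples of two consecutive values of \<open>tri_bound\<close>; \<open>odd1\<close>
  isolates the exceptional value 9.\<close>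

lemma gr_bound_cases:
  obtains (even0) k where "r = 2 * k" "s = 0"
  | (odd0) k where "r = Suc (2 * k)" "s = 0"
  | (even) k u where "r = 2 * k" "s \<noteq> 0" "s + t = Suc u"
  | (odd1) k where "r = Suc (2 * k)" "s = Suc 0" "t = 0"
  | (odd) k u where "r = Suc (2 * k)" "s \<noteq> 0" "s + t = Suc (Suc u)"
proof -
  consider k where "r = 2 * k" | k where "r = Suc (2 * k)"
    by (metis evenE oddE Suc_eq_plus1)
  moreover have "s = 0 \<or> s \<noteq> 0 \<and> (\<exists>u. s + t = Suc u)"
    by presburger
  moreover have "s = 0 \<or> (s = Suc 0 \<and> t = 0) \<or> s \<noteq> 0 \<and> (\<exists>u. s + t
      = Suc (Suc u))"
    by presburger
  ultimately show ?thesis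
    using that by metis
qed

lemma gr_bound_even0 [simp]: "gr_bound (2 * k) 0 t = 17 ^ k * tri_bound t"
  and gr_bound_odd0 [simp]: "gr_bound (Suc (2 * k)) 0 t = 17 ^ k * (4 * tri_bound t)"
  and gr_bound_even: "s \<noteq> 0 \<Longrightarrow> s + t = Suc u \<Longrightarrow> gr_bound (2 *
      k) s t = 17 ^ k * (3 * tri_bound u)"
  and gr_bound_odd1 [simp]: "gr_bound (Suc (2 * k)) (Suc 0) 0 = 17 ^ k * 9"
  and gr_bound_odd: "s \<noteq> 0 \<Longrightarrow> s + t = Suc (Suc u) \<Longrightarrow>
    gr_bound (Suc (2 * k)) s t = 17 ^ k * (24 * tri_bound u)"
  by (auto simp: gr_bound_def)

lemma gr_bound_Suc2: "gr_bound (Suc (Suc r)) s t = 17 * gr_bound r s t"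
  by (simp add: gr_bound_def)

text \<open>Each inequality pays for one configuration of the upper bound.
  \<open>gr_bound_K\<close>, \<open>gr_bound_S\<close>, \<open>gr_bound_B\<close> serve two sets
  joined in one color, where the letter is the constraint on that color; two letters refer to the
  two colors of a Gallai partition. \<open>gr_bound_BB\<close> and the last two parts of
  \<open>gr_bound_BK\<close> pay for removing a K4.\<close>

lemma gr_bound_pos: "1 \<le> gr_bound r s t"
  and gr_bound_K: "2 * gr_bound r s t \<le> gr_bound r s (Suc t)"
  and gr_bound_S: "3 \<le> gr_bound r (Suc s) t" "gr_bound r s (Suc t) \<le> gr_bound r (Suc s) t"
  and gr_bound_B: "4 \<le> gr_bound (Suc r) s t"
    "gr_bound r s t + gr_bound r s (Suc t) \<le> gr_bound (Suc r) s t"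
    "1 + gr_bound r (Suc s) t \<le> gr_bound (Suc r) s t"
  and gr_bound_KK: "5 * gr_bound r s t \<le> gr_bound r s (Suc (Suc t))"
  and gr_bound_BK: "8 * gr_bound r s t \<le> gr_bound (Suc r) s (Suc t)"
    "3 * gr_bound r s t + 2 * gr_bound r s (Suc t) \<le> gr_bound (Suc r) s (Suc t)"
    "4 + gr_bound (Suc r) s t \<le> gr_bound (Suc r) s (Suc t)"
    "1 + gr_bound r (Suc s) t + gr_bound (Suc r) s t \<le> gr_bound (Suc r) s (Suc t)"
  and gr_bound_ratio: "3 * gr_bound r s (Suc t) \<le> 8 * gr_bound r s t"
    "3 * gr_bound r s (Suc (Suc t)) \<le> 16 * gr_bound r s t"
  and gr_bound_BB: "4 + gr_bound (Suc r) s (Suc t) \<le> gr_bound (Suc (Suc r)) s t"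
    "1 + gr_bound r (Suc s) t + gr_bound (Suc r) s (Suc t) \<le> gr_bound (Suc (Suc r)) s t"
    "1 + gr_bound r (Suc s) (Suc t) + gr_bound (Suc r) s t \<le> gr_bound (Suc (Suc r)) s t"
proof -
  let ?G = gr_bound
  have "1 \<le> ?G r s t \<and> 2 * ?G r s t \<le> ?G r s (Suc t) \<and>
    3 \<le> ?G r (Suc s) t \<and> ?G r s (Suc t) \<le> ?G r (Suc s) t \<and>
    4 \<le> ?G (Suc r) s t \<and> ?G r s t + ?G r s (Suc t) \<le> ?G (Suc r) s t \<and>
    1 + ?G r (Suc s) t \<le> ?G (Suc r) s t \<and> 5 * ?G r s t \<le> ?G r s (Suc (Suc t)) \<and>
    8 * ?G r s t \<le> ?G (Suc r) s (Suc t) \<and> 3 * ?G r s t + 2 * ?G r s (Suc t) \<le> ?G (Suc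
        r) s (Suc t) \<and>
    4 + ?G (Suc r) s t \<le> ?G (Suc r) s (Suc t) \<and>
    1 + ?G r (Suc s) t + ?G (Suc r) s t \<le> ?G (Suc r) s (Suc t) \<and>
    3 * ?G r s (Suc t) \<le> 8 * ?G r s t \<and> 3 * ?G r s (Suc (Suc t)) \<le> 16 * ?G r s t \<and>
    4 + ?G (Suc r) s (Suc t) \<le> ?G (Suc (Suc r)) s t \<and>
    1 + ?G r (Suc s) t + ?G (Suc r) s (Suc t) \<le> ?G (Suc (Suc r)) s t \<and>
    1 + ?G r (Suc s) (Suc t) + ?G (Suc r) s t \<le> ?G (Suc (Suc r)) s t"
  proof (cases rule: gr_bound_cases[where r = r and s = s and t = t])
    case (even0 k)
    define p a b where "p = (17::nat) ^ k" and "a = p * tri_bound t" and "b = p * tri_bound (Suc t)"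
    have "1 \<le> p" "p \<le> a" "2 * a \<le> b" "2 * b \<le> 5 * a"
      using tri_bound_Suc[of t] tri_bound_pos[of t] by (simp_all add: p_def a_def b_def)
    moreover have "?G r s t = a" "?G r s (Suc t) = b" "?G r s (Suc (Suc t)) = 5 * a"
      "?G r (Suc s) t = 3 * a" "?G r (Suc s) (Suc t) = 3 * b" "?G (Suc r) s t = 4 * a"
      "?G (Suc r) s (Suc t) = 4 * b"
      using even0 by (simp_all add: gr_bound_even p_def a_def b_def)
    ultimately show ?thesis
      unfolding gr_bound_Suc2 by linarith
  next
    case (odd0 k)
    define p a b where "p = (17::nat) ^ k" and "a = p * tri_bound t" and "b = p * tri_bound (Suc t)"
    have "1 \<le> p" "p \<le> a" "2 * a \<le> b" "2 * b \<le> 5 * a"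
      using tri_bound_Suc[of t] tri_bound_pos[of t] by (simp_all add: p_def a_def b_def)
    moreover have "?G r s t = 4 * a" "?G r s (Suc t) = 4 * b" "?G r s (Suc (Suc t)) = 20 * a"
      "?G (Suc r) s t = 17 * a" "?G (Suc r) s (Suc t) = 17 * b" "?G r (Suc s) (Suc t) = 24 * a"
      using odd0 gr_bound_Suc2[of "2 * k"] by (simp_all add: gr_bound_odd p_def a_def b_def)
    \<comment> \<open>Passing from \<open>s = 0\<close> to \<open>s = 1\<close> hits the exceptional
      value 9 when \<open>t = 0\<close>, so this value is only bracketed.\<close>
    moreover have "4 * b \<le> ?G r (Suc s) t" "?G r (Suc s) t \<le> 12 * a"
    proof -
      have "t = 0 \<or> (\<exists>u. t = Suc u)" by presburger
      then have "4 * b \<le> ?G r (Suc s) t \<and> ?G r (Suc s) t \<le> 12 * a"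
        using odd0 tri_bound_Suc by (auto simp: gr_bound_odd p_def a_def b_def)
      then show "4 * b \<le> ?G r (Suc s) t" "?G r (Suc s) t \<le> 12 * a" by simp_all
    qed
    ultimately show ?thesis
      unfolding gr_bound_Suc2 by linarith
  next
    case (even k u)
    define p a b where "p = (17::nat) ^ k" and "a = p * tri_bound u" and "b = p * tri_bound (Suc u)"
    have "1 \<le> p" "p \<le> a" "2 * a \<le> b" "2 * b \<le> 5 * a"
      using tri_bound_Suc[of u] tri_bound_pos[of u] by (simp_all add: p_def a_def b_def)
    moreover have "?G r s t = 3 * a" "?G r s (Suc t) = 3 * b" "?G r s (Suc (Suc t)) = 15 * a"
      "?G r (Suc s) t = 3 * b" "?G r (Suc s) (Suc t) = 15 * a" "?G (Suc r) s (Suc t) = 24 * a"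
      using even by (simp_all add: gr_bound_even gr_bound_odd p_def a_def b_def)
    \<comment> \<open>For \<open>s = 1\<close> and \<open>t = 0\<close> this is the exceptional
      value, and the lower estimate is attained as 9 = 3 + 6, up to the factor
      \<open>p\<close>.\<close>
    moreover have "3 * a + 3 * b \<le> ?G (Suc r) s t" "?G (Suc r) s t \<le> 12 * a"
    proof -
      have "(s = Suc 0 \<and> t = 0 \<and> u = 0) \<or> (\<exists>v. u = Suc v)" using even by
          presburger
      then have "3 * a + 3 * b \<le> ?G (Suc r) s t \<and> ?G (Suc r) s t \<le> 12 * a"
        using even tri_bound_Suc by (auto simp: gr_bound_odd p_def a_def b_def)
      then show "3 * a + 3 * b \<le> ?G (Suc r) s t" "?G (Suc r) s t \<le> 12 * a" by simp_all
    qed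
    ultimately show ?thesis
      unfolding gr_bound_Suc2 by linarith
  next
    case (odd1 k)
    define p where "p = (17::nat) ^ k"
    have "1 \<le> p"
      by (simp add: p_def)
    moreover have "?G r s t = 9 * p" "?G r s (Suc t) = 24 * p" "?G r s (Suc (Suc t)) = 48 * p"
      "?G r (Suc s) t = 24 * p" "?G r (Suc s) (Suc t) = 48 * p" "?G (Suc r) s t = 51 * p"
      "?G (Suc r) s (Suc t) = 102 * p"
      using odd1 gr_bound_Suc2[of "2 * k"] gr_bound_even[of "Suc 0"]
      by (simp_all add: gr_bound_odd p_def)
    ultimately show ?thesis
      unfolding gr_bound_Suc2 by linarith
  next
    case (odd k u)
    define p a b where "p = (17::nat) ^ k" and "a = p * tri_bound u" and "b = p * tri_bound (Suc u)"
    have "1 \<le> p" "p \<le> a" "2 * a \<le> b" "2 * b \<le> 5 * a"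
      using tri_bound_Suc[of u] tri_bound_pos[of u] by (simp_all add: p_def a_def b_def)
    moreover have "?G r s t = 24 * a" "?G r s (Suc t) = 24 * b" "?G r s (Suc (Suc t)) = 120 * a"
      "?G r (Suc s) t = 24 * b" "?G r (Suc s) (Suc t) = 120 * a" "?G (Suc r) s t = 51 * b"
      "?G (Suc r) s (Suc t) = 255 * a"
      using odd gr_bound_Suc2[of "2 * k"] 
      by (simp_all add: gr_bound_even gr_bound_odd p_def a_def b_def)
    ultimately show ?thesis
      unfolding gr_bound_Suc2 by linarith
  qed
  then show "1 \<le> gr_bound r s t"
    "2 * gr_bound r s t \<le> gr_bound r s (Suc t)"
    "3 \<le> gr_bound r (Suc s) t" "gr_bound r s (Suc t) \<le> gr_bound r (Suc s) t"
    "4 \<le> gr_bound (Suc r) s t"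
    "gr_bound r s t + gr_bound r s (Suc t) \<le> gr_bound (Suc r) s t"
    "1 + gr_bound r (Suc s) t \<le> gr_bound (Suc r) s t"
    "5 * gr_bound r s t \<le> gr_bound r s (Suc (Suc t))"
    "8 * gr_bound r s t \<le> gr_bound (Suc r) s (Suc t)"
    "3 * gr_bound r s t + 2 * gr_bound r s (Suc t) \<le> gr_bound (Suc r) s (Suc t)"
    "4 + gr_bound (Suc r) s t \<le> gr_bound (Suc r) s (Suc t)"
    "1 + gr_bound r (Suc s) t + gr_bound (Suc r) s t \<le> gr_bound (Suc r) s (Suc t)"
    "3 * gr_bound r s (Suc t) \<le> 8 * gr_bound r s t"
    "3 * gr_bound r s (Suc (Suc t)) \<le> 16 * gr_bound r s t"
    "4 + gr_bound (Suc r) s (Suc t) \<le> gr_bound (Suc (Suc r)) s t"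
    "1 + gr_bound r (Suc s) t + gr_bound (Suc r) s (Suc t) \<le> gr_bound (Suc (Suc r)) s t"
    "1 + gr_bound r (Suc s) (Suc t) + gr_bound (Suc r) s t \<le> gr_bound (Suc (Suc r)) s t"
    by blast+
qed

section \<open>Gallai partitions\<close>

locale edge_coloring =
  fixes e :: "'a \<Rightarrow> 'a \<Rightarrow> nat"
  assumes sym: "e x y = e y x"
begin

definition gallai :: "'a set \<Rightarrow> bool" where
  "gallai V \<longleftrightarrow> (\<forall>x\<in>V. \<forall>y\<in>V. \<forall>z\<in>V. x \<noteq>
      y \<and> y \<noteq> z \<and> x \<noteq> z \<longrightarrow>
     e x y = e y z \<or> e y z = e x z \<or> e x y = e x z)"

definition joined :: "nat \<Rightarrow> 'a set \<Rightarrow> 'a set \<Rightarrow> bool" where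
  "joined l A B \<longleftrightarrow> (\<forall>a\<in>A. \<forall>b\<in>B. e a b = l)"

text \<open>A two-sided precursor of a Gallai partition: it can be built by adding vertices one at a
  time and is refined to a partition afterwards.\<close>

definition split :: "nat \<Rightarrow> nat \<Rightarrow> 'a set \<Rightarrow> 'a set \<Rightarrow>
    'a set \<Rightarrow> bool" where
  "split i j V A B \<longleftrightarrow> A \<union> B = V \<and> A \<inter> B = {} \<and> A
      \<noteq> {} \<and> B \<noteq> {} \<and> (\<forall>a\<in>A. \<forall>b\<in>B. e a b \<in> {i,
      j})"

text \<open>The colors \<open>i\<close> and \<open>j\<close> may coincide here; in the case without
  a joined bipartition they turn out to be distinct.\<close>

definition gallai_partition :: "nat \<Rightarrow> nat \<Rightarrow> 'a set \<Rightarrow> 'a set set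
    \<Rightarrow> bool" where
  "gallai_partition i j V \<P> \<longleftrightarrow> partition_on V \<P> \<and> V \<notin> \<P>
      \<and>
     (\<forall>P\<in>\<P>. \<forall>Q\<in>\<P>. P \<noteq> Q \<longrightarrow> joined i P Q \<or>
         joined j P Q)"

lemma gallai_subset: "gallai V \<Longrightarrow> U \<subseteq> V \<Longrightarrow> gallai U"
  unfolding gallai_def by blast

lemma gallaiD:
  "gallai V \<Longrightarrow> {x, y, z} \<subseteq> V \<Longrightarrow> x \<noteq> y
      \<Longrightarrow> y \<noteq> z \<Longrightarrow> x \<noteq> z \<Longrightarrow>
    e x y = e y z \<or> e y z = e x z \<or> e x y = e x z"
  unfolding gallai_def by simp

lemma joined_sym: "joined l A B \<longleftrightarrow> joined l B A"
  unfolding joined_def using sym by metis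

text \<open>The parts are the connected components of the graph formed by the edges of color other
  than \<open>i\<close> and \<open>j\<close>.\<close>

lemma split_imp_gallai_partition:
  assumes "gallai V" and "split i j V A B"
  shows "\<exists>\<P>. gallai_partition i j V \<P>"
proof -
  define R where "R = {(x, y). x \<in> V \<and> y \<in> V \<and> e x y \<notin> {i, j}}"
  define E where "E = {(x, y). x \<in> V \<and> y \<in> V \<and> (x, y) \<in> R\<^sup>*}"
  have "Relation.sym (R\<^sup>*)"
    by (rule sym_rtrancl) (auto simp: Relation.sym_def R_def sym)
  then have "equiv V E"
    unfolding equiv_def refl_on_def Relation.sym_def trans_def E_def
    by (auto intro: rtrancl_trans)
  then have part: "partition_on V (V // E)"
    by (rule partition_on_quotient)
  \<comment> \<open>Along a path of edges of other colors the color towards \<open>z\<close> stays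
    constant: both edges to \<open>z\<close> have color \<open>i\<close> or \<open>j\<close>, the
    edge on the path has neither, and the triangle is not rainbow.\<close>
  have hom: "e y z = e x z" if "(x, y) \<in> R\<^sup>*" "z \<in> V" "x \<in> V"
      "(x, z) \<notin> R\<^sup>*" for x y z
    using that(1)
  proof (induction rule: rtrancl_induct)
    case (step y y')
    have "y \<noteq> z" "y' \<noteq> z"
      using step.hyps that(4) by (auto intro: rtrancl_into_rtrancl)
    moreover have "e y z \<in> {i, j}"
      using step.hyps that by (auto simp: R_def intro: rtrancl_into_rtrancl)
    moreover have "(x, y') \<in> R\<^sup>*"
      using step.hyps by (rule rtrancl_into_rtrancl)
    then have "e y' z \<in> {i, j}"
      using step.hyps(2) that rtrancl_into_rtrancl[of x y' R z] by (auto simp: R_def)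
    moreover have "y \<in> V" "y' \<in> V" "e y y' \<notin> {i, j}"
      using step.hyps(2) by (auto simp: R_def)
    ultimately have "e y z = e y' z"
      using gallaiD[OF assms(1), of y y' z] that(2) by (cases "y = y'") auto
    then show ?case
      using step.IH by simp
  qed simp
  have "joined i P Q \<or> joined j P Q" if PQ: "P \<in> V // E" "Q \<in> V // E" "P \<noteq> Q"
      for P Q
  proof -
    obtain p q where pq: "p \<in> V" "P = E `` {p}" "q \<in> V" "Q = E `` {q}"
      using PQ by (auto simp: quotient_def)
    have npq: "(p, q) \<notin> R\<^sup>*"
      using PQ(3) pq equiv_class_eq[OF \<open>equiv V E\<close>, of p q] by (auto simp: E_def)
    have "e p' q' = e p q" if "p' \<in> P" "q' \<in> Q" for p' q'
    proof -
      have "(p, p') \<in> R\<^sup>*" "(q, q') \<in> R\<^sup>*" "p' \<in> V" "q' \<in> V"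
        using that pq by (auto simp: E_def)
      then have "(q, p) \<notin> R\<^sup>*" "(p, q') \<notin> R\<^sup>*"
        using npq \<open>Relation.sym (R\<^sup>*)\<close> by (meson rtrancl_trans symE)+
      have "e p' q' = e p q'"
        using hom \<open>(p, p') \<in> R\<^sup>*\<close> \<open>q' \<in> V\<close> pq(1) \<open>(p,
            q') \<notin> R\<^sup>*\<close> by blast
      also have "\<dots> = e p q"
        using hom[OF \<open>(q, q') \<in> R\<^sup>*\<close> pq(1,3) \<open>(q, p) \<notin>
            R\<^sup>*\<close>] sym by metis
      finally show ?thesis .
    qed
    moreover have "e p q \<in> {i, j}"
      using npq pq by (auto simp: R_def)
    ultimately show ?thesis
      unfolding joined_def by blast
  qed
  \<comment> \<open>Such a path cannot leave \<open>A\<close>, since all edges from \<open>A\<close>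
    to \<open>B\<close> have color \<open>i\<close> or \<open>j\<close>.\<close>
  moreover have "V \<notin> V // E"
  proof
    assume "V \<in> V // E"
    obtain a b where ab: "a \<in> A" "b \<in> B"
      using assms(2) unfolding split_def by auto
    then have "(a, b) \<in> R\<^sup>*"
      using \<open>V \<in> V // E\<close> assms(2) \<open>equiv V E\<close> quotient_eq_iff[OF
          \<open>equiv V E\<close>, of V V a b]
      unfolding split_def E_def by auto
    then have "b \<in> A"
    proof (induction rule: rtrancl_induct)
      case (step y z)
      then show ?case
        using assms(2) unfolding R_def split_def by auto
    qed (rule ab)
    then show False
      using ab assms(2) unfolding split_def by auto
  qed
  ultimately have "gallai_partition i j V (V // E)"
    unfolding gallai_partition_def using part by blast
  then show ?thesis ..
qed

text \<open>Add a vertex \<open>v\<close> to a partitioned set \<open>F\<close>. A part that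
  \<open>v\<close> sees only in \<open>i\<close> and \<open>j\<close> is one side of a split.
  Otherwise \<open>v\<close> sends an edge of another color into each part, and this color
  \<open>l\<close> is the same for all parts. A part joined to all others in one color
  \<open>a\<close> then splits off with the colors \<open>a\<close> and \<open>l\<close>. If there
  is none, every part has neighbours in both colors, which forces color \<open>l\<close> on all
  edges at \<open>v\<close>.\<close>

lemma gallai_imp_split:
  assumes "finite V" "gallai V" "2 \<le> card V"
  shows "\<exists>i j A B. split i j V A B"
  using assms
proof (induction rule: finite_induct)
  case (insert v F)
  show ?case
  proof (cases "2 \<le> card F")
    case False
    then have "card F = 1"
      using insert by simp
    then obtain u where "F = {u}"
      by (auto simp: card_1_singleton_iff)
    then have "split (e v u) (e v u) (insert v F) {v} F"
      using insert unfolding split_def by auto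
    then show ?thesis
      by blast
  next
    case True
    have gF: "gallai F"
      using insert.prems gallai_subset by blast
    then obtain i j \<P> where "gallai_partition i j F \<P>"
      using insert.IH True split_imp_gallai_partition by blast
    then have part: "partition_on F \<P>" "F \<notin> \<P>"
      and hom: "\<And>P Q. P \<in> \<P> \<Longrightarrow> Q \<in> \<P> \<Longrightarrow> P \<noteq>
          Q \<Longrightarrow> joined i P Q \<or> joined j P Q"
      unfolding gallai_partition_def by auto
    have sub: "P \<subseteq> F" "P \<noteq> {}" if "P \<in> \<P>" for P
      using that part unfolding partition_on_def by auto
    have inP: "\<exists>P\<in>\<P>. x \<in> P" if "x \<in> F" for x
      using that part unfolding partition_on_def by auto
    have other: "\<exists>Q\<in>\<P>. Q \<noteq> P" if "P \<in> \<P>" for P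
    proof (rule ccontr)
      assume "\<not> (\<exists>Q\<in>\<P>. Q \<noteq> P)"
      then have "F \<subseteq> P"
        using inP by blast
      then show False
        using sub(1)[OF that] part(2) that by (metis subset_antisym)
    qed
    have disj: "P \<inter> Q = {}" if "P \<in> \<P>" "Q \<in> \<P>" "P \<noteq> Q" for P Q
      using that part by (auto simp: partition_on_def disjoint_def)
    show ?thesis
    proof (cases "\<exists>C\<in>\<P>. \<forall>x\<in>C. e v x \<in> {i, j}")
      case True
      then obtain C where C: "C \<in> \<P>" "\<forall>x\<in>C. e v x \<in> {i, j}"
        by blast
      have "e a b \<in> {i, j}" if a: "a \<in> C" and b: "b \<in> insert v F - C" for a b
      proof (cases "b = v")
        case True
        then show ?thesis
          using C(2) a sym by metis
      next
        case False
        then obtain D where "D \<in> \<P>" "b \<in> D"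
          using b inP by blast
        then show ?thesis
          using hom[OF C(1), of D] a b unfolding joined_def by auto
      qed
      then have "split i j (insert v F) C (insert v F - C)"
        unfolding split_def using sub[OF C(1)] insert.hyps by blast
      then show ?thesis
        by blast
    next
      case False
      then obtain x where x: "\<And>C. C \<in> \<P> \<Longrightarrow> x C \<in> C"
          "\<And>C. C \<in> \<P> \<Longrightarrow> e v (x C) \<notin> {i, j}"
        by metis
      have vne: "v \<noteq> y" if "C \<in> \<P>" "y \<in> C" for y C
        using that sub insert.hyps by blast
      have "F \<noteq> {}"
        using True by auto
      then obtain C0 where C0: "C0 \<in> \<P>"
        using inP by blast
      define l where "l = e v (x C0)"
      have tri: "e v y = e v z \<or> e v y = e y z \<or> e v z = e y z"
        if "C \<in> \<P>" "D \<in> \<P>" "C \<noteq> D" "y \<in> C" "z \<in> D" for C D y z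
      proof -
        have "v \<noteq> y" "v \<noteq> z" "y \<in> F" "z \<in> F" "y \<noteq> z"
          using that sub vne disj[of C D] by blast+
        then show ?thesis
          using gallaiD[OF insert.prems(1), of v y z] by auto
      qed
      \<comment> \<open>The edge from \<open>x C\<close> to \<open>x C0\<close> has color
        \<open>i\<close> or \<open>j\<close> and the two edges at \<open>v\<close> do not, so these
        two agree.\<close>
      have xl: "e v (x C) = l" if "C \<in> \<P>" for C
      proof (cases "C = C0")
        case False
        then show ?thesis
          using tri[OF that C0 False x(1)[OF that] x(1)[OF C0]] hom[OF that C0 False]
            x[OF that] x[OF C0] unfolding joined_def l_def by force
      qed (simp add: l_def)
      have l: "l \<notin> {i, j}"
        using x(2)[OF C0] l_def by simp
      \<comment> \<open>In the triangle \<open>v\<close>, \<open>y\<close>, \<open>x D\<close> the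
        edges at \<open>x D\<close> have the distinct colors \<open>l\<close> and
        \<open>a\<close>.\<close>
      have yl: "e v y \<in> {l, a}" if "C \<in> \<P>" "D \<in> \<P>" "C \<noteq> D" "joined a C D"
          "y \<in> C" "a \<in> {i, j}" for C D y a
        using tri[OF that(1,2,3,5) x(1)[OF that(2)]] xl[OF that(2)] that x(1)[OF that(2)] l
        unfolding joined_def by auto
      show ?thesis
      proof (cases "\<exists>C\<in>\<P>. \<exists>a\<in>{i, j}. \<forall>D\<in>\<P>. D \<noteq> C
          \<longrightarrow> joined a C D")
        case True
        then obtain C a where C: "C \<in> \<P>" "a \<in> {i, j}"
            "\<forall>D\<in>\<P>. D \<noteq> C \<longrightarrow> joined a C D"
          by (elim bexE)
        obtain D where D: "D \<in> \<P>" "D \<noteq> C"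
          using other[OF C(1)] by blast
        have "e y z \<in> {a, l}" if y: "y \<in> C" and z: "z \<in> insert v F - C" for y z
        proof (cases "z = v")
          case True
          then show ?thesis
            using yl[OF C(1) D(1) D(2)[symmetric] C(3)[rule_format, OF D] y C(2)] sym[of y v] by
                auto
        next
          case False
          then obtain D' where "D' \<in> \<P>" "z \<in> D'"
            using z inP by blast
          then show ?thesis
            using C(3) y z unfolding joined_def by blast
        qed
        moreover have "C \<subseteq> F" "C \<noteq> {}" "v \<notin> C"
          using sub[OF C(1)] insert.hyps by auto
        ultimately have "split a l (insert v F) C (insert v F - C)"
          unfolding split_def by auto
        then show ?thesis
          by blast
      next
        case nj: False
        have "e v y = l" if y: "y \<in> F" for y
        proof -
          obtain C where C: "C \<in> \<P>" "y \<in> C"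
            using inP y by blast
          obtain D where D: "D \<in> \<P>" "D \<noteq> C" "\<not> joined i C D"
            using nj C(1) by blast
          obtain D' where D': "D' \<in> \<P>" "D' \<noteq> C" "\<not> joined j C D'"
            using nj C(1) by blast
          have "e v y \<in> {l, j}" "e v y \<in> {l, i}"
            using yl[OF C(1) D(1) D(2)[symmetric] _ C(2)] hom[OF C(1) D(1) D(2)[symmetric]] D(3)
              yl[OF C(1) D'(1) D'(2)[symmetric] _ C(2)] hom[OF C(1) D'(1) D'(2)[symmetric]] D'(3)
            by auto
          moreover have "i \<noteq> j"
            using D(3) hom[OF C(1) D(1) D(2)[symmetric]] by auto
          ultimately show ?thesis
            by auto
        qed
        then have "split l l (insert v F) {v} F"
          unfolding split_def using insert.hyps \<open>F \<noteq> {}\<close> by auto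
        then show ?thesis
          by blast
      qed
    qed
  qed
qed simp

lemma gallai_partition_exists:
  assumes "finite V" "gallai V" "2 \<le> card V"
  shows "\<exists>i j \<P>. gallai_partition i j V \<P>"
  using gallai_imp_split[OF assms] split_imp_gallai_partition[OF assms(2)] by blast

end

section \<open>Ramsey numbers and weighted parts\<close>

text \<open>The handshake lemma: a new vertex adds its degree once for itself and once through its
  neighbours.\<close>

lemma even_sum_card_symmetric:
  assumes "finite X" "\<And>x y. R x y \<Longrightarrow> R y x" "\<And>x. \<not> R x x"
  shows "even (\<Sum>x\<in>X. card {y \<in> X. R x y})"
proof -
  have "even (\<Sum>x\<in>X. \<Sum>y\<in>X. if R x y then 1 else 0 :: nat)"
    using assms(1)
  proof (induction rule: finite_induct)
    case (insert v F)
    have "(\<Sum>x\<in>F. if R x v then 1 else 0) = (\<Sum>y\<in>F. if R v y then 1 else 0 :: nat)"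
      by (rule sum.cong) (use assms(2) in auto)
    then show ?case
      using insert assms(3) by (simp add: sum.distrib)
  qed simp
  moreover have "(\<Sum>y\<in>X. if R x y then 1 else 0) = card {y \<in> X. R x y}" for x
    using assms(1) by (simp add: sum.If_cases Int_def)
  ultimately show ?thesis
    by simp
qed

section \<open>Clique numbers by color and the classical Ramsey bounds\<close>

context edge_coloring
begin

definition clique :: "nat \<Rightarrow> 'a set \<Rightarrow> bool" where
  "clique i K \<longleftrightarrow> (\<forall>x\<in>K. \<forall>y\<in>K. x \<noteq> y
      \<longrightarrow> e x y = i)"

text \<open>The extremes matter: bound 1 means that the color does not occur and bound 0 that the
  set is empty, so lowering a bound treats all situations uniformly.\<close>

definition clique_bound :: "nat \<Rightarrow> nat \<Rightarrow> 'a set \<Rightarrow> bool" where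
  "clique_bound i m U \<longleftrightarrow> (\<forall>K. K \<subseteq> U \<and> finite K \<and>
      clique i K \<longrightarrow> card K \<le> m)"

definition two_colored :: "nat \<Rightarrow> nat \<Rightarrow> 'a set \<Rightarrow> bool" where
  "two_colored i j X \<longleftrightarrow> (\<forall>x\<in>X. \<forall>y\<in>X. x \<noteq> y
      \<longrightarrow> e x y \<in> {i, j})"

lemma clique_bound_subset: "clique_bound i m U \<Longrightarrow> W \<subseteq> U \<Longrightarrow>
    clique_bound i m W"
  unfolding clique_bound_def by blast

lemma clique_bound_mono: "clique_bound i m U \<Longrightarrow> m \<le> n \<Longrightarrow>
    clique_bound i n U"
  unfolding clique_bound_def using le_trans by blast

lemma clique_boundD: "clique_bound i m U \<Longrightarrow> K \<subseteq> U \<Longrightarrow> finite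
    K \<Longrightarrow> clique i K \<Longrightarrow> card K \<le> m"
  unfolding clique_bound_def by blast

lemma clique_subset: "clique i K \<Longrightarrow> L \<subseteq> K \<Longrightarrow> clique i L"
  unfolding clique_def by blast

lemma not_clique_boundE:
  assumes "\<not> clique_bound i m U"
  obtains K where "K \<subseteq> U" "finite K" "clique i K" "card K = Suc m"
proof -
  obtain L where L: "L \<subseteq> U" "finite L" "clique i L" "Suc m \<le> card L"
    using assms unfolding clique_bound_def by (auto simp: not_le Suc_le_eq)
  obtain K where K: "K \<subseteq> L" "card K = Suc m" "finite K"
    using obtain_subset_with_card_n[OF L(4)] .
  show ?thesis
    using that[of K] K L clique_subset by blast
qed

lemma clique_bound_0: "clique_bound i 0 U \<longleftrightarrow> U = {}"
proof
  assume "clique_bound i 0 U"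
  then have "card {x} \<le> 0" if "x \<in> U" for x
    using that by (intro clique_boundD[of i 0 U]) (auto simp: clique_def)
  then show "U = {}"
    by auto
qed (auto simp: clique_bound_def)

lemma clique_bound_1: "clique_bound i 1 U \<longleftrightarrow> (\<forall>x\<in>U.
    \<forall>y\<in>U. x \<noteq> y \<longrightarrow> e x y \<noteq> i)"
proof (intro iffI ballI impI notI)
  fix x y assume "clique_bound i 1 U" and xy: "x \<in> U" "y \<in> U" "x \<noteq> y" "e x y = i"
  then have "card {x, y} \<le> 1"
    by (intro clique_boundD[of i 1 U]) (auto simp: clique_def sym)
  then show False
    using xy by simp
next
  assume no: "\<forall>x\<in>U. \<forall>y\<in>U. x \<noteq> y \<longrightarrow> e x y \<noteq> i"
  show "clique_bound i 1 U"
    unfolding clique_bound_def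
  proof (intro allI impI)
    fix K assume "K \<subseteq> U \<and> finite K \<and> clique i K"
    then have "x = y" if "x \<in> K" "y \<in> K" for x y
      using that no unfolding clique_def by blast
    then show "card K \<le> 1"
      by (simp add: card_le_Suc0_iff_eq[simplified] \<open>K \<subseteq> U \<and> finite K \<and>
          clique i K\<close>)
  qed
qed

lemma clique_Un:
  assumes "clique i K" "clique i L" "joined i K L"
  shows "clique i (K \<union> L)"
  using assms sym unfolding clique_def joined_def by (metis Un_iff)

text \<open>A clique in \<open>A\<close> extends every clique in \<open>B\<close>. A nonempty
  \<open>A\<close> costs \<open>B\<close> one (\<open>a = 0\<close>), an \<open>A\<close> with an
  edge of the joining color costs it two (\<open>a = 1\<close>).\<close>

lemma clique_bound_joined:
  assumes "clique_bound i m U" "A \<union> B \<subseteq> U" "A \<inter> B = {}" "joined i A B"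
      "\<not> clique_bound i a A"
  shows "clique_bound i (m - Suc a) B"
  unfolding clique_bound_def
proof (intro allI impI)
  fix L assume L: "L \<subseteq> B \<and> finite L \<and> clique i L"
  obtain K where K: "K \<subseteq> A" "finite K" "clique i K" "card K = Suc a"
    using not_clique_boundE[OF assms(5)] .
  have "joined i K L"
    using assms(4) K L unfolding joined_def by blast
  then have "clique i (K \<union> L)"
    using K L clique_Un by blast
  then have "card (K \<union> L) \<le> m"
    using K L assms(1,2) by (intro clique_boundD[OF assms(1)]) auto
  moreover have "card (K \<union> L) = Suc a + card L"
    using K L assms(3) by (subst card_Un_disjoint) auto
  ultimately show "card L \<le> m - Suc a"
    by simp
qed

text \<open>The recursion behind R(a,b) <= R(a-1,b) + R(a,b-1), with the single vertex
  \<open>x\<close> as one of the joined sets. It covers \<open>i = j\<close>, where the two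
  neighbourhoods coincide.\<close>

lemma ramsey_step:
  assumes "finite X" "two_colored i j X" "x \<in> X" "clique_bound i (Suc a) X"
      "clique_bound j (Suc b) X"
  shows "card X \<le> Suc (card {y \<in> X. y \<noteq> x \<and> e x y = i} + card {y \<in> X. y
      \<noteq> x \<and> e x y = j})"
    and "clique_bound i a {y \<in> X. y \<noteq> x \<and> e x y = i}"
    and "clique_bound j b {y \<in> X. y \<noteq> x \<and> e x y = j}"
proof -
  let ?N = "\<lambda>i. {y \<in> X. y \<noteq> x \<and> e x y = i}"
  have "X = insert x (?N i \<union> ?N j)"
    using assms(2,3) unfolding two_colored_def by auto
  then have "card X = Suc (card (?N i \<union> ?N j))"
    using assms(1) card_insert_disjoint[of "?N i \<union> ?N j" x] by simp
  also have "\<dots> \<le> Suc (card (?N i) + card (?N j))"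
    by (simp add: card_Un_le)
  finally show "card X \<le> Suc (card (?N i) + card (?N j))" .
  have "\<not> clique_bound k 0 {x}" for k
    by (simp add: clique_bound_0)
  moreover have "joined k {x} (?N k)" "{x} \<inter> ?N k = {}" "{x} \<union> ?N k \<subseteq> X"
      for k
    using assms(3) by (auto simp: joined_def)
  ultimately have "clique_bound k (m - Suc 0) (?N k)" if "clique_bound k m X" for k m
    using clique_bound_joined[OF that, of "{x}" "?N k" 0] by simp
  from this[of i "Suc a"] this[of j "Suc b"] assms(4,5)
  show "clique_bound i a (?N i)" "clique_bound j b (?N j)"
    by simp_all
qed

lemma two_colored_subset: "two_colored i j X \<Longrightarrow> Y \<subseteq> X \<Longrightarrow>
    two_colored i j Y"
  unfolding two_colored_def by blast

lemma two_colored_swap: "two_colored i j X \<longleftrightarrow> two_colored j i X"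
  unfolding two_colored_def by blast

lemma ramsey_1:
  assumes "finite X" "two_colored i j X" "clique_bound i 1 X" "clique_bound j b X"
  shows "card X \<le> b"
proof (rule clique_boundD[OF assms(4) subset_refl assms(1)])
  show "clique j X"
    using assms(2,3) unfolding clique_def clique_bound_1 two_colored_def by auto
qed

lemma ramsey_2_2:
  assumes "finite X" "two_colored i j X" "clique_bound i 2 X" "clique_bound j 2 X"
  shows "card X \<le> 5"
proof (cases "X = {}")
  case False
  then obtain x where "x \<in> X"
    by blast
  let ?N = "\<lambda>i. {y \<in> X. y \<noteq> x \<and> e x y = i}"
  have s: "clique_bound i (Suc 1) X" "clique_bound j (Suc 1) X"
    using assms by (simp_all add: numeral_2_eq_2)
  note step = ramsey_step[OF assms(1,2) \<open>x \<in> X\<close> s]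
  have "?N k \<subseteq> X" "finite (?N k)" for k
    using assms(1) by auto
  then have "card (?N i) \<le> 2" "card (?N j) \<le> 2"
    using ramsey_1[OF _ _ step(2)] ramsey_1[OF _ _ step(3)] assms two_colored_subset
      clique_bound_subset two_colored_swap by meson+
  then show ?thesis
    using step(1) by simp
qed simp

text \<open>If there were nine vertices, the \<open>j\<close>-colored edges would form a cubic graph on an odd
  number of vertices.\<close>

lemma ramsey_3_2:
  assumes "finite X" "two_colored i j X" "clique_bound i 3 X" "clique_bound j 2 X"
  shows "card X \<le> 8"
proof (cases "i = j \<or> X = {}")
  case True
  then have "card X \<le> 2"
    using clique_boundD[OF assms(4) subset_refl assms(1)] assms(2)
    unfolding clique_def two_colored_def by auto
  then show ?thesis
    by simp
next
  case False
  let ?N = "\<lambda>x i. {y \<in> X. y \<noteq> x \<and> e x y = i}"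
  have s: "clique_bound i (Suc 2) X" "clique_bound j (Suc 1) X"
    using assms by (simp_all add: eval_nat_numeral)
  have *: "card X \<le> Suc (card (?N x i) + card (?N x j)) \<and> card (?N x i) \<le> 5 \<and>
      card (?N x j) \<le> 3"
    if "x \<in> X" for x
  proof -
    note step = ramsey_step[OF assms(1,2) that s]
    have "?N x k \<subseteq> X" "finite (?N x k)" for k
      using assms(1) by auto
    then show ?thesis
      using ramsey_2_2[OF _ _ step(2)] ramsey_1[OF _ _ step(3)] step(1) assms two_colored_subset
        clique_bound_subset two_colored_swap by meson
  qed
  show ?thesis
  proof (rule ccontr)
    assume "\<not> card X \<le> 8"
    then have deg: "card (?N x j) = 3" and nine: "card X = 9" if "x \<in> X" for x
      using *[OF that] by linarith+
    have "even (\<Sum>x\<in>X. card {y \<in> X. y \<noteq> x \<and> e x y = j})"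
      by (rule even_sum_card_symmetric) (use assms(1) sym in auto)
    also have "(\<Sum>x\<in>X. card {y \<in> X. y \<noteq> x \<and> e x y = j}) = (\<Sum>x\<in>X.
        3)"
      by (rule sum.cong) (use deg in auto)
    also have "\<dots> = 27"
      using nine False by auto
    finally show False
      by simp
  qed
qed

lemma ramsey_3_3:
  assumes "finite X" "two_colored i j X" "clique_bound i 3 X" "clique_bound j 3 X"
  shows "card X \<le> 17"
proof (cases "X = {}")
  case False
  then obtain x where "x \<in> X"
    by blast
  let ?N = "\<lambda>i. {y \<in> X. y \<noteq> x \<and> e x y = i}"
  have s: "clique_bound i (Suc 2) X" "clique_bound j (Suc 2) X"
    using assms by (simp_all add: eval_nat_numeral)
  note step = ramsey_step[OF assms(1,2) \<open>x \<in> X\<close> s]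
  have "?N k \<subseteq> X" "finite (?N k)" for k
    using assms(1) by auto
  then have "card (?N i) \<le> 8" "card (?N j) \<le> 8"
    using ramsey_3_2[OF _ _ _ step(2)] ramsey_3_2[OF _ _ _ step(3)] assms two_colored_subset
      clique_bound_subset two_colored_swap by meson+
  then show ?thesis
    using step(1) by simp
qed simp

end

text \<open>A part is light if it contains no edge of color \<open>i\<close> or \<open>j\<close>; \<open>w0\<close> and \<open>w1\<close> bound the sizes of light
  parts and of parts that contain edges of at most one of the two colors.\<close>

locale weighted_parts = edge_coloring +
  fixes i j :: nat and \<P> :: "'a set set" and w0 w1 :: nat
  assumes finite_parts: "finite \<P>" "\<And>P. P \<in> \<P> \<Longrightarrow> finite P"
    and nonempty: "\<And>P. P \<in> \<P> \<Longrightarrow> P \<noteq> {}"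
    and disjoint: "\<And>P Q. P \<in> \<P> \<Longrightarrow> Q \<in> \<P> \<Longrightarrow> P
        \<noteq> Q \<Longrightarrow> P \<inter> Q = {}"
    and joined: "\<And>P Q. P \<in> \<P> \<Longrightarrow> Q \<in> \<P> \<Longrightarrow> P
        \<noteq> Q \<Longrightarrow> joined i P Q \<or> joined j P Q"
    and triangle_free: "\<And>P. P \<in> \<P> \<Longrightarrow> clique_bound i 2 P"
        "\<And>P. P \<in> \<P> \<Longrightarrow> clique_bound j 2 P"
    and light: "\<And>P. P \<in> \<P> \<Longrightarrow> clique_bound i 1 P \<Longrightarrow>
        clique_bound j 1 P \<Longrightarrow> card P \<le> w0"
    and heavy: "\<And>P. P \<in> \<P> \<Longrightarrow> clique_bound j 1 P \<Longrightarrow> card P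
        \<le> w1"
      "\<And>P. P \<in> \<P> \<Longrightarrow> clique_bound i 1 P \<Longrightarrow> card P \<le> w1"
    and w01: "2 * w0 \<le> w1"
begin

lemma swap: "weighted_parts e j i \<P> w0 w1"
  by unfold_locales (fact finite_parts nonempty disjoint triangle_free light heavy w01
    joined[THEN disj_commute[THEN iffD1]] | simp add: light)+

text \<open>The Ramsey recursion with a whole part \<open>A\<close> in place of a vertex. The richer
  \<open>A\<close> is in a color, the smaller the clique number of its neighbourhood in that color.
  The bounds \<open>m\<close> and \<open>n\<close> are left open so that earlier estimates for
  smaller clique numbers can be inserted.\<close>

lemma step:
  assumes "\<Q> \<subseteq> \<P>" "A \<in> \<Q>" "\<not> clique_bound i \<alpha> A"
      "\<not> clique_bound j \<beta> A"
    and "clique_bound i a (\<Union>\<Q>)" "clique_bound j b (\<Union>\<Q>)"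
    and "\<And>\<N>. \<N> \<subseteq> \<Q> \<Longrightarrow> clique_bound i (a - Suc \<alpha>)
        (\<Union>\<N>) \<Longrightarrow> clique_bound j b (\<Union>\<N>) \<Longrightarrow> card
        (\<Union>\<N>) \<le> m"
    and "\<And>\<N>. \<N> \<subseteq> \<Q> \<Longrightarrow> clique_bound i a (\<Union>\<N>)
        \<Longrightarrow> clique_bound j (b - Suc \<beta>) (\<Union>\<N>) \<Longrightarrow> card
        (\<Union>\<N>) \<le> n"
  shows "card (\<Union>\<Q>) \<le> card A + m + n"
proof -
  let ?N = "\<lambda>k. {P \<in> \<Q>. P \<noteq> A \<and> joined k A P}"
  have N: "joined k A (\<Union>(?N k))" "A \<union> \<Union>(?N k) \<subseteq> \<Union>\<Q>" for k
    using assms(2) unfolding joined_def by auto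
  have dis: "A \<inter> \<Union>(?N k) = {}" for k
    using assms(1,2) disjoint by auto
  have "\<Union>(?N k) \<subseteq> \<Union>\<Q>" for k
    by auto
  then have "card (\<Union>(?N i)) \<le> m" "card (\<Union>(?N j)) \<le> n"
    using assms(7)[of "?N i"] assms(8)[of "?N j"]
      clique_bound_joined[OF assms(5) N(2) dis N(1) assms(3)]
      clique_bound_joined[OF assms(6) N(2) dis N(1) assms(4)]
      clique_bound_subset[OF assms(5)] clique_bound_subset[OF assms(6)] by auto
  moreover have "\<Union>\<Q> = A \<union> (\<Union>(?N i) \<union> \<Union>(?N j))"
    using assms(1,2) joined by blast
  then have "card (\<Union>\<Q>) \<le> card A + (card (\<Union>(?N i)) + card (\<Union>(?N j)))"
    using card_Un_le[of A "\<Union>(?N i) \<union> \<Union>(?N j)"] card_Un_le[of "\<Union>(?N i)"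
        "\<Union>(?N j)"] by simp
  ultimately show ?thesis
    by linarith
qed

lemma not_empty_bound: "A \<in> \<Q> \<Longrightarrow> \<Q> \<subseteq> \<P> \<Longrightarrow>
    \<not> clique_bound k 0 A"
  using nonempty by (auto simp: clique_bound_0)

text \<open>One representative per part gives a two-colored complete graph, so the classical bound
  limits the number of parts, each of weight at most \<open>w0\<close>.\<close>

lemma card_light:
  assumes "\<Q> \<subseteq> \<P>" "\<And>A. A \<in> \<Q> \<Longrightarrow> clique_bound i 1 A
      \<and> clique_bound j 1 A"
    and "clique_bound i a (\<Union>\<Q>)" "clique_bound j b (\<Union>\<Q>)"
    and ramsey: "\<And>X. finite X \<Longrightarrow> two_colored i j X \<Longrightarrow>
        clique_bound i a X \<Longrightarrow> clique_bound j b X \<Longrightarrow> card X \<le> m"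
  shows "card (\<Union>\<Q>) \<le> m * w0"
proof -
  obtain f where f: "\<And>A. A \<in> \<Q> \<Longrightarrow> f A \<in> A"
    using nonempty assms(1) by (metis ex_in_conv subset_iff)
  have finQ: "finite \<Q>"
    using assms(1) finite_parts(1) by (rule finite_subset)
  have inj: "inj_on f \<Q>"
  proof (rule inj_onI, rule ccontr)
    fix A B assume "A \<in> \<Q>" "B \<in> \<Q>" "f A = f B" "A \<noteq> B"
    then show False
      using disjoint[of A B] f[of A] f[of B] assms(1) by auto
  qed
  have "e (f A) (f B) \<in> {i, j}" if "A \<in> \<Q>" "B \<in> \<Q>" "f A \<noteq> f B" for A B
  proof -
    have "joined i A B \<or> joined j A B"
      using that assms(1) by (intro joined) auto
    then show ?thesis
      using f[OF that(1)] f[OF that(2)] unfolding joined_def by blast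
  qed
  then have "two_colored i j (f ` \<Q>)"
    unfolding two_colored_def by blast
  moreover have "f ` \<Q> \<subseteq> \<Union>\<Q>"
    using f by blast
  ultimately have "card (f ` \<Q>) \<le> m"
    using clique_bound_subset[OF assms(3)] clique_bound_subset[OF assms(4)]
    by (intro ramsey) (simp_all add: finQ)
  then have "card \<Q> \<le> m"
    using card_image[OF inj] by simp
  have "card (\<Union>\<Q>) \<le> (\<Sum>A\<in>\<Q>. card A)"
    using card_Union_le_sum_card by blast
  also have "\<dots> \<le> (\<Sum>A\<in>\<Q>. w0)"
    by (rule sum_mono) (use assms(1,2) light in blast)
  also have "\<dots> \<le> m * w0"
    using \<open>card \<Q> \<le> m\<close> by simp
  finally show ?thesis .
qed

text \<open>In \<open>card_a_b\<close> the numbers are the clique bounds for \<open>i\<close> and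
  \<open>j\<close>. Here a second part would already create an edge of color \<open>i\<close> or
  \<open>j\<close>.\<close>

lemma card_1_1:
  assumes "\<Q> \<subseteq> \<P>" "clique_bound i 1 (\<Union>\<Q>)"
      "clique_bound j 1 (\<Union>\<Q>)"
  shows "card (\<Union>\<Q>) \<le> w0"
proof (cases "\<Q> = {}")
  case False
  then obtain A where A: "A \<in> \<Q>"
    by blast
  have "card (\<Union>\<Q>) \<le> card A + 0 + 0"
    by (rule step[OF assms(1) A not_empty_bound[OF A assms(1)] not_empty_bound[OF A assms(1)]
        assms(2,3)])
      (simp_all add: clique_bound_0 del: Sup_bot_conv)
  moreover have "card A \<le> w0"
    using assms A clique_bound_subset by (intro light) blast+
  ultimately show ?thesis
    by simp
qed simp

text \<open>A part with an \<open>i\<close>-edge excludes all other parts, which gives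
  \<open>w1\<close>; a light part leaves room for weight \<open>w0\<close> besides itself, and
  \<open>w01\<close> absorbs the sum.\<close>

lemma card_2_1:
  assumes "\<Q> \<subseteq> \<P>" "clique_bound i 2 (\<Union>\<Q>)"
      "clique_bound j 1 (\<Union>\<Q>)"
  shows "card (\<Union>\<Q>) \<le> w1"
proof (cases "\<Q> = {}")
  case False
  then obtain A where A: "A \<in> \<Q>"
    by blast
  have A1: "A \<in> \<P>" "clique_bound j 1 A"
    using assms A clique_bound_subset by blast+
  note ne = not_empty_bound[OF A assms(1)]
  show ?thesis
  proof (cases "clique_bound i 1 A")
    case True
    have "card (\<Union>\<Q>) \<le> card A + w0 + 0"
      by (rule step[OF assms(1) A ne ne assms(2,3)])
        (use assms(1) card_1_1 in \<open>auto simp: clique_bound_0 eval_nat_numeral simp del: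
            Sup_bot_conv\<close>)
    then show ?thesis
      using light[OF A1(1) True A1(2)] w01 by simp
  next
    case False
    have "card (\<Union>\<Q>) \<le> card A + 0 + 0"
      by (rule step[OF assms(1) A False ne assms(2,3)])
        (auto simp: clique_bound_0 eval_nat_numeral simp del: Sup_bot_conv)
    then show ?thesis
      using heavy(1)[OF A1] by simp
  qed
qed simp

text \<open>Either choice of the part \<open>A\<close> gives the same sum: a light part next to a
  family of type \<open>card_2_1\<close>, or a part with an \<open>i\<close>-edge next to one of
  type \<open>card_1_1\<close>.\<close>

lemma card_3_1:
  assumes "\<Q> \<subseteq> \<P>" "clique_bound i 3 (\<Union>\<Q>)"
      "clique_bound j 1 (\<Union>\<Q>)"
  shows "card (\<Union>\<Q>) \<le> w0 + w1"
proof (cases "\<Q> = {}")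
  case False
  then obtain A where A: "A \<in> \<Q>"
    by blast
  have A1: "A \<in> \<P>" "clique_bound j 1 A"
    using assms A clique_bound_subset by blast+
  note ne = not_empty_bound[OF A assms(1)]
  show ?thesis
  proof (cases "clique_bound i 1 A")
    case True
    have "card (\<Union>\<Q>) \<le> card A + w1 + 0"
      by (rule step[OF assms(1) A ne ne assms(2,3)])
        (use assms(1) card_2_1 in \<open>auto simp: clique_bound_0 eval_nat_numeral simp del:
            Sup_bot_conv\<close>)
    then show ?thesis
      using light[OF A1(1) True A1(2)] by simp
  next
    case False
    have "card (\<Union>\<Q>) \<le> card A + w0 + 0"
      by (rule step[OF assms(1) A False ne assms(2,3)])
        (use assms(1) card_1_1 in \<open>auto simp: clique_bound_0 eval_nat_numeral simp del:
            Sup_bot_conv\<close>)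
    then show ?thesis
      using heavy(1)[OF A1] by simp
  qed
qed simp

lemma card_2_2_light:
  assumes "\<And>P. P \<in> \<P> \<Longrightarrow> clique_bound i 1 P \<and> clique_bound j 1 P"
    and "clique_bound i 2 (\<Union>\<P>)" "clique_bound j 2 (\<Union>\<P>)"
  shows "card (\<Union>\<P>) \<le> 5 * w0"
  by (rule card_light[OF subset_refl assms ramsey_2_2[of _ i j]])

text \<open>If some part has an \<open>i\<close>-edge it weighs at most \<open>w1\<close>. Its
  \<open>i\<close>-neighbourhood has no \<open>i\<close>-edge left and thus at most two light parts,
  weight \<open>2 * w0\<close>; its \<open>j\<close>-neighbourhood weighs at most
  \<open>w0 + w1\<close>. This is the second lower bound on \<open>M\<close>, the first being eight
  light parts.\<close>

lemma card_3_2_light: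
  assumes "\<And>P. P \<in> \<P> \<Longrightarrow> clique_bound j 1 P"
    and cb: "clique_bound i 3 (\<Union>\<P>)" "clique_bound j 2 (\<Union>\<P>)"
    and M: "8 * w0 \<le> M" "3 * w0 + 2 * w1 \<le> M"
  shows "card (\<Union>\<P>) \<le> M"
proof (cases "\<forall>P\<in>\<P>. clique_bound i 1 P")
  case True
  then have "card (\<Union>\<P>) \<le> 8 * w0"
    using assms(1) by (intro card_light[OF subset_refl _ cb ramsey_3_2[of _ i j]]) auto
  then show ?thesis
    using M by simp
next
  case False
  then obtain A where A: "A \<in> \<P>" "\<not> clique_bound i 1 A"
    by blast
  note ne = not_empty_bound[OF A(1) subset_refl]
  have "card (\<Union>\<P>) \<le> card A + 2 * w0 + (w0 + w1)"
  proof (rule step[OF subset_refl A ne cb])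
    fix \<N> assume N: "\<N> \<subseteq> \<P>" "clique_bound i (3 - Suc 1) (\<Union>\<N>)"
        "clique_bound j 2 (\<Union>\<N>)"
    then have i1: "clique_bound i 1 (\<Union>\<N>)"
      by simp
    then have "clique_bound i 1 P" if "P \<in> \<N>" for P
      using that clique_bound_subset by blast
    then show "card (\<Union>\<N>) \<le> 2 * w0"
      using N assms(1) by (intro card_light[OF N(1) _ i1 N(3) ramsey_1[of _ i j]]) auto
  next
    fix \<N> assume "\<N> \<subseteq> \<P>" "clique_bound i 3 (\<Union>\<N>)"
        "clique_bound j (2 - Suc 0) (\<Union>\<N>)"
    then show "card (\<Union>\<N>) \<le> w0 + w1"
      by (intro card_3_1) simp_all
  qed
  then show ?thesis
    using heavy(1)[OF A(1) assms(1)[OF A(1)]] M by simp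
qed

end

text \<open>The setting for two B3+ colors, where a part may contain edges of both colors. The
  ratios 8/3 and 16/3 are attained by the values 9, 24, 48 of \<open>gr_bound\<close>.\<close>

locale ratio_parts = weighted_parts +
  fixes w2 :: nat
  assumes any: "\<And>P. P \<in> \<P> \<Longrightarrow> card P \<le> w2"
    and ratio: "3 * w1 \<le> 8 * w0" "3 * w2 \<le> 16 * w0"
begin

lemma ratio_swap: "ratio_parts e j i \<P> w0 w1 w2"
  using swap any ratio by (simp add: ratio_parts_def ratio_parts_axioms_def)

text \<open>Light parts alone give \<open>5 * w0\<close>. A part with edges of both colors is the
  whole family (\<open>w2\<close>), one with edges of a single color leaves at most
  \<open>w1\<close> (in total \<open>2 * w1\<close>); both amount to at most 16/3 of
  \<open>w0\<close>, hence the factor 3.\<close>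

lemma card_2_2:
  assumes "\<Q> \<subseteq> \<P>" and cb: "clique_bound i 2 (\<Union>\<Q>)"
      "clique_bound j 2 (\<Union>\<Q>)"
  shows "3 * card (\<Union>\<Q>) \<le> 16 * w0"
proof (cases "\<forall>A\<in>\<Q>. clique_bound i 1 A \<and> clique_bound j 1 A")
  case True
  then have "card (\<Union>\<Q>) \<le> 5 * w0"
    by (intro card_light[OF assms(1) _ cb ramsey_2_2[of _ i j]]) auto
  then show ?thesis
    by simp
next
  case False
  then obtain A where A: "A \<in> \<Q>" "\<not> (clique_bound i 1 A \<and> clique_bound j 1 A)"
    by blast
  interpret sw: weighted_parts e j i \<P> w0 w1
    by (rule swap)
  have P: "A \<in> \<P>"
    using A assms by blast
  note ne = not_empty_bound[OF A(1) assms(1)]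
  note [simp] = clique_bound_0 eval_nat_numeral
  note [simp del] = Sup_bot_conv
  consider "\<not> clique_bound i 1 A" "\<not> clique_bound j 1 A" | "\<not> clique_bound i 1 A"
      "clique_bound j 1 A"
    | "clique_bound i 1 A" "\<not> clique_bound j 1 A"
    using A(2) by blast
  then show ?thesis
  proof cases
    case 1
    have "card (\<Union>\<Q>) \<le> card A + 0 + 0"
      by (rule step[OF assms(1) A(1) 1 cb]) auto
    then show ?thesis
      using any[OF P] ratio by linarith
  next
    case 2
    have "card (\<Union>\<Q>) \<le> card A + 0 + w1"
      by (rule step[OF assms(1) A(1) 2(1) ne cb]) (use assms(1) card_2_1 in auto)
    then show ?thesis
      using heavy(1)[OF P 2(2)] ratio by linarith
  next
    case 3
    have "card (\<Union>\<Q>) \<le> card A + w1 + 0"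
      by (rule step[OF assms(1) A(1) ne 3(2) cb]) (use assms(1) sw.card_2_1 in auto)
    then show ?thesis
      using heavy(2)[OF P 3(1)] ratio by linarith
  qed
qed

text \<open>The 9 comes from a part with \<open>i\<close>-edges but no \<open>j\<close>-edge:
  \<open>w1 + w1 + (w0 + w1)\<close>, where \<open>3 * w1\<close> is at most \<open>8 * w0\<close>.
  The other cases give at most \<open>8 * w0\<close>.\<close>

lemma card_3_2:
  assumes "\<Q> \<subseteq> \<P>" and cb: "clique_bound i 3 (\<Union>\<Q>)"
      "clique_bound j 2 (\<Union>\<Q>)"
  shows "card (\<Union>\<Q>) \<le> 9 * w0"
proof (cases "\<forall>A\<in>\<Q>. clique_bound i 1 A \<and> clique_bound j 1 A")
  case True
  then have "card (\<Union>\<Q>) \<le> 8 * w0"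
    by (intro card_light[OF assms(1) _ cb ramsey_3_2[of _ i j]]) auto
  then show ?thesis
    by simp
next
  case False
  then obtain A where A: "A \<in> \<Q>" "\<not> (clique_bound i 1 A \<and> clique_bound j 1 A)"
    by blast
  interpret sw: weighted_parts e j i \<P> w0 w1
    by (rule swap)
  have P: "A \<in> \<P>"
    using A assms by blast
  note ne = not_empty_bound[OF A(1) assms(1)]
  note [simp] = clique_bound_0 eval_nat_numeral
  note [simp del] = Sup_bot_conv
  consider "\<not> clique_bound i 1 A" "\<not> clique_bound j 1 A" | "\<not> clique_bound i 1 A"
      "clique_bound j 1 A"
    | "clique_bound i 1 A" "\<not> clique_bound j 1 A"
    using A(2) by blast
  then show ?thesis
  proof cases
    case 1
    have "card (\<Union>\<Q>) \<le> card A + w1 + 0"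
      by (rule step[OF assms(1) A(1) 1 cb]) (use assms(1) sw.card_2_1 in auto)
    then show ?thesis
      using any[OF P] ratio by linarith
  next
    case 2
    have "card (\<Union>\<Q>) \<le> card A + w1 + (w0 + w1)"
      by (rule step[OF assms(1) A(1) 2(1) ne cb]) (use assms(1) sw.card_2_1 card_3_1 in auto)
    then show ?thesis
      using heavy(1)[OF P 2(2)] ratio by linarith
  next
    case 3
    have "card (\<Union>\<Q>) \<le> card A + 16 * w0 div 3 + 0"
    proof (rule step[OF assms(1) A(1) ne 3(2) cb])
      fix \<N> assume "\<N> \<subseteq> \<Q>" "clique_bound i (3 - Suc 0) (\<Union>\<N>)"
          "clique_bound j 2 (\<Union>\<N>)"
      then have "3 * card (\<Union>\<N>) \<le> 16 * w0"
        using assms(1) by (intro card_2_2) auto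
      then show "card (\<Union>\<N>) \<le> 16 * w0 div 3"
        by linarith
    qed auto
    then show ?thesis
      using heavy(2)[OF P 3(1)] ratio by linarith
  qed
qed

text \<open>Only the case of light parts needs 17. A part with edges of both colors leads to
  \<open>w2 + 2 * (w0 + w1)\<close>, one with edges of a single color to
  \<open>w1 + (w0 + w1) + 9 * w0\<close>, that is, 38/3 and 46/3 of \<open>w0\<close> by the
  ratios.\<close>

lemma card_3_3:
  assumes cb: "clique_bound i 3 (\<Union>\<P>)" "clique_bound j 3 (\<Union>\<P>)"
  shows "card (\<Union>\<P>) \<le> 17 * w0"
proof (cases "\<forall>A\<in>\<P>. clique_bound i 1 A \<and> clique_bound j 1 A")
  case True
  then show ?thesis
    by (intro card_light[OF subset_refl _ cb ramsey_3_3[of _ i j]]) auto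
next
  case False
  then obtain A where A: "A \<in> \<P>" "\<not> (clique_bound i 1 A \<and> clique_bound j 1 A)"
    by blast
  interpret sw: ratio_parts e j i \<P> w0 w1 w2
    by (rule ratio_swap)
  note ne = not_empty_bound[OF A(1) subset_refl]
  note [simp] = clique_bound_0 eval_nat_numeral
  note [simp del] = Sup_bot_conv
  consider "\<not> clique_bound i 1 A" "\<not> clique_bound j 1 A" | "\<not> clique_bound i 1 A"
      "clique_bound j 1 A"
    | "clique_bound i 1 A" "\<not> clique_bound j 1 A"
    using A(2) by blast
  then show ?thesis
  proof cases
    case 1
    have "card (\<Union>\<P>) \<le> card A + (w0 + w1) + (w0 + w1)"
      by (rule step[OF subset_refl A(1) 1 cb]) (use sw.card_3_1 card_3_1 in auto)
    then show ?thesis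
      using any[OF A(1)] ratio by linarith
  next
    case 2
    have "card (\<Union>\<P>) \<le> card A + (w0 + w1) + 9 * w0"
      by (rule step[OF subset_refl A(1) 2(1) ne cb]) (use sw.card_3_1 card_3_2 in auto)
    then show ?thesis
      using heavy(1)[OF A(1) 2(2)] ratio by linarith
  next
    case 3
    have "card (\<Union>\<P>) \<le> card A + 9 * w0 + (w0 + w1)"
      by (rule step[OF subset_refl A(1) ne 3(2) cb]) (use card_3_1 sw.card_3_2 in auto)
    then show ?thesis
      using heavy(2)[OF A(1) 3(1)] ratio by linarith
  qed
qed

end

section \<open>Joined sets\<close>

text \<open>\<open>Book\<close>, \<open>Paw\<close> and \<open>Triangle\<close> forbid monochromatic copies of \<open>B\<^sub>3\<^sup>+\<close>, \<open>S\<^sub>3\<^sup>+\<close> and \<open>K\<^sub>3\<close>;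
  \<open>Absent\<close> means that the color is not used.\<close>

datatype constraint = Book | Paw | Triangle | Absent

context edge_coloring
begin

text \<open>B3+ is viewed as a K4 with a fifth vertex joined to two of its vertices; these two,
  \<open>a\<close> and \<open>b\<close>, are the spine of the book.\<close>

definition book_free :: "nat \<Rightarrow> 'a set \<Rightarrow> bool" where
  "book_free i U \<longleftrightarrow> \<not> (\<exists>a b c d v. {a, b, c, d, v} \<subseteq> U
      \<and> distinct [a, b, c, d, v] \<and>
     clique i {a, b, c, d} \<and> e a v = i \<and> e b v = i)"

definition paw_free :: "nat \<Rightarrow> 'a set \<Rightarrow> bool" where
  "paw_free i U \<longleftrightarrow> \<not> (\<exists>a b c v. {a, b, c, v} \<subseteq> U \<and>
      distinct [a, b, c, v] \<and>
     clique i {a, b, c} \<and> e a v = i)"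

lemma clique_insert [simp]: "clique i (insert x K) \<longleftrightarrow> clique i K \<and>
    (\<forall>y\<in>K. y \<noteq> x \<longrightarrow> e x y = i)"
  unfolding clique_def using sym by auto

lemma clique_empty [simp]: "clique i {}"
  by (simp add: clique_def)

lemma book_freeD:
  "book_free i U \<Longrightarrow> {a, b, c, d, v} \<subseteq> U \<Longrightarrow> distinct [a, b,
      c, d, v] \<Longrightarrow>
    clique i {a, b, c, d} \<Longrightarrow> e a v = i \<Longrightarrow> e b v = i \<Longrightarrow>
        False"
  unfolding book_free_def by blast

lemma paw_freeD:
  "paw_free i U \<Longrightarrow> {a, b, c, v} \<subseteq> U \<Longrightarrow> distinct [a, b, c,
      v] \<Longrightarrow>
    clique i {a, b, c} \<Longrightarrow> e a v = i \<Longrightarrow> False"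
  unfolding paw_free_def by blast

lemma book_free_subset: "book_free i U \<Longrightarrow> W \<subseteq> U \<Longrightarrow>
    book_free i W"
  unfolding book_free_def[of i W] using book_freeD[of i U] subset_trans[of _ W U] by metis

lemma paw_free_subset: "paw_free i U \<Longrightarrow> W \<subseteq> U \<Longrightarrow> paw_free i
    W"
  unfolding paw_free_def[of i W] using paw_freeD[of i U] subset_trans[of _ W U] by metis

lemma not_clique_bound_1E:
  assumes "\<not> clique_bound i 1 U"
  obtains x y where "x \<in> U" "y \<in> U" "x \<noteq> y" "e x y = i"
  using assms unfolding clique_bound_1 by blast

lemma not_clique_bound_2E:
  assumes "\<not> clique_bound i 2 U"
  obtains x y z where "x \<in> U" "y \<in> U" "z \<in> U" "x \<noteq> y" "x \<noteq> z"
      "y \<noteq> z" "clique i {x, y, z}"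
proof -
  obtain K where K: "K \<subseteq> U" "finite K" "clique i K" "card K = Suc 2"
    using not_clique_boundE[OF assms] .
  then have "card K = 3"
    by simp
  then obtain x y z where "K = {x, y, z}" "x \<noteq> y" "y \<noteq> z" "x \<noteq> z"
    unfolding card_3_iff by blast
  then show ?thesis
    using that[of x y z] K(1,3) by simp
qed

text \<open>An edge in \<open>A\<close> and a vertex \<open>b\<close> of \<open>B\<close> form a
  triangle. A further vertex of \<open>A\<close> hangs on \<open>b\<close>, one of \<open>B\<close>
  hangs on the edge.\<close>

lemma joined_paw_free:
  assumes "paw_free l (A \<union> B)" "joined l A B" "A \<inter> B = {}" "B \<noteq> {}"
      "\<not> clique_bound l 1 A"
  shows "card (A \<union> B) \<le> 3"
proof -
  obtain x y where xy: "x \<in> A" "y \<in> A" "x \<noteq> y" "e x y = l" "e y x = l"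
    using not_clique_bound_1E[OF assms(5)] sym by metis
  obtain b where b: "b \<in> B"
    using assms(4) by blast
  have j: "e p q = l" "e q p = l" "p \<noteq> q" if "p \<in> A" "q \<in> B" for p q
    using that assms(2,3) sym unfolding joined_def by auto
  have "A \<union> B \<subseteq> {x, y, b}"
  proof (rule ccontr)
    assume "\<not> A \<union> B \<subseteq> {x, y, b}"
    then obtain z where z: "z \<in> A \<union> B" "z \<notin> {x, y, b}"
      by blast
    show False
    proof (cases "z \<in> A")
      case True
      show False
        by (rule paw_freeD[OF assms(1), of b x y z]) (use xy b z True j[OF xy(1) b] j[OF xy(2) b]
            j[OF True b] in auto)
    next
      case False
      then have zB: "z \<in> B"
        using z by blast
      show False
        by (rule paw_freeD[OF assms(1), of x y b z]) (use xy b z j[OF xy(1) b] j[OF xy(2) b] j[OF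
            xy(1) zB] in auto)
    qed
  qed
  then have "card (A \<union> B) \<le> card {x, y, b}"
    by (intro card_mono) auto
  also have "\<dots> \<le> 3"
    by (simp add: card_insert_if)
  finally show ?thesis .
qed

text \<open>An edge on each side gives a K4, and a fifth vertex sees both ends of the edge on the
  opposite side.\<close>

lemma joined_book_free_edges:
  assumes "book_free l (A \<union> B)" "joined l A B" "A \<inter> B = {}"
    and "\<not> clique_bound l 1 A" "\<not> clique_bound l 1 B"
  shows "card (A \<union> B) \<le> 4"
proof -
  obtain x y where xy: "x \<in> A" "y \<in> A" "x \<noteq> y" "e x y = l" "e y x = l"
    using not_clique_bound_1E[OF assms(4)] sym by metis
  obtain u v where uv: "u \<in> B" "v \<in> B" "u \<noteq> v" "e u v = l" "e v u = l"
    using not_clique_bound_1E[OF assms(5)] sym by metis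
  have j: "e p q = l" "e q p = l" "p \<noteq> q" if "p \<in> A" "q \<in> B" for p q
    using that assms(2,3) sym unfolding joined_def by auto
  note juv = j[OF xy(1) uv(1)] j[OF xy(2) uv(1)] j[OF xy(1) uv(2)] j[OF xy(2) uv(2)]
  have "A \<union> B \<subseteq> {x, y, u, v}"
  proof (rule ccontr)
    assume "\<not> A \<union> B \<subseteq> {x, y, u, v}"
    then obtain z where z: "z \<in> A \<union> B" "z \<notin> {x, y, u, v}"
      by blast
    show False
    proof (cases "z \<in> A")
      case True
      show False
        by (rule book_freeD[OF assms(1), of u v x y z]) (use xy uv z True juv j[OF True uv(1)] j[OF
            True uv(2)] in auto)
    next
      case False
      then have zB: "z \<in> B"
        using z by blast
      show False
        by (rule book_freeD[OF assms(1), of x y u v z]) (use xy uv z zB juv j[OF xy(1) zB] j[OF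
            xy(2) zB] in auto)
    qed
  qed
  then have "card (A \<union> B) \<le> card {x, y, u, v}"
    by (intro card_mono) auto
  also have "\<dots> \<le> 4"
    by (simp add: card_insert_if)
  finally show ?thesis .
qed

text \<open>A triangle in \<open>A\<close> and \<open>b\<close> form a K4, and \<open>b'\<close>
  sees three of its vertices.\<close>

lemma joined_book_free_triangle:
  assumes "book_free l (A \<union> B)" "joined l A B" "A \<inter> B = {}"
      "\<not> clique_bound l 2 A" "b \<in> B" "b' \<in> B"
  shows "b = b'"
proof (rule ccontr)
  assume ne: "b \<noteq> b'"
  obtain x y z where xyz: "x \<in> A" "y \<in> A" "z \<in> A" "x \<noteq> y" "x \<noteq> z"
      "y \<noteq> z" "clique l {x, y, z}"
    using not_clique_bound_2E[OF assms(4)] .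
  have j: "e p q = l" "e q p = l" "p \<noteq> q" if "p \<in> A" "q \<in> B" for p q
    using that assms(2,3) sym unfolding joined_def by auto
  show False
    by (rule book_freeD[OF assms(1), of x y z b b'])
      (use xyz ne assms(5,6) xyz(1-3)[THEN j(1), OF assms(5)] xyz(1-3)[THEN j(2), OF assms(5)]
        xyz(1-3)[THEN j(3), OF assms(5)] xyz(1-3)[THEN j(1), OF assms(6)]
        xyz(1-3)[THEN j(3), OF assms(6)] in auto)
qed

text \<open>Adding \<open>b\<close> to a paw with vertex \<open>x\<close> of degree three gives B3+
  with spine \<open>x\<close>, \<open>b\<close>.\<close>

lemma joined_book_free_vertex:
  assumes "book_free l (A \<union> B)" "joined l A B" "A \<inter> B = {}" "b \<in> B"
  shows "paw_free l A"
  unfolding paw_free_def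
proof
  assume "\<exists>x y z v. {x, y, z, v} \<subseteq> A \<and> distinct [x, y, z, v] \<and> clique l
      {x, y, z} \<and> e x v = l"
  then obtain x y z v where w: "{x, y, z, v} \<subseteq> A" "distinct [x, y, z, v]"
      "clique l {x, y, z}" "e x v = l"
    by blast
  have j: "e p b = l" "e b p = l" "p \<noteq> b" if "p \<in> A" for p
    using that assms(2,3,4) sym unfolding joined_def by auto
  show False
    by (rule book_freeD[OF assms(1), of x b y z v]) (use w j[of x] j[of y] j[of z] j[of v] assms(4)
        in auto)
qed

definition obeys :: "constraint \<Rightarrow> nat \<Rightarrow> 'a set \<Rightarrow> bool" where
  "obeys s i U \<longleftrightarrow> (case s of Book \<Rightarrow> book_free i U | Paw
      \<Rightarrow> paw_free i U
     | Triangle \<Rightarrow> clique_bound i 2 U | Absent \<Rightarrow> clique_bound i 1 U)"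

lemma obeys_simps [simp]:
  "obeys Book i U = book_free i U" "obeys Paw i U = paw_free i U"
  "obeys Triangle i U = clique_bound i 2 U" "obeys Absent i U = clique_bound i 1 U"
  by (simp_all add: obeys_def)

lemma obeys_subset: "obeys s i U \<Longrightarrow> W \<subseteq> U \<Longrightarrow> obeys s i W"
  by (cases s) (auto intro: book_free_subset paw_free_subset clique_bound_subset)

text \<open>All natural numbers count as colors; those outside the palette are given the constraint
  \<open>Absent\<close>.\<close>

definition obeys_all :: "(nat \<Rightarrow> constraint) \<Rightarrow> 'a set \<Rightarrow> bool"
    where
  "obeys_all \<tau> U \<longleftrightarrow> (\<forall>i. obeys (\<tau> i) i U)"

lemma obeys_all_upd: "obeys_all \<tau> V \<Longrightarrow> U \<subseteq> V \<Longrightarrow> obeys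
    s i U \<Longrightarrow> obeys_all (\<tau>(i := s)) U"
  unfolding obeys_all_def using obeys_subset by (metis fun_upd_apply)

end

section \<open>Profiles: counting the colors under each constraint\<close>

definition profile_bound :: "(nat \<Rightarrow> constraint) \<Rightarrow> nat" where
  "profile_bound \<tau> = gr_bound (card {i. \<tau> i = Book}) (card {i. \<tau> i = Paw}) (card {i.
      \<tau> i = Triangle})"

definition finite_profile :: "(nat \<Rightarrow> constraint) \<Rightarrow> bool" where
  "finite_profile \<tau> \<longleftrightarrow> finite {i. \<tau> i \<noteq> Absent}"

lemma finite_profile_upd: "finite_profile \<tau> \<Longrightarrow> finite_profile (\<tau>(i := s))"
  unfolding finite_profile_def by (rule finite_subset[of _
      "insert i {i. \<tau> i \<noteq> Absent}"]) auto

text \<open>The profile with \<open>i\<close> set to \<open>Absent\<close> is a common base point: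
  every change of the constraint on \<open>i\<close> then only adds to the counts and no subtraction
  appears.\<close>

lemma card_profile_upd:
  assumes "finite_profile \<tau>" "a \<noteq> Absent"
  shows "card {k. (\<tau>(i := s)) k = a} = card {k. (\<tau>(i := Absent)) k = a} + of_bool (s = a)"
proof -
  have fin: "finite {k. (\<tau>(i := Absent)) k = a}"
    using assms by (intro finite_subset[OF _ assms(1)[unfolded finite_profile_def]]) (auto split:
        if_splits)
  have "{k. (\<tau>(i := s)) k = a} = (if s = a then insert i else id) {k. (\<tau>(i := Absent)) k
      = a}"
    using assms by auto
  then show ?thesis
    using fin assms by auto
qed

lemma profile_bound_upd:
  assumes "finite_profile \<tau>"
  shows "profile_bound (\<tau>(i := s)) = gr_bound (card {k. (\<tau>(i := Absent)) k = Book} +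
      of_bool (s = Book))
    (card {k. (\<tau>(i := Absent)) k = Paw} + of_bool (s = Paw))
    (card {k. (\<tau>(i := Absent)) k = Triangle} + of_bool (s = Triangle))"
  unfolding profile_bound_def using assms by (subst (1 2 3) card_profile_upd) simp_all

definition other_count :: "(nat \<Rightarrow> constraint) \<Rightarrow> nat \<Rightarrow> nat
    \<Rightarrow> constraint \<Rightarrow> nat" where
  "other_count \<tau> i j a = card {k. k \<noteq> i \<and> k \<noteq> j \<and> \<tau> k = a}"

lemma other_count_swap: "other_count \<tau> j i a = other_count \<tau> i j a"
  unfolding other_count_def by (rule arg_cong[of _ _ card]) auto

lemma profile_bound_upd2:
  assumes "finite_profile \<tau>" "i \<noteq> j"
  shows "profile_bound (\<tau>(i := a, j := b)) = gr_bound
    (other_count \<tau> i j Book + of_bool (a = Book) + of_bool (b = Book))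
    (other_count \<tau> i j Paw + of_bool (a = Paw) + of_bool (b = Paw))
    (other_count \<tau> i j Triangle + of_bool (a = Triangle) + of_bool (b = Triangle))"
proof -
  have fin: "finite_profile (\<tau>(i := a))" "finite_profile (\<tau>(j := Absent))"
    using assms(1) by (simp_all add: finite_profile_upd)
  have "card {k. (\<tau>(i := a, j := Absent)) k = c} = other_count \<tau> i j c + of_bool (a = c)"
    if "c \<noteq> Absent" for c
  proof -
    have "{k. (\<tau>(j := Absent, i := Absent)) k = c} = {k. k \<noteq> i \<and> k \<noteq> j
        \<and> \<tau> k = c}"
      using that by auto
    then show ?thesis
      using card_profile_upd[OF fin(2) that, of i a] assms(2)
      by (simp add: fun_upd_twist other_count_def)
  qed
  then show ?thesis
    unfolding profile_bound_upd[OF fin(1)] by simp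
qed

section \<open>Two sets completely joined in one color\<close>

context edge_coloring
begin

text \<open>The induction hypothesis as a predicate. The profile varies, because subsets are
  measured against stronger constraints than the whole.\<close>

definition hereditarily_bounded :: "'a set \<Rightarrow> bool" where
  "hereditarily_bounded V \<longleftrightarrow> (\<forall>U \<tau>. U \<subset> V \<longrightarrow>
      finite_profile \<tau> \<longrightarrow> obeys_all \<tau> U \<longrightarrow> card U \<le>
      profile_bound \<tau>)"

lemma hereditarily_boundedD:
  "hereditarily_bounded V \<Longrightarrow> U \<subset> V \<Longrightarrow> finite_profile \<tau>
      \<Longrightarrow> obeys_all \<tau> U \<Longrightarrow> card U \<le> profile_bound \<tau>"
  unfolding hereditarily_bounded_def by simp

definition bipartition :: "'a set \<Rightarrow> 'a set \<Rightarrow> 'a set \<Rightarrow> bool"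
    where
  "bipartition V A B \<longleftrightarrow> A \<union> B = V \<and> A \<inter> B = {} \<and> A
      \<noteq> {} \<and> B \<noteq> {}"

lemma bipartition_sym: "bipartition V A B \<longleftrightarrow> bipartition V B A"
  unfolding bipartition_def by blast

lemma joined_book_cases:
  assumes "book_free i V" "bipartition V A B" "joined i A B" "clique_bound i 1 A"
  shows "clique_bound i 2 B \<or> (paw_free i B \<and> card A = 1)"
proof (cases "clique_bound i 2 B")
  case False
  have AB: "B \<union> A = V" "joined i B A" "B \<inter> A = {}"
    using assms(2,3) joined_sym unfolding bipartition_def by blast+
  obtain a where a: "a \<in> A"
    using assms(2) unfolding bipartition_def by blast
  then have "b = a" if "b \<in> A" for b
    using joined_book_free_triangle[of i B A] AB assms(1) False that by metis
  then have "A = {a}"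
    using a by blast
  then show ?thesis
    using joined_book_free_vertex[of i B A a] AB assms(1) by simp
qed simp

text \<open>For K3, and for S3+ beyond three vertices, neither side keeps an edge of color
  \<open>i\<close>. For B3+ beyond four vertices one side has no such edge; the other is then
  triangle-free in \<open>i\<close>, or S3+-free with a single vertex opposite to it.\<close>

lemma card_le_joined:
  assumes fin: "finite V" and hb: "hereditarily_bounded V" and \<tau>: "finite_profile \<tau>"
      "obeys_all \<tau> V"
    and AB: "bipartition V A B" and joined: "joined i A B"
  shows "card V \<le> profile_bound \<tau>"
proof -
  define r s t where "r = card {k. (\<tau>(i := Absent)) k = Book}"
    and "s = card {k. (\<tau>(i := Absent)) k = Paw}"
    and "t = card {k. (\<tau>(i := Absent)) k = Triangle}"
  have bound: "profile_bound (\<tau>(i := a)) =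
      gr_bound (r + of_bool (a = Book)) (s + of_bool (a = Paw)) (t + of_bool (a = Triangle))" for a
    unfolding r_def s_def t_def by (rule profile_bound_upd[OF \<tau>(1)])
  have \<tau>_bound: "profile_bound \<tau> =
      gr_bound (r + of_bool (\<tau> i = Book)) (s + of_bool (\<tau> i = Paw)) (t + of_bool (\<tau>
          i = Triangle))"
    using bound[of "\<tau> i"] by simp
  have IH: "card U \<le> gr_bound (r + of_bool (a = Book)) (s + of_bool (a = Paw)) (t + of_bool (a
      = Triangle))"
    if "U \<in> {A, B}" "obeys a i U" for U a
  proof -
    have "U \<subset> V"
      using that AB unfolding bipartition_def by blast
    then have "card U \<le> profile_bound (\<tau>(i := a))"
      by (intro hereditarily_boundedD[OF hb] finite_profile_upd \<tau>(1) obeys_all_upd[OF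
          \<tau>(2)] that(2))
        auto
    then show ?thesis
      by (simp add: bound)
  qed
  have cardV: "card V = card A + card B"
    using AB fin card_Un_disjoint[of A B] unfolding bipartition_def by auto
  have U: "V = A \<union> B" "V = B \<union> A" and disj: "A \<inter> B = {}" "B \<inter> A = {}"
    and ne: "A \<noteq> {}" "B \<noteq> {}" and joined': "joined i B A"
    using AB joined joined_sym unfolding bipartition_def by auto
  have ne0: "\<not> clique_bound i 0 A" "\<not> clique_bound i 0 B"
    using ne by (simp_all add: clique_bound_0)
  have obeys: "obeys (\<tau> i) i V"
    using \<tau>(2) unfolding obeys_all_def by blast
  have light: "card V \<le> 2 * gr_bound r s t" if "clique_bound i 1 A" "clique_bound i 1 B"
    using IH[of A Absent] IH[of B Absent] that cardV by simp
  show ?thesis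
  proof (cases "\<tau> i")
    case Absent
    then have "clique_bound i (1 - Suc 0) B"
      using clique_bound_joined[of i 1 V A B 0] obeys U disj joined ne0 by simp
    then show ?thesis
      using ne by (simp add: clique_bound_0)
  next
    case Triangle
    then have "clique_bound i 2 V"
      using obeys by simp
    then have "clique_bound i (2 - Suc 0) B" "clique_bound i (2 - Suc 0) A"
      using clique_bound_joined[of i 2 V A B 0] clique_bound_joined[of i 2 V B A 0]
        U disj joined joined' ne0 by simp_all
    then show ?thesis
      using light gr_bound_K[of r s t] Triangle \<tau>_bound by simp
  next
    case Paw
    then have paw: "paw_free i (A \<union> B)" "paw_free i (B \<union> A)"
      using obeys U by simp_all
    show ?thesis
    proof (cases "card V \<le> 3")
      case True
      then show ?thesis
        using gr_bound_S(1)[of r s t] Paw \<tau>_bound by simp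
    next
      case False
      then have "clique_bound i 1 A" "clique_bound i 1 B"
        using joined_paw_free[OF paw(1) joined disj(1) ne(2)]
          joined_paw_free[OF paw(2) joined' disj(2) ne(1)] U by auto
      then show ?thesis
        using light gr_bound_K[of r s t] gr_bound_S(2)[of r s t] Paw \<tau>_bound by simp
    qed
  next
    case Book
    then have book: "book_free i V"
      using obeys by simp
    have half: "card V \<le> gr_bound (Suc r) s t"
      if "C \<in> {A, B}" "D \<in> {A, B}" "card V = card C + card D" "clique_bound i 1 C"
        "clique_bound i 2 D \<or> (paw_free i D \<and> card C = 1)" for C D
      using that IH[of C Absent] IH[of D Triangle] IH[of D Paw] gr_bound_B[of r s t] by auto
    have "card V \<le> gr_bound (Suc r) s t"
    proof (cases "card V \<le> 4")
      case True
      then show ?thesis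
        using gr_bound_B(1)[of r s t] by simp
    next
      case False
      then consider "clique_bound i 1 A" | "clique_bound i 1 B"
        using joined_book_free_edges[of i A B] book joined disj U by auto
      then show ?thesis
      proof cases
        case 1
        then show ?thesis
          using half[of A B] joined_book_cases[OF book AB joined] cardV by simp
      next
        case 2
        then show ?thesis
          using half[of B A] joined_book_cases[OF book _ joined'] AB bipartition_sym cardV by simp
      qed
    qed
    then show ?thesis
      using Book \<tau>_bound by simp
  qed
qed

end

section \<open>Gallai decompositions without joined bipartition\<close>

locale gallai_decomposition = edge_coloring +
  fixes i j :: nat and V :: "'a set" and \<P> :: "'a set set"
  assumes finite_V: "finite V" and V_nonempty: "V \<noteq> {}"
    and partition: "gallai_partition i j V \<P>"
    and prime: "\<And>A B l. bipartition V A B \<Longrightarrow> \<not> joined l A B"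
begin

lemma swap: "gallai_decomposition e j i V \<P>"
  using finite_V V_nonempty partition prime
  by unfold_locales (auto simp: gallai_partition_def)

lemma partition_on: "partition_on V \<P>"
  using partition unfolding gallai_partition_def by blast

lemma finite_parts: "finite \<P>"
  using finite_elements[OF finite_V partition_on] .

lemma Union_parts: "\<Union>\<P> = V"
  using partition_on by (simp add: partition_on_def)

lemma part_psubset: "P \<in> \<P> \<Longrightarrow> P \<subset> V"
  using partition Union_parts unfolding gallai_partition_def by blast

lemma finite_part: "P \<in> \<P> \<Longrightarrow> finite P"
  using part_psubset finite_V by (meson finite_subset psubset_imp_subset)

lemma part_nonempty: "P \<in> \<P> \<Longrightarrow> P \<noteq> {}"
  using partition_on by (auto simp: partition_on_def)

lemma part_disjoint: "P \<in> \<P> \<Longrightarrow> Q \<in> \<P> \<Longrightarrow> P \<noteq> Q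
    \<Longrightarrow> P \<inter> Q = {}"
  using partition_on by (auto simp: partition_on_def disjoint_def)

lemma part_joined: "P \<in> \<P> \<Longrightarrow> Q \<in> \<P> \<Longrightarrow> P \<noteq> Q
    \<Longrightarrow> joined i P Q \<or> joined j P Q"
  using partition unfolding gallai_partition_def by blast

lemma exists_part: "x \<in> V \<Longrightarrow> \<exists>P\<in>\<P>. x \<in> P"
  using Union_parts by blast

text \<open>The graph of color \<open>i\<close> on the parts is connected: parts with no
  \<open>i\<close>-edge leaving them would be joined to the rest in color \<open>j\<close>.\<close>

lemma cross:
  assumes "\<Q> \<subseteq> \<P>" "\<Q> \<noteq> {}" "\<Q> \<noteq> \<P>"
  shows "\<exists>P\<in>\<Q>. \<exists>Q\<in>\<P> - \<Q>. joined i P Q"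
proof (rule ccontr)
  assume no: "\<not> (\<exists>P\<in>\<Q>. \<exists>Q\<in>\<P> - \<Q>. joined i P Q)"
  have j: "joined j P Q" if "P \<in> \<Q>" "Q \<in> \<P> - \<Q>" for P Q
    using no part_joined[of P Q] that assms(1) by blast
  then have "joined j (\<Union>\<Q>) (\<Union>(\<P> - \<Q>))"
    unfolding joined_def by blast
  moreover have "\<Union>\<Q> \<inter> \<Union>(\<P> - \<Q>) = {}"
  proof -
    have "P \<inter> Q = {}" if "P \<in> \<Q>" "Q \<in> \<P> - \<Q>" for P Q
      using part_disjoint[of P Q] that assms(1) by blast
    then show ?thesis
      by blast
  qed
  moreover obtain P Q where "P \<in> \<Q>" "Q \<in> \<P> - \<Q>"
    using assms by blast
  then have "\<Union>\<Q> \<noteq> {}" "\<Union>(\<P> - \<Q>) \<noteq> {}"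
    using part_nonempty[of P] part_nonempty[of Q] assms(1) by blast+
  moreover have "\<Union>\<Q> \<union> \<Union>(\<P> - \<Q>) = V"
    using Union_parts assms(1) by blast
  ultimately show False
    using prime unfolding bipartition_def by blast
qed

lemma neighbour:
  assumes "P \<in> \<P>"
  obtains Q where "Q \<in> \<P>" "Q \<noteq> P" "joined i P Q"
proof -
  have "{P} \<noteq> \<P>"
    using part_psubset[OF assms] Union_parts by auto
  then show ?thesis
    using cross[of "{P}"] assms that by auto
qed

lemma joined_unique:
  assumes "P \<in> \<P>" "Q \<in> \<P>" "joined k P Q" "joined l P Q"
  shows "k = l"
  using assms part_nonempty unfolding joined_def by (metis ex_in_conv)

text \<open>With a single color any part is joined to its complement.\<close>

lemma colors_distinct: "i \<noteq> j"
proof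
  assume "i = j"
  obtain x where "x \<in> V"
    using V_nonempty by blast
  then obtain P where P: "P \<in> \<P>" "x \<in> P"
    using exists_part by blast
  have "e a b = i" if ab: "a \<in> P" "b \<in> V - P" for a b
  proof -
    obtain Q where "Q \<in> \<P>" "b \<in> Q"
      using ab(2) exists_part by blast
    then show ?thesis
      using part_joined[OF P(1), of Q] ab \<open>i = j\<close> unfolding joined_def by auto
  qed
  then have "joined i P (V - P)"
    unfolding joined_def by blast
  moreover have "bipartition V P (V - P)"
    using part_psubset[OF P(1)] P(2) unfolding bipartition_def by blast
  ultimately show False
    using prime by blast
qed

text \<open>The graphs of both colors on the parts are connected, and the path on four vertices is
  the smallest graph with at least two vertices that is connected together with its
  complement.\<close>

lemma four_parts: "4 \<le> card \<P>"
proof -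
  interpret sw: gallai_decomposition e j i V \<P>
    by (rule swap)
  obtain P where P: "P \<in> \<P>"
    using V_nonempty exists_part by blast
  obtain Q where Q: "Q \<in> \<P>" "Q \<noteq> P" "joined i P Q"
    using neighbour[OF P] .
  obtain R where R: "R \<in> \<P>" "R \<noteq> P" "joined j P R"
    using sw.neighbour[OF P] .
  obtain S where S: "S \<in> \<P>" "S \<noteq> Q" "joined j Q S"
    using sw.neighbour[OF Q(1)] .
  obtain T where T: "T \<in> \<P>" "T \<noteq> R" "joined i R T"
    using neighbour[OF R(1)] .
  have "Q \<noteq> R"
    using joined_unique[OF P Q(1) Q(3)] R(3) colors_distinct by blast
  have "S \<noteq> P"
    using joined_unique[OF Q(1) P] Q(3) S(3) colors_distinct joined_sym by blast
  have "T \<noteq> P"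
    using joined_unique[OF R(1) P] R(3) T(3) colors_distinct joined_sym by blast
  have "\<exists>U\<in>\<P>. U \<notin> {P, Q, R}"
  proof (cases "S = R")
    case True
    then have "T \<noteq> Q"
      using joined_unique[OF R(1) Q(1)] S(3) T(3) colors_distinct joined_sym by blast
    then show ?thesis
      using T \<open>T \<noteq> P\<close> by blast
  next
    case False
    then show ?thesis
      using S \<open>S \<noteq> P\<close> by blast
  qed
  then obtain U where U: "U \<in> \<P>" "U \<notin> {P, Q, R}"
    by blast
  have "card {U, P, Q, R} \<le> card \<P>"
    using P Q(1) R(1) U(1) by (intro card_mono finite_parts) auto
  moreover have "card {U, P, Q, R} = 4"
    using Q(2)[symmetric] R(2)[symmetric] U(2) \<open>Q \<noteq> R\<close> by simp
  ultimately show ?thesis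
    by simp
qed

text \<open>A vertex of an \<open>i\<close>-neighbour of \<open>P\<close> extends every
  \<open>i\<close>-clique of \<open>P\<close>.\<close>

lemma part_clique_bound:
  assumes "clique_bound i (Suc m) V" "P \<in> \<P>"
  shows "clique_bound i m P"
proof -
  obtain Q where Q: "Q \<in> \<P>" "Q \<noteq> P" "joined i P Q"
    using neighbour[OF assms(2)] .
  have "joined i Q P"
    using Q(3) joined_sym by blast
  moreover have "Q \<union> P \<subseteq> V" "Q \<inter> P = {}"
    using part_psubset[OF Q(1)] part_psubset[OF assms(2)] part_disjoint[OF Q(1) assms(2) Q(2)] by
        auto
  moreover have "\<not> clique_bound i 0 Q"
    using part_nonempty[OF Q(1)] by (simp add: clique_bound_0)
  ultimately show ?thesis
    using clique_bound_joined[OF assms(1), of Q P 0] by simp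
qed

text \<open>A triangle meets at most three of the at least four parts, so it has a pendant edge.\<close>

lemma paw_free_imp_triangle_free:
  assumes "paw_free i V"
  shows "clique_bound i 2 V"
proof (rule ccontr)
  assume "\<not> clique_bound i 2 V"
  then obtain x y z where xyz: "x \<in> V" "y \<in> V" "z \<in> V" "x \<noteq> y" "x \<noteq> z"
      "y \<noteq> z" "clique i {x, y, z}"
    using not_clique_bound_2E by blast
  obtain Px Py Pz where P: "Px \<in> \<P>" "x \<in> Px" "Py \<in> \<P>" "y \<in> Py"
      "Pz \<in> \<P>" "z \<in> Pz"
    using exists_part[OF xyz(1)] exists_part[OF xyz(2)] exists_part[OF xyz(3)] by auto
  let ?Q = "{Px, Py, Pz}"
  have "card ?Q \<le> 3"
    by (simp add: card_insert_if)
  then have "?Q \<noteq> \<P>"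
    using four_parts by auto
  \<comment> \<open>An \<open>i\<close>-edge between parts leaves the parts met by the triangle;
    since parts are joined completely, it can be taken to start at a vertex of the triangle.\<close>
  then have "\<exists>P\<in>?Q. \<exists>Q\<in>\<P> - ?Q. joined i P Q"
    using P by (intro cross) auto
  then obtain P Q where PQ: "P \<in> ?Q" "Q \<in> \<P> - ?Q" "joined i P Q"
    by (elim bexE)
  obtain q where q: "q \<in> Q"
    using part_nonempty PQ(2) by blast
  obtain w where w: "w \<in> {x, y, z}" "w \<in> P"
    using PQ(1) P by blast
  have wq: "e w q = i"
    using PQ(3) q w(2) unfolding joined_def by blast
  have "Q \<inter> Px = {}" "Q \<inter> Py = {}" "Q \<inter> Pz = {}"
    using PQ(2) P part_disjoint by auto
  then have qn: "q \<notin> {x, y, z}"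
    using P q by blast
  have qV: "q \<in> V"
    using q PQ(2) Union_parts by blast
  obtain u v where uv: "{x, y, z} = {w, u, v}" "distinct [w, u, v]"
  proof -
    consider "w = x" | "w = y" | "w = z"
      using w(1) by blast
    then show ?thesis
      using that[of y z] that[of x z] that[of x y] xyz(4-6) by cases auto
  qed
  have "clique i {w, u, v}"
    using xyz(7) unfolding uv(1) .
  moreover have "{w, u, v} \<subseteq> V"
    unfolding uv(1)[symmetric] using xyz(1-3) by simp
  moreover have "q \<notin> {w, u, v}"
    using qn unfolding uv(1) .
  ultimately show False
    using paw_freeD[OF assms, of w u v q] uv(2) qV wq by auto
qed

end

section \<open>Counting the vertices of a Gallai decomposition\<close>

locale profiled_decomposition = gallai_decomposition +
  fixes \<tau> :: "nat \<Rightarrow> constraint"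
  assumes profile: "finite_profile \<tau>" "obeys_all \<tau> V"
    and hereditary: "hereditarily_bounded V"
begin

lemma profiled_swap: "profiled_decomposition e j i V \<P> \<tau>"
  using swap profile hereditary
  by (simp add: profiled_decomposition_def profiled_decomposition_axioms_def)

abbreviation "r \<equiv> other_count \<tau> i j Book"
abbreviation "s \<equiv> other_count \<tau> i j Paw"
abbreviation "t \<equiv> other_count \<tau> i j Triangle"

lemma subset_bound:
  assumes "U \<subset> V" "obeys a i U" "obeys b j U"
  shows "card U \<le> gr_bound (r + of_bool (a = Book) + of_bool (b = Book))
    (s + of_bool (a = Paw) + of_bool (b = Paw)) (t + of_bool (a = Triangle) + of_bool (b =
        Triangle))"
  unfolding profile_bound_upd2[OF profile(1) colors_distinct, symmetric]
  using assms by (intro hereditarily_boundedD[OF hereditary] finite_profile_upd profile(1))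
    (auto intro!: obeys_all_upd[of _ U] obeys_all_upd[OF profile(2)])

text \<open>In a color without K4 the parts are triangle-free, so the induction hypothesis applies
  to them with \<open>Triangle\<close> or \<open>Absent\<close> for \<open>i\<close> and
  \<open>j\<close>; this gives the weights.\<close>

lemma weighted:
  assumes "clique_bound i 3 V" "clique_bound j 3 V"
  shows "weighted_parts e i j \<P> (gr_bound r s t) (gr_bound r s (Suc t))"
proof -
  interpret sw: profiled_decomposition e j i V \<P> \<tau>
    by (rule profiled_swap)
  have i2: "clique_bound i 2 P" and j2: "clique_bound j 2 P" if "P \<in> \<P>" for P
    using part_clique_bound[of 2 P] sw.part_clique_bound[of 2 P] assms that by simp_all
  show ?thesis
  proof
    fix P assume P: "P \<in> \<P>"
    show "card P \<le> gr_bound r s t" if "clique_bound i 1 P" "clique_bound j 1 P"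
      using subset_bound[of P Absent Absent] part_psubset[OF P] that by simp
    show "card P \<le> gr_bound r s (Suc t)" if "clique_bound j 1 P"
      using subset_bound[of P Triangle Absent] part_psubset[OF P] that i2[OF P] by simp
    show "card P \<le> gr_bound r s (Suc t)" if "clique_bound i 1 P"
      using subset_bound[of P Absent Triangle] part_psubset[OF P] that j2[OF P] by simp
  qed (use finite_parts finite_part part_nonempty part_disjoint part_joined i2 j2 gr_bound_K in
      auto)
qed

lemma bound_Triangle_Triangle:
  assumes "clique_bound i 2 V" "clique_bound j 2 V"
  shows "card V \<le> gr_bound r s (Suc (Suc t))"
proof -
  interpret sw: profiled_decomposition e j i V \<P> \<tau>
    by (rule profiled_swap)
  interpret weighted_parts e i j \<P> "gr_bound r s t" "gr_bound r s (Suc t)"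
    using assms by (intro weighted) (auto elim: clique_bound_mono)
  have "card (\<Union>\<P>) \<le> 5 * gr_bound r s t"
    using part_clique_bound[of 1] sw.part_clique_bound[of 1] assms
    by (intro card_2_2_light) (auto simp: Union_parts numeral_2_eq_2)
  then show ?thesis
    using gr_bound_KK[of r s t] by (simp add: Union_parts)
qed

lemma bound_Book_Triangle:
  assumes "clique_bound i 3 V" "clique_bound j 2 V"
  shows "card V \<le> gr_bound (Suc r) s (Suc t)"
proof -
  interpret sw: profiled_decomposition e j i V \<P> \<tau>
    by (rule profiled_swap)
  interpret weighted_parts e i j \<P> "gr_bound r s t" "gr_bound r s (Suc t)"
    using assms by (intro weighted) (auto elim: clique_bound_mono)
  have "clique_bound j 1 P" if "P \<in> \<P>" for P
    using sw.part_clique_bound[of 1 P] assms(2) that by (simp add: numeral_2_eq_2)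
  then have "card (\<Union>\<P>) \<le> gr_bound (Suc r) s (Suc t)"
    using gr_bound_BK(1,2)[of r s t] assms by (intro card_3_2_light) (simp_all add: Union_parts)
  then show ?thesis
    by (simp add: Union_parts)
qed

lemma bound_Book_Book:
  assumes "clique_bound i 3 V" "clique_bound j 3 V"
  shows "card V \<le> gr_bound (Suc (Suc r)) s t"
proof -
  interpret sw: profiled_decomposition e j i V \<P> \<tau>
    by (rule profiled_swap)
  interpret W: weighted_parts e i j \<P> "gr_bound r s t" "gr_bound r s (Suc t)"
    using assms by (rule weighted)
  interpret ratio_parts e i j \<P> "gr_bound r s t" "gr_bound r s (Suc t)"
      "gr_bound r s (Suc (Suc t))"
  proof
    fix P assume P: "P \<in> \<P>"
    then show "card P \<le> gr_bound r s (Suc (Suc t))"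
      using subset_bound[of P Triangle Triangle] part_psubset[OF P] W.triangle_free[OF P] by simp
  qed (use gr_bound_ratio in auto)
  have "card (\<Union>\<P>) \<le> 17 * gr_bound r s t"
    using assms by (intro card_3_3) (auto simp: Union_parts)
  then show ?thesis
    by (simp add: Union_parts gr_bound_Suc2)
qed

end

section \<open>Removing a K4 in a B3+-free color\<close>

context edge_coloring
begin

text \<open>Two \<open>i\<close>-edges from \<open>v\<close> to an \<open>i\<close>-colored K4
  complete B3+, with their ends as spine.\<close>

lemma book_free_one_edge:
  assumes "book_free i V" "Q \<subseteq> V" "clique i Q" "card Q = 4" "v \<in> V - Q"
    and xy: "x \<in> Q" "y \<in> Q" "x \<noteq> y" "e v x = i" "e v y = i"
  shows False
proof -
  have "finite Q"
    using assms(4) card.infinite by fastforce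
  then have "card (Q - {x, y}) = 2"
    using assms(4) xy by (simp add: card_Diff_subset)
  then obtain c d where cd: "Q - {x, y} = {c, d}" "c \<noteq> d"
    by (auto simp: card_2_iff)
  have Q: "Q = {x, y, c, d}"
    using cd(1) xy by blast
  have "c \<notin> {x, y}" "d \<notin> {x, y}"
    using cd(1) by blast+
  moreover have "v \<notin> {x, y, c, d}"
    using assms(5) Q by blast
  moreover have "{x, y, c, d, v} \<subseteq> V"
    using assms(2,5) Q by blast
  ultimately show False
    using book_freeD[OF assms(1), of x y c d v] assms(3) xy cd(2) sym[of v] unfolding Q by auto
qed

end

lemma card_four_avoid:
  assumes "card Q = 4"
  shows "\<exists>x\<in>Q. x \<notin> {a, b, c}"
proof (rule ccontr)
  assume "\<not> ?thesis"
  then have "card Q \<le> card {a, b, c}"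
    by (intro card_mono) auto
  also have "\<dots> \<le> 3"
    by (simp add: card_insert_if)
  finally show False
    using assms by simp
qed

lemma two_elements:
  assumes "2 \<le> card S"
  obtains a b where "a \<in> S" "b \<in> S" "a \<noteq> b"
proof -
  obtain T where "T \<subseteq> S" "card T = 2"
    using obtain_subset_with_card_n[OF assms] by metis
  then show ?thesis
    using that by (auto simp: card_2_iff)
qed

context profiled_decomposition
begin

text \<open>A \<open>K\<^sub>4\<close> in a book-free color either has exactly three vertices in one part, or every vertex
  outside it is joined to at least three of its vertices in color \<open>j\<close>.\<close>

lemma scattered_K4_neighbours:
  assumes book: "book_free i V" and Q: "Q \<subseteq> V" "clique i Q" "card Q = 4"
    and not3: "\<And>P. P \<in> \<P> \<Longrightarrow> card (P \<inter> Q) \<noteq> 3" and v: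
        "v \<in> V - Q"
  shows "\<exists>b\<in>Q. \<forall>x\<in>Q. x \<noteq> b \<longrightarrow> e v x = j"
proof -
  note one = book_free_one_edge[OF book Q]
  have finQ: "finite Q"
    using Q(1) finite_V finite_subset by blast
  obtain P where P: "P \<in> \<P>" "v \<in> P"
    using v exists_part by blast
  \<comment> \<open>If the part \<open>P\<close> of \<open>v\<close> met \<open>Q\<close>, all
    vertices of \<open>Q\<close> outside \<open>P\<close> would be joined to \<open>P\<close>, hence
    to \<open>v\<close>, in color \<open>i\<close>. A single such edge is excluded by
    \<open>not3\<close>, two or more by \<open>one\<close>; and if \<open>Q\<close> lies in
    \<open>P\<close>, an \<open>i\<close>-neighbour of \<open>P\<close> sends four
    \<open>i\<close>-edges to \<open>Q\<close>.\<close>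
  have PQ: "P \<inter> Q = {}"
  proof (rule ccontr)
    assume "P \<inter> Q \<noteq> {}"
    then obtain q where q: "q \<in> P" "q \<in> Q"
      by blast
    have "\<not> Q \<subseteq> P"
    proof
      assume "Q \<subseteq> P"
      obtain R where R: "R \<in> \<P>" "R \<noteq> P" "joined i P R"
        using neighbour[OF P(1)] .
      obtain w where w: "w \<in> R"
        using part_nonempty[OF R(1)] by blast
      have w': "w \<in> V - Q"
        using w part_psubset[OF R(1)] part_disjoint[OF R(1) P(1) R(2)] \<open>Q \<subseteq>
            P\<close> by blast
      have wi: "e w x = i" if "x \<in> Q" for x
        using R(3) w that \<open>Q \<subseteq> P\<close> sym[of w x] unfolding joined_def by auto
      obtain x y where "x \<in> Q" "y \<in> Q" "x \<noteq> y"
        using two_elements[of Q] Q(3) by auto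
      then show False
        using one[OF w'] wi by blast
    qed
    have "card Q = card (P \<inter> Q) + card (Q - P)"
      using card_Int_Diff[OF finQ, of P] by (simp add: Int_commute)
    moreover have "card (Q - P) \<noteq> 0"
      using \<open>\<not> Q \<subseteq> P\<close> finQ by auto
    ultimately have "2 \<le> card (Q - P)"
      using not3[OF P(1)] Q(3) by linarith
    then obtain z1 z2 where z: "z1 \<in> Q - P" "z2 \<in> Q - P" "z1 \<noteq> z2"
      by (rule two_elements)
    have "e v z = i" if z: "z \<in> Q - P" for z
    proof -
      obtain R where R: "R \<in> \<P>" "z \<in> R"
        using z Q(1) exists_part by blast
      have "e q z = i"
        using Q(2) q z unfolding clique_def by auto
      moreover have "R \<noteq> P"
        using R z by blast
      ultimately have "joined i P R"
        using part_joined[OF P(1) R(1)] q R(2) colors_distinct unfolding joined_def by auto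
      then show ?thesis
        using P(2) R(2) unfolding joined_def by blast
    qed
    then show False
      using one[OF v, of z1 z2] z by blast
  qed
  have ij: "e v x \<in> {i, j}" if x: "x \<in> Q" for x
  proof -
    obtain R where R: "R \<in> \<P>" "x \<in> R"
      using x Q(1) exists_part by blast
    have "R \<noteq> P"
      using R x PQ by blast
    then show ?thesis
      using part_joined[OF P(1) R(1)] P(2) R(2) unfolding joined_def by blast
  qed
  show ?thesis
  proof (cases "\<exists>b\<in>Q. e v b = i")
    case True
    then obtain b where "b \<in> Q" "e v b = i"
      by blast
    then show ?thesis
      using one[OF v, of b] ij by blast
  next
    case False
    moreover obtain b where "b \<in> Q"
      using Q(3) by (metis card.empty ex_in_conv zero_neq_numeral)
    ultimately show ?thesis
      using ij by blast
  qed
qed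

text \<open>Every outside vertex has at most one exceptional vertex in \<open>Q\<close> and sees the
  others in color \<open>j\<close>. Few outside vertices thus have common
  \<open>j\<close>-neighbours in \<open>Q\<close>, so a \<open>j\<close>-edge outside extends to a
  triangle and a \<open>j\<close>-triangle outside to B3+. Dropping \<open>Q\<close> costs 4 and
  strengthens the constraint on \<open>j\<close>.\<close>

lemma scattered_K4:
  assumes book: "book_free i V" and Q: "Q \<subseteq> V" "clique i Q" "card Q = 4"
    and not3: "\<And>P. P \<in> \<P> \<Longrightarrow> card (P \<inter> Q) \<noteq> 3"
  shows "clique_bound j 2 V \<Longrightarrow> card V \<le> gr_bound (Suc r) s (Suc t)"
    and "book_free j V \<Longrightarrow> card V \<le> gr_bound (Suc (Suc r)) s t"
proof -
  have finQ: "finite Q"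
    using Q(1) finite_V finite_subset by blast
  have psub: "V - Q \<subset> V"
  proof -
    obtain q where "q \<in> Q"
      using card_four_avoid[OF Q(3)] by blast
    then show ?thesis
      using Q(1) by blast
  qed
  have cardV: "card V = 4 + card (V - Q)"
    using Q finQ finite_V card_mono[of V Q] by (simp add: card_Diff_subset)
  have bookU: "book_free i (V - Q)"
    using book_free_subset[OF book] by blast
  obtain b where b: "\<And>v x. v \<in> V - Q \<Longrightarrow> x \<in> Q \<Longrightarrow> x
      \<noteq> b v \<Longrightarrow> e v x = j"
    using scattered_K4_neighbours[OF assms] by metis
  show "card V \<le> gr_bound (Suc r) s (Suc t)" if "clique_bound j 2 V"
  proof -
    have "clique_bound j 1 (V - Q)"
    proof (rule ccontr)
      assume "\<not> clique_bound j 1 (V - Q)"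
      then obtain u v where uv: "u \<in> V - Q" "v \<in> V - Q" "u \<noteq> v" "e u v = j"
        by (rule not_clique_bound_1E)
      obtain x where x: "x \<in> Q" "x \<noteq> b u" "x \<noteq> b v"
        using card_four_avoid[OF Q(3), of "b u" "b v" "b v"] by blast
      have "clique j {u, v, x}"
        using uv b[OF uv(1) x(1,2)] b[OF uv(2) x(1,3)] by (simp add: sym)
      then have "card {u, v, x} \<le> 2"
        using uv x Q(1) by (intro clique_boundD[OF that]) auto
      moreover have "x \<noteq> u" "x \<noteq> v"
        using uv x by blast+
      ultimately show False
        using uv(3) by simp
    qed
    then have "card (V - Q) \<le> gr_bound (Suc r) s t"
      using subset_bound[OF psub, of Book Absent] bookU by simp
    then show ?thesis
      using cardV gr_bound_BK(3)[of r s t] by linarith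
  qed
  show "card V \<le> gr_bound (Suc (Suc r)) s t" if "book_free j V"
  proof -
    have "clique_bound j 2 (V - Q)"
    proof (rule ccontr)
      assume "\<not> clique_bound j 2 (V - Q)"
      then obtain u v w where uvw: "u \<in> V - Q" "v \<in> V - Q" "w \<in> V - Q" "u \<noteq> v"
          "u \<noteq> w" "v \<noteq> w"
        "clique j {u, v, w}"
        by (rule not_clique_bound_2E)
      \<comment> \<open>With \<open>x\<close> the triangle becomes a K4; the fifth vertex
        \<open>y\<close> has to avoid only \<open>x\<close> and the exceptional vertices of the
        spine \<open>u\<close>, \<open>v\<close>.\<close>
      obtain x where x: "x \<in> Q" "x \<noteq> b u" "x \<noteq> b v" "x \<noteq> b w"
        using card_four_avoid[OF Q(3), of "b u" "b v" "b w"] by blast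
      obtain y where y: "y \<in> Q" "y \<noteq> b u" "y \<noteq> b v" "y \<noteq> x"
        using card_four_avoid[OF Q(3), of "b u" "b v" x] by blast
      have xn: "x \<notin> {u, v, w}" "y \<notin> {u, v, w}"
        using uvw x(1) y(1) by blast+
      have xj: "e u x = j" "e v x = j" "e w x = j"
        using b[OF uvw(1) x(1,2)] b[OF uvw(2) x(1,3)] b[OF uvw(3) x(1,4)] .
      have yj: "e u y = j" "e v y = j"
        using b[OF uvw(1) y(1,2)] b[OF uvw(2) y(1,3)] .
      have "{u, v, w, x, y} \<subseteq> V"
        using uvw(1-3) x(1) y(1) Q(1) by blast
      moreover have "distinct [u, v, w, x, y]"
        using uvw(4-6) xn y(4) by auto
      moreover have "clique j {u, v, w, x}"
        using uvw(7) xj by simp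
      ultimately show False
        using book_freeD[OF that] yj by blast
    qed
    then have "card (V - Q) \<le> gr_bound (Suc r) s (Suc t)"
      using subset_bound[OF psub, of Book Triangle] bookU by simp
    then show ?thesis
      using cardV gr_bound_BB(1)[of r s t] by linarith
  qed
qed

text \<open>The fourth vertex \<open>b\<close> of \<open>Q\<close> is joined to \<open>P\<close> in
  color \<open>i\<close>, so \<open>P\<close> is S3+-free in \<open>i\<close>. All remaining
  vertices \<open>W\<close> are joined to \<open>P\<close> in color \<open>j\<close>, so the
  argument for joined sets applies to \<open>P\<close> and \<open>W\<close>; \<open>b\<close> itself
  accounts for the summand 1.\<close>

lemma clustered_K4:
  assumes book: "book_free i V" and Q: "Q \<subseteq> V" "clique i Q" "card Q = 4"
    and P: "P \<in> \<P>" "card (P \<inter> Q) = 3"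
  shows "clique_bound j 2 V \<Longrightarrow> card V \<le> gr_bound (Suc r) s (Suc t)"
    and "book_free j V \<Longrightarrow> card V \<le> gr_bound (Suc (Suc r)) s t"
proof -
  note one = book_free_one_edge[OF book Q]
  have finQ: "finite Q"
    using Q(1) finite_V finite_subset by blast
  have "card (Q - P) = 1"
    using finQ Q(3) P(2) by (simp add: card_Diff_subset_Int Int_commute)
  then obtain b where b: "Q - P = {b}"
    by (auto simp: card_1_singleton_iff)
  have bQ: "b \<in> Q" "b \<notin> P" "Q \<subseteq> insert b P"
    using b by blast+
  obtain x y where xy: "x \<in> P \<inter> Q" "y \<in> P \<inter> Q" "x \<noteq> y"
    using two_elements[of "P \<inter> Q"] P(2) by auto
  have finP: "finite P"
    using finite_part[OF P(1)] .
  obtain R where R: "R \<in> \<P>" "b \<in> R"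
    using bQ Q(1) exists_part by blast
  have RP: "R \<noteq> P"
    using R bQ by blast
  have "e x b = i"
    using Q(2) xy bQ unfolding clique_def by auto
  then have "joined i P R"
    using part_joined[OF P(1) R(1)] RP xy R(2) colors_distinct unfolding joined_def by auto
  then have Pb: "joined i P {b}"
    using R(2) unfolding joined_def by blast
  define W where "W = V - insert b P"
  \<comment> \<open>Otherwise \<open>v\<close> would send \<open>i\<close>-edges to the vertices
    \<open>x\<close> and \<open>y\<close> of \<open>Q\<close>.\<close>
  have jPS: "joined j P S" if S: "S \<in> \<P>" "S \<noteq> P" "v \<in> S" "v \<noteq> b" for S v
  proof (rule ccontr)
    assume "\<not> joined j P S"
    then have "joined i P S"
      using part_joined[OF P(1) S(1)] S(2) by blast
    then have "e v x = i" "e v y = i"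
      using xy S(3) sym unfolding joined_def by (metis IntD1)+
    moreover have "v \<notin> P" "v \<in> V"
      using part_disjoint[OF P(1) S(1)] S part_psubset[OF S(1)] by blast+
    then have "v \<in> V - Q"
      using bQ(3) S(4) by blast
    ultimately show False
      using one[of v x y] xy by blast
  qed
  have PW: "joined j P W"
    unfolding joined_def
  proof (intro ballI)
    fix p v assume "p \<in> P" "v \<in> W"
    moreover obtain S where "S \<in> \<P>" "v \<in> S"
      using \<open>v \<in> W\<close> exists_part unfolding W_def by blast
    ultimately show "e p v = j"
      using jPS[of S v] unfolding W_def joined_def by blast
  qed
  have disj: "P \<inter> W = {}" "W \<inter> P = {}"
    unfolding W_def by blast+
  \<comment> \<open>Two parts besides \<open>P\<close> and \<open>R\<close> give two vertices of
    \<open>W\<close>; they rule out a \<open>j\<close>-triangle in \<open>P\<close> and help to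
    exceed four vertices in \<open>P \<union> W\<close>.\<close>
  have "2 \<le> card (\<P> - {P, R})"
    using four_parts card_Diff_subset[of "{P, R}" \<P>] P(1) R(1) RP by simp
  then obtain S T where ST: "S \<in> \<P> - {P, R}" "T \<in> \<P> - {P, R}" "S \<noteq> T"
    by (rule two_elements)
  have inW: "S \<subseteq> W" if "S \<in> \<P> - {P, R}" for S
    using part_disjoint[of S P] part_disjoint[of S R] part_psubset[of S] that P(1) R
    unfolding W_def by blast
  obtain v w where vw: "v \<in> S" "w \<in> T"
    using ST part_nonempty by blast
  have vw: "v \<in> W" "w \<in> W" "v \<noteq> w"
    using vw inW[OF ST(1)] inW[OF ST(2)] part_disjoint[of S T] ST by blast+
  have psub: "P \<subset> V" "W \<subset> V"
    using part_psubset[OF P(1)] xy unfolding W_def by blast+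
  have PWV: "P \<union> W \<subseteq> V" "W \<union> P \<subseteq> V"
    using psub by blast+
  have bV: "b \<in> V"
    using bQ Q(1) by blast
  have paw: "paw_free i P"
    using joined_book_free_vertex[of i P "{b}" b] Pb bQ(2) bV psub(1) book_free_subset[OF book, of
        "P \<union> {b}"]
    by auto
  have bookW: "book_free i W"
    using book_free_subset[OF book] psub(2) by blast
  have finW: "finite W"
    using finite_V unfolding W_def by simp
  have "V = insert b (P \<union> W)" "b \<notin> P \<union> W"
    using psub bV bQ(2) unfolding W_def by blast+
  then have cardV: "card V = 1 + card P + card W"
    using finP finW disj by (simp add: card_Un_disjoint)
  have WP: "joined j W P"
    using PW joined_sym by blast
  show "card V \<le> gr_bound (Suc r) s (Suc t)" if c: "clique_bound j 2 V"
  proof -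
    have "\<not> clique_bound j 0 P" "\<not> clique_bound j 0 W"
      using xy vw by (auto simp: clique_bound_0)
    then have "clique_bound j 1 P" "clique_bound j 1 W"
      using clique_bound_joined[OF c PWV(1) disj(1) PW, of 0]
        clique_bound_joined[OF c PWV(2) disj(2) WP, of 0] by simp_all
    then have "card P \<le> gr_bound r (Suc s) t" "card W \<le> gr_bound (Suc r) s t"
      using subset_bound[OF psub(1), of Paw Absent] subset_bound[OF psub(2), of Book Absent]
        paw bookW by simp_all
    then show ?thesis
      using cardV gr_bound_BK(4)[of r s t] by linarith
  qed
  show "card V \<le> gr_bound (Suc (Suc r)) s t" if bj: "book_free j V"
  proof -
    have bPW: "book_free j (P \<union> W)" "book_free j (W \<union> P)"
      using book_free_subset[OF bj] PWV by blast+
    have P2: "clique_bound j 2 P"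
      using joined_book_free_triangle[OF bPW(1) PW disj(1) _ vw(1,2)] vw(3) by blast
    have W2: "clique_bound j 2 W"
      using joined_book_free_triangle[OF bPW(2) WP disj(2), of x y] xy by blast
    have "3 \<le> card P"
      using card_mono[of P "P \<inter> Q"] finP P(2) by simp
    moreover have "2 \<le> card W"
      using card_mono[of W "{v, w}"] finW vw by simp
    ultimately have "4 < card (P \<union> W)"
      using finP finW disj by (simp add: card_Un_disjoint)
    then consider "clique_bound j 1 P" | "clique_bound j 1 W"
      using joined_book_free_edges[OF bPW(1) PW disj(1)] by linarith
    then show ?thesis
    proof cases
      case 1
      then have "card P \<le> gr_bound r (Suc s) t" "card W \<le> gr_bound (Suc r) s (Suc t)"
        using subset_bound[OF psub(1), of Paw Absent] subset_bound[OF psub(2), of Book Triangle]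
          paw bookW W2 by simp_all
      then show ?thesis
        using cardV gr_bound_BB(2)[of r s t] by linarith
    next
      case 2
      then have "card P \<le> gr_bound r (Suc s) (Suc t)" "card W \<le> gr_bound (Suc r) s t"
        using subset_bound[OF psub(1), of Paw Triangle] subset_bound[OF psub(2), of Book Absent]
          paw bookW P2 by simp_all
      then show ?thesis
        using cardV gr_bound_BB(3)[of r s t] by linarith
    qed
  qed
qed

lemma book_free_with_K4:
  assumes "book_free i V" "\<not> clique_bound i 3 V"
  shows "clique_bound j 2 V \<Longrightarrow> card V \<le> gr_bound (Suc r) s (Suc t)"
    and "book_free j V \<Longrightarrow> card V \<le> gr_bound (Suc (Suc r)) s t"
proof -
  obtain Q where Q: "Q \<subseteq> V" "finite Q" "clique i Q" "card Q = Suc 3"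
    using not_clique_boundE[OF assms(2)] .
  then have Q4: "card Q = 4"
    by simp
  have "(clique_bound j 2 V \<longrightarrow> card V \<le> gr_bound (Suc r) s (Suc t)) \<and>
    (book_free j V \<longrightarrow> card V \<le> gr_bound (Suc (Suc r)) s t)"
    using scattered_K4[OF assms(1) Q(1,3) Q4] clustered_K4[OF assms(1) Q(1,3) Q4] by metis
  then show "clique_bound j 2 V \<Longrightarrow> card V \<le> gr_bound (Suc r) s (Suc t)"
    "book_free j V \<Longrightarrow> card V \<le> gr_bound (Suc (Suc r)) s t"
    by blast+
qed

lemma book_triangle:
  assumes "book_free i V" "clique_bound j 2 V"
  shows "card V \<le> gr_bound (Suc r) s (Suc t)"
  using bound_Book_Triangle book_free_with_K4(1) assms by blast

lemma book_book:
  assumes "book_free i V" "book_free j V"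
  shows "card V \<le> gr_bound (Suc (Suc r)) s t"
proof -
  interpret sw: profiled_decomposition e j i V \<P> \<tau>
    by (rule profiled_swap)
  have "card V \<le> gr_bound (Suc (Suc r)) s t" if "\<not> clique_bound j 3 V"
    using sw.book_free_with_K4(2)[OF assms(2) that assms(1)] by (simp add: other_count_swap)
  then show ?thesis
    using bound_Book_Book book_free_with_K4(2) assms by blast
qed

text \<open>Both colors occur between parts.\<close>

lemma not_absent: "\<tau> i \<noteq> Absent"
proof
  assume "\<tau> i = Absent"
  then have i1: "clique_bound i 1 V"
    using profile(2) unfolding obeys_all_def by (metis obeys_simps(4))
  obtain P where P: "P \<in> \<P>"
    using V_nonempty exists_part by blast
  have "clique_bound i 0 P"
    using i1 part_clique_bound[OF _ P, of 0] by simp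
  then show False
    using part_nonempty[OF P] by (simp add: clique_bound_0)
qed

lemma book_or_triangle_free: "\<tau> i = Book \<and> book_free i V \<or> \<tau> i \<in> {Paw,
    Triangle} \<and> clique_bound i 2 V"
proof -
  have "obeys (\<tau> i) i V"
    using profile(2) unfolding obeys_all_def by blast
  then show ?thesis
    using not_absent paw_free_imp_triangle_free by (cases "\<tau> i") auto
qed

text \<open>S3+ colors among \<open>i\<close> and \<open>j\<close> are counted as K3 colors;
  \<open>gr_bound_S(2)\<close> returns to the actual profile.\<close>

lemma card_le_profile_bound: "card V \<le> profile_bound \<tau>"
proof -
  interpret sw: profiled_decomposition e j i V \<P> \<tau>
    by (rule profiled_swap)
  have total: "profile_bound \<tau> = gr_bound (r + of_bool (\<tau> i = Book) + of_bool (\<tau> j =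
      Book))
    (s + of_bool (\<tau> i = Paw) + of_bool (\<tau> j = Paw)) (t + of_bool (\<tau> i = Triangle) +
        of_bool (\<tau> j = Triangle))"
    using profile_bound_upd2[OF profile(1) colors_distinct, of "\<tau> i" "\<tau> j"] by simp
  note mono = gr_bound_S(2)
  consider "\<tau> i = Book" "\<tau> j = Book" "book_free i V" "book_free j V"
    | "\<tau> i = Book" "\<tau> j \<in> {Paw, Triangle}" "book_free i V" "clique_bound j 2 V"
    | "\<tau> i \<in> {Paw, Triangle}" "\<tau> j = Book" "clique_bound i 2 V" "book_free j V"
    | "\<tau> i \<in> {Paw, Triangle}" "\<tau> j \<in> {Paw, Triangle}" "clique_bound i 2 V"
        "clique_bound j 2 V"
    using book_or_triangle_free sw.book_or_triangle_free by blast
  then show ?thesis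
  proof cases
    case 1
    then show ?thesis
      using book_book total by simp
  next
    case 2
    then show ?thesis
      using book_triangle mono[of "Suc r" s t] total by auto
  next
    case 3
    then show ?thesis
      using sw.book_triangle mono[of "Suc r" s t] total by (auto simp: other_count_swap)
  next
    case 4
    then show ?thesis
      using bound_Triangle_Triangle mono[of r s "Suc t"] mono[of r "Suc s" t] total by auto
  qed
qed

end

context edge_coloring
begin

theorem gallai_card_le:
  assumes "finite V" "gallai V" "finite_profile \<tau>" "obeys_all \<tau> V"
  shows "card V \<le> profile_bound \<tau>"
  using assms
proof (induction V arbitrary: \<tau> rule: finite_psubset_induct)
  case (psubset V)
  have hb: "hereditarily_bounded V"
    unfolding hereditarily_bounded_def
    using psubset.IH psubset.prems(1) gallai_subset psubset_imp_subset by metis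
  show ?case
  proof (cases "card V \<le> 1")
    case True
    then show ?thesis
      using gr_bound_pos le_trans unfolding profile_bound_def by blast
  next
    case False
    show ?thesis
    proof (cases "\<exists>A B l. bipartition V A B \<and> joined l A B")
      case True
      then show ?thesis
        using card_le_joined[OF psubset.hyps hb psubset.prems(2,3)] by blast
    next
      case nj: False
      obtain i j \<P> where P: "gallai_partition i j V \<P>"
        using gallai_partition_exists psubset False by (metis not_less_eq_eq One_nat_def
            numeral_2_eq_2)
      interpret profiled_decomposition e i j V \<P> \<tau>
        by unfold_locales (use psubset hb nj False P in auto)
      show ?thesis
        by (rule card_le_profile_bound)
    qed
  qed
qed

end

section \<open>Blow-ups\<close>

text \<open>Clique numbers small enough to guarantee the constraint. Outer colorings of blow-ups
  must respect them; a starting block may exceed them.\<close>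

fun clique_limit :: "constraint \<Rightarrow> nat" where
  "clique_limit Book = 3" | "clique_limit Paw = 2" | "clique_limit Triangle = 2" |
      "clique_limit Absent = 1"

lemma (in edge_coloring) clique_limit_imp_obeys:
  assumes "clique_bound i (clique_limit a) U"
  shows "obeys a i U"
proof (cases a)
  case Book
  have "book_free i U"
    unfolding book_free_def
  proof
    assume "\<exists>a b c d v. {a, b, c, d, v} \<subseteq> U \<and> distinct [a, b, c, d, v]
        \<and> clique i {a, b, c, d} \<and> e a v = i \<and> e b v = i"
    then obtain a b c d where w: "{a, b, c, d} \<subseteq> U" "distinct [a, b, c, d]"
        "clique i {a, b, c, d}"
      by auto
    have "card {a, b, c, d} \<le> 3"
      using assms Book w(1,3) by (intro clique_boundD[of i _ U]) auto
    then show False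
      using w(2) by simp
  qed
  then show ?thesis
    using Book by simp
next
  case Paw
  have "paw_free i U"
    unfolding paw_free_def
  proof
    assume "\<exists>a b c v. {a, b, c, v} \<subseteq> U \<and> distinct [a, b, c, v] \<and> clique
        i {a, b, c} \<and> e a v = i"
    then obtain a b c where w: "{a, b, c} \<subseteq> U" "distinct [a, b, c]" "clique i {a, b, c}"
      by auto
    have "card {a, b, c} \<le> 2"
      using assms Paw w(1,3) by (intro clique_boundD[of i _ U]) auto
    then show False
      using w(2) by simp
  qed
  then show ?thesis
    using Paw by simp
qed (use assms in auto)

definition realizable :: "nat \<Rightarrow> (nat \<Rightarrow> constraint) \<Rightarrow> bool" where
  "realizable n \<tau> \<longleftrightarrow> (\<exists>e. edge_coloring e \<and>
      edge_coloring.gallai e {..<n} \<and> edge_coloring.obeys_all e \<tau> {..<n})"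

text \<open>Minimality in the Gallai-Ramsey number concerns every smaller number of vertices, not
  only the extremal one.\<close>

lemma realizable_le:
  assumes "realizable n \<tau>" "m \<le> n"
  shows "realizable m \<tau>"
proof -
  obtain e where e: "edge_coloring e" "edge_coloring.gallai e {..<n}"
      "edge_coloring.obeys_all e \<tau> {..<n}"
    using assms(1) unfolding realizable_def by blast
  interpret edge_coloring e
    by (rule e)
  have "{..<m} \<subseteq> {..<n}"
    using assms(2) by auto
  then have "gallai {..<m}" "obeys_all \<tau> {..<m}"
    using e(2,3) gallai_subset obeys_subset unfolding obeys_all_def by blast+
  then show ?thesis
    using e(1) unfolding realizable_def by blast
qed

text \<open>The starting blocks: four vertices are too few for B3+, three too few for S3+.\<close>

lemma realizable_const:
  assumes "n \<le> (if \<tau> i = Book then 4 else if \<tau> i = Paw then 3 else clique_limit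
      (\<tau> i))"
  shows "realizable n \<tau>"
proof -
  interpret edge_coloring "\<lambda>x y. i"
    by unfold_locales simp
  have n: "card S \<le> n" if "S \<subseteq> {..<n}" for S
    using card_mono[OF _ that] by simp
  have cb: "clique_bound i b {..<n}" if "n \<le> b" for b
    unfolding clique_bound_def using n that le_trans by blast
  have "obeys (\<tau> l) l {..<n}" for l
  proof (cases "l = i")
    case False
    then have "clique_bound l 1 {..<n}"
      by (simp add: clique_bound_1[simplified])
    then have "clique_bound l (clique_limit (\<tau> l)) {..<n}"
      by (rule clique_bound_mono) (cases "\<tau> l"; simp)
    then show ?thesis
      by (rule clique_limit_imp_obeys)
  next
    case True
    show ?thesis
    proof (cases "\<tau> i")
      case Book
      have False if "{a, b, c, d, v} \<subseteq> {..<n}" "distinct [a, b, c, d, v]" for a b c d v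
        using n[OF that(1)] that(2) Book assms by simp
      then have "book_free i {..<n}"
        unfolding book_free_def by blast
      then show ?thesis
        using True Book by simp
    next
      case Paw
      have False if "{a, b, c, v} \<subseteq> {..<n}" "distinct [a, b, c, v]" for a b c v
        using n[OF that(1)] that(2) Paw assms by simp
      then have "paw_free i {..<n}"
        unfolding paw_free_def by blast
      then show ?thesis
        using True Paw by simp
    next
      case Triangle
      then show ?thesis
        using True assms cb by simp
    next
      case Absent
      then show ?thesis
        using True assms cb by simp
    qed
  qed
  then have "obeys_all \<tau> {..<n}"
    unfolding obeys_all_def by blast
  moreover have "gallai {..<n}"
    unfolding gallai_def by simp
  ultimately show ?thesis
    using edge_coloring_axioms unfolding realizable_def by blast
qed

lemma realizable_weaken:
  assumes "realizable n \<tau>" "\<And>i. \<tau>' i = \<tau> i \<or> (\<tau> i = Triangle \<and>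
      \<tau>' i = Paw)"
  shows "realizable n \<tau>'"
proof -
  obtain e where e: "edge_coloring e" "edge_coloring.gallai e {..<n}"
      "edge_coloring.obeys_all e \<tau> {..<n}"
    using assms(1) unfolding realizable_def by blast
  interpret edge_coloring e
    by (rule e)
  have "obeys (\<tau>' i) i {..<n}" for i
    using e(3) assms(2)[of i] clique_limit_imp_obeys[of i Paw "{..<n}"]
    unfolding obeys_all_def by (metis clique_limit.simps(2) obeys_simps(3))
  then have "obeys_all \<tau>' {..<n}"
    unfolding obeys_all_def by blast
  then show ?thesis
    using e unfolding realizable_def by blast
qed

locale blow_up = inner: edge_coloring e + outer: edge_coloring f
  for e f :: "nat \<Rightarrow> nat \<Rightarrow> nat" +
  fixes n m i j :: nat and \<tau> :: "nat \<Rightarrow> constraint"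
  assumes inner_gallai: "inner.gallai {..<n}"
    and inner_obeys: "inner.obeys_all (\<tau>(i := Absent, j := Absent)) {..<n}"
    and outer_colors: "\<And>x y. x < m \<Longrightarrow> y < m \<Longrightarrow> x \<noteq> y
        \<Longrightarrow> f x y \<in> {i, j}"
    and outer_bound: "\<And>l. l \<in> {i, j} \<Longrightarrow> outer.clique_bound l (clique_limit
        (\<tau> l)) {..<m}"
    and pos: "0 < n"
begin

definition g :: "nat \<Rightarrow> nat \<Rightarrow> nat" where
  "g x y = (if x div n = y div n then e (x mod n) (y mod n) else f (x div n) (y div n))"

sublocale edge_coloring g
  by unfold_locales (simp add: g_def inner.sym outer.sym)

lemma div_less: "x < m * n \<Longrightarrow> x div n < m"
  by (simp add: less_mult_imp_div_less)

lemma mod_neq: "x div n = y div n \<Longrightarrow> x \<noteq> y \<Longrightarrow> x mod n \<noteq>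
    y mod n"
  by (metis div_mult_mod_eq)

lemma g_gallai: "gallai {..<m * n}"
  unfolding gallai_def
proof (intro ballI impI)
  fix x y z assume x: "x \<in> {..<m * n}" and y: "y \<in> {..<m * n}" and z: "z \<in> {..<m * n}"
    and d: "x \<noteq> y \<and> y \<noteq> z \<and> x \<noteq> z"
  show "g x y = g y z \<or> g y z = g x z \<or> g x y = g x z"
  proof (cases "x div n = y div n \<or> y div n = z div n \<or> x div n = z div n")
    case False
    then have "g x y \<in> {i, j}" "g y z \<in> {i, j}" "g x z \<in> {i, j}"
      using outer_colors[of "x div n" "y div n"] outer_colors[of "y div n" "z div n"]
        outer_colors[of "x div n" "z div n"] x y z div_less by (simp_all add: g_def)
    then show ?thesis
      by auto
  next
    case some: True
    show ?thesis
    proof (cases "x div n = y div n \<and> y div n = z div n")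
      case True
      then show ?thesis
        using inner.gallaiD[OF inner_gallai, of "x mod n" "y mod n" "z mod n"] mod_neq d pos
        by (simp add: g_def)
    next
      case False
      then show ?thesis
        using some outer.sym by (auto simp: g_def)
    qed
  qed
qed

lemma same_block:
  assumes "l \<notin> {i, j}" "x < m * n" "y < m * n" "g x y = l"
  shows "x div n = y div n"
  using assms outer_colors[of "x div n" "y div n"] div_less unfolding g_def by (auto split:
      if_splits)

lemma g_mod: "x div n = y div n \<Longrightarrow> g x y = e (x mod n) (y mod n)"
  by (simp add: g_def)

lemma inner_clique:
  assumes "clique l K" "K \<subseteq> {..<m * n}" "l \<notin> {i, j}"
  shows "inner.clique l ((\<lambda>x. x mod n) ` K)" and "inj_on (\<lambda>x. x mod n) K"
proof -
  have b: "x div n = y div n" if "x \<in> K" "y \<in> K" for x y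
  proof (cases "x = y")
    case False
    then have "g x y = l"
      using assms(1) that unfolding clique_def by simp
    moreover have "x < m * n" "y < m * n"
      using assms(2) that by auto
    ultimately show ?thesis
      using same_block[OF assms(3)] by blast
  qed simp
  have "e (x mod n) (y mod n) = l" if "x \<in> K" "y \<in> K" "x mod n \<noteq> y mod n" for x y
  proof -
    have "x \<noteq> y"
      using that(3) by auto
    then have "g x y = l"
      using assms(1) that(1,2) unfolding clique_def by simp
    then show ?thesis
      using g_mod[OF b[OF that(1,2)]] by simp
  qed
  then show "inner.clique l ((\<lambda>x. x mod n) ` K)"
    unfolding inner.clique_def by simp
  show "inj_on (\<lambda>x. x mod n) K"
    using b mod_neq by (meson inj_onI)
qed

text \<open>Edges of such a color stay inside blocks and the forbidden graphs are connected, so a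
  copy lies in one block and \<open>mod n\<close> maps it into the inner coloring.\<close>

lemma obeys_inner:
  assumes "l \<notin> {i, j}"
  shows "obeys (\<tau> l) l {..<m * n}"
proof -
  have inner: "inner.obeys (\<tau> l) l {..<n}"
    using inner_obeys assms unfolding inner.obeys_all_def by (metis fun_upd_apply insertCI)
  have cb: "clique_bound l b {..<m * n}" if "inner.clique_bound l b {..<n}" for b
    unfolding clique_bound_def
  proof (intro allI impI)
    fix K assume K: "K \<subseteq> {..<m * n} \<and> finite K \<and> clique l K"
    then have "card ((\<lambda>x. x mod n) ` K) \<le> b"
      using inner_clique(1)[OF _ _ assms, of K] pos by (intro inner.clique_boundD[OF that]) auto
    then show "card K \<le> b"
      using inner_clique(2)[OF _ _ assms, of K] K card_image by metis
  qed
  have block: "x div n = y div n" if "g x y = l" "x < m * n" "y < m * n" for x y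
    using same_block[OF assms] that by blast
  show ?thesis
  proof (cases "\<tau> l")
    case Book
    have "book_free l {..<m * n}"
      unfolding book_free_def
    proof
      assume "\<exists>a b c d v. {a, b, c, d, v} \<subseteq> {..<m * n} \<and> distinct [a, b, c,
          d, v] \<and>
        clique l {a, b, c, d} \<and> g a v = l \<and> g b v = l"
      then obtain a b c d v where w: "{a, b, c, d, v} \<subseteq> {..<m * n}"
          "distinct [a, b, c, d, v]"
        "clique l {a, b, c, d}" "g a v = l" "g b v = l"
        by blast
      have "inner.clique l {a mod n, b mod n, c mod n, d mod n}"
        using inner_clique(1)[OF w(3) _ assms] w(1) by simp
      moreover have "a div n = b div n" "a div n = c div n" "a div n = d div n" "a div n = v div n"
        using w block[of a b] block[of a c] block[of a d] block[of a v] by auto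
      moreover from this have "distinct [a mod n, b mod n, c mod n, d mod n, v mod n]"
        using w(2) mod_neq by simp
      ultimately show False
        using inner.book_freeD[of l "{..<n}" "a mod n" "b mod n" "c mod n" "d mod n" "v mod n"]
          inner Book pos w(4,5) g_mod[of a v] g_mod[of b v] by auto
    qed
    then show ?thesis
      using Book by simp
  next
    case Paw
    have "paw_free l {..<m * n}"
      unfolding paw_free_def
    proof
      assume "\<exists>a b c v. {a, b, c, v} \<subseteq> {..<m * n} \<and> distinct [a, b, c, v]
          \<and>
        clique l {a, b, c} \<and> g a v = l"
      then obtain a b c v where w: "{a, b, c, v} \<subseteq> {..<m * n}" "distinct [a, b, c, v]"
        "clique l {a, b, c}" "g a v = l"
        by blast
      have "inner.clique l {a mod n, b mod n, c mod n}"
        using inner_clique(1)[OF w(3) _ assms] w(1) by simp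
      moreover have "a div n = b div n" "a div n = c div n" "a div n = v div n"
        using w block[of a b] block[of a c] block[of a v] by auto
      moreover from this have "distinct [a mod n, b mod n, c mod n, v mod n]"
        using w(2) mod_neq by simp
      ultimately show False
        using inner.paw_freeD[of l "{..<n}" "a mod n" "b mod n" "c mod n" "v mod n"]
          inner Paw pos w(4) g_mod[of a v] by auto
    qed
    then show ?thesis
      using Paw by simp
  next
    case Triangle
    then show ?thesis
      using inner cb by simp
  next
    case Absent
    then show ?thesis
      using inner cb by simp
  qed
qed

text \<open>The inner coloring avoids color \<open>l\<close>, so a clique has at most one vertex per
  block and \<open>div n\<close> maps it injectively to an outer clique.\<close>

lemma obeys_outer:
  assumes "l \<in> {i, j}"
  shows "obeys (\<tau> l) l {..<m * n}"
proof (rule clique_limit_imp_obeys, unfold clique_bound_def, intro allI impI)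
  fix K assume K: "K \<subseteq> {..<m * n} \<and> finite K \<and> clique l K"
  have "inner.obeys Absent l {..<n}"
    using inner_obeys assms unfolding inner.obeys_all_def by (metis fun_upd_apply insertE
        singletonD)
  then have no: "e x y \<noteq> l" if "x < n" "y < n" "x \<noteq> y" for x y
    using that unfolding inner.obeys_simps inner.clique_bound_1 by simp
  have block: "x div n \<noteq> y div n" if "x \<in> K" "y \<in> K" "x \<noteq> y" for x y
    using that K no[of "x mod n" "y mod n"] mod_neq[of x y] pos g_mod[of x y] unfolding clique_def
        by auto
  then have "inj_on (\<lambda>x. x div n) K"
    by (meson inj_onI)
  moreover have "outer.clique l ((\<lambda>x. x div n) ` K)"
    using K block unfolding clique_def outer.clique_def by (force simp: g_def)
  then have "card ((\<lambda>x. x div n) ` K) \<le> clique_limit (\<tau> l)"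
    using K div_less by (intro outer.clique_boundD[OF outer_bound[OF assms]]) auto
  ultimately show "card K \<le> clique_limit (\<tau> l)"
    by (simp add: card_image)
qed

lemma realizable_blow_up: "realizable (m * n) \<tau>"
proof -
  have "obeys_all \<tau> {..<m * n}"
    unfolding obeys_all_def using obeys_inner obeys_outer by metis
  then show ?thesis
    unfolding realizable_def using g_gallai edge_coloring_axioms by (intro exI[of _ g] conjI)
qed

end

lemma realizable_outer:
  assumes "realizable n (\<tau>(i := Absent, j := Absent))" "0 < n"
    and "edge_coloring f" "\<And>x y. x < m \<Longrightarrow> y < m \<Longrightarrow> x \<noteq> y
        \<Longrightarrow> f x y \<in> {i, j}"
    and "\<And>l. l \<in> {i, j} \<Longrightarrow> edge_coloring.clique_bound f l (clique_limit
        (\<tau> l)) {..<m}"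
  shows "realizable (m * n) \<tau>"
proof -
  obtain e where e: "edge_coloring e" "edge_coloring.gallai e {..<n}"
    "edge_coloring.obeys_all e (\<tau>(i := Absent, j := Absent)) {..<n}"
    using assms(1) unfolding realizable_def by blast
  interpret blow_up e f n m i j \<tau>
    by (intro blow_up.intro blow_up_axioms.intro) (use assms e in auto)
  show ?thesis
    by (rule realizable_blow_up)
qed

lemma realizable_single:
  assumes "realizable n (\<tau>(i := Absent))" "0 < n" "m \<le> clique_limit (\<tau> i)"
  shows "realizable (m * n) \<tau>"
proof -
  interpret edge_coloring "\<lambda>x y. i"
    by unfold_locales simp
  show ?thesis
  proof (rule realizable_outer[where i = i and j = i])
    show "clique_bound l (clique_limit (\<tau> l)) {..<m}" if "l \<in> {i, i}" for l
      unfolding clique_bound_def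
    proof (intro allI impI)
      fix K :: "nat set" assume "K \<subseteq> {..<m} \<and> finite K \<and> clique l K"
      then have "card K \<le> m"
        using card_mono[of "{..<m}" K] by simp
      then show "card K \<le> clique_limit (\<tau> l)"
        using assms(3) that by simp
    qed
  qed (use assms edge_coloring_axioms in simp_all)
qed

section \<open>Circulant colorings on 17, 8 and 5 vertices\<close>

definition circulant :: "nat \<Rightarrow> int set \<Rightarrow> nat \<Rightarrow> nat
    \<Rightarrow> nat \<Rightarrow> nat \<Rightarrow> nat" where
  "circulant m D i j x y = (if (int x - int y) mod int m \<in> D then i else j)"

lemma circulant_sym:
  assumes "\<forall>d\<in>D. (- d) mod int m \<in> D"
  shows "edge_coloring (circulant m D i j)"
proof -
  have "(y - x) mod int m \<in> D" if "(x - y) mod int m \<in> D" for x y :: int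
    using assms that by (metis minus_diff_eq mod_minus_eq)
  then show ?thesis
    by unfold_locales (auto simp: circulant_def)
qed

lemma (in edge_coloring) clique_bound_2I:
  assumes "\<And>x y z. {x, y, z} \<subseteq> U \<Longrightarrow> distinct [x, y, z]
      \<Longrightarrow> e x y = i \<Longrightarrow> e y z = i \<Longrightarrow> e x z = i
      \<Longrightarrow> False"
  shows "clique_bound i 2 U"
proof (rule ccontr)
  assume "\<not> clique_bound i 2 U"
  then obtain x y z where "x \<in> U" "y \<in> U" "z \<in> U" "x \<noteq> y" "x \<noteq> z"
      "y \<noteq> z" "clique i {x, y, z}"
    by (rule not_clique_bound_2E)
  then show False
    using assms[of x y z] unfolding clique_def by simp
qed

lemma (in edge_coloring) clique_bound_3I:
  assumes "\<And>x y z w. {x, y, z, w} \<subseteq> U \<Longrightarrow> distinct [x, y, z, w]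
      \<Longrightarrow> e x y = i \<Longrightarrow> e y z = i \<Longrightarrow>
    e z w = i \<Longrightarrow> e x z = i \<Longrightarrow> e y w = i \<Longrightarrow> e x w = i
        \<Longrightarrow> False"
  shows "clique_bound i 3 U"
proof (rule ccontr)
  assume "\<not> clique_bound i 3 U"
  then obtain K where K: "K \<subseteq> U" "finite K" "clique i K" "card K = Suc 3"
    by (rule not_clique_boundE)
  obtain x L where x: "K = insert x L" "x \<notin> L" "card L = 3"
    using K(4) unfolding card_Suc_eq by blast
  obtain y z w where "L = {y, z, w}" "y \<noteq> z" "z \<noteq> w" "y \<noteq> w"
    using x(3) unfolding card_3_iff by blast
  then show False
    using assms[of x y z w] x(1,2) K(1,3) unfolding clique_def by simp
qed

text \<open>By translation invariance, cliques are detected by the differences of consecutive vertices.\<close>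

lemma circulant_clique_bound_2:
  assumes "edge_coloring f" "\<And>x y. x < m \<Longrightarrow> y < m \<Longrightarrow> x \<noteq>
      y \<Longrightarrow> f x y = i \<Longrightarrow> (int x - int y) mod int m \<in> D"
    and "\<forall>u\<in>D. \<forall>v\<in>D. (u + v) mod int m \<notin> D"
  shows "edge_coloring.clique_bound f i 2 {..<m}"
proof -
  interpret edge_coloring f
    by (rule assms)
  show ?thesis
  proof (rule clique_bound_2I)
    fix x y z assume w: "{x, y, z} \<subseteq> {..<m}" "distinct [x, y, z]" "f x y = i" "f y z = i"
        "f x z = i"
    have "((int x - int y) mod int m + (int y - int z) mod int m) mod int m = (int x - int z) mod
        int m"
      by (simp add: mod_add_eq)
    moreover have "(int x - int y) mod int m \<in> D" "(int y - int z) mod int m \<in> D"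
        "(int x - int z) mod int m \<in> D"
      using w by (auto intro!: assms(2))
    ultimately show False
      using assms(3) by metis
  qed
qed

lemma circulant_clique_bound_3:
  assumes "edge_coloring f" "\<And>x y. x < m \<Longrightarrow> y < m \<Longrightarrow> x \<noteq>
      y \<Longrightarrow> f x y = i \<Longrightarrow> (int x - int y) mod int m \<in> D"
    and "\<forall>u\<in>D. \<forall>v\<in>D. (u + v) mod int m \<in> D \<longrightarrow>
        (\<forall>w\<in>D. (v + w) mod int m \<in> D \<longrightarrow> (u + v + w) mod int m
        \<notin> D)"
  shows "edge_coloring.clique_bound f i 3 {..<m}"
proof -
  interpret edge_coloring f
    by (rule assms)
  show ?thesis
  proof (rule clique_bound_3I)
    fix x y z w assume w: "{x, y, z, w} \<subseteq> {..<m}" "distinct [x, y, z, w]" "f x y = i"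
        "f y z = i"
      "f z w = i" "f x z = i" "f y w = i" "f x w = i"
    define a b c where "a = (int x - int y) mod int m" and "b = (int y - int z) mod int m"
      and "c = (int z - int w) mod int m"
    have ab: "(a + b) mod int m = (int x - int z) mod int m" and bc:
        "(b + c) mod int m = (int y - int w) mod int m"
      unfolding a_def b_def c_def by (simp_all add: mod_add_eq)
    have "(a + b + c) mod int m = ((a + b) mod int m + c) mod int m"
      by (simp add: mod_add_left_eq)
    also have "\<dots> = (int x - int w) mod int m"
      unfolding ab unfolding c_def by (simp add: mod_add_eq)
    finally have abc: "(a + b + c) mod int m = (int x - int w) mod int m" .
    have "a \<in> D" "b \<in> D" "c \<in> D" "(a + b) mod int m \<in> D"
        "(b + c) mod int m \<in> D" "(a + b + c) mod int m \<in> D"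
      unfolding ab bc abc unfolding a_def b_def c_def using w by (simp_all add: assms(2))
    then show False
      using assms(3) by blast
  qed
qed

text \<open>Distinct vertices have nonzero difference modulo \<open>m\<close>, so color
  \<open>j\<close> is described by the complementary differences and the clique tests apply to both
  colors.\<close>

lemma circulant_color:
  assumes "i \<noteq> j" "x < m" "y < m" "x \<noteq> y"
  shows "circulant m D i j x y = i \<Longrightarrow> (int x - int y) mod int m \<in> D"
    and "circulant m D i j x y = j \<Longrightarrow> (int x - int y) mod int m \<in> {1..<int m} -
        D"
proof -
  have "(int x - int y) mod int m \<noteq> 0"
  proof
    assume "(int x - int y) mod int m = 0"
    then have "int m dvd int x - int y"
      by (simp add: dvd_eq_mod_eq_0)
    then show False
      using assms(2-4) dvd_imp_le_int[of "int x - int y" "int m"] by linarith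
  qed
  moreover have "0 \<le> (int x - int y) mod int m" "(int x - int y) mod int m < int m"
    using assms(2) by simp_all
  ultimately show "circulant m D i j x y = i \<Longrightarrow> (int x - int y) mod int m \<in> D"
    "circulant m D i j x y = j \<Longrightarrow> (int x - int y) mod int m \<in> {1..<int m} - D"
    using assms(1) unfolding circulant_def by (auto split: if_splits)
qed

lemma realizable_circulant:
  assumes "realizable n (\<tau>(i := Absent, j := Absent))" "0 < n" "i \<noteq> j"
    and sym: "\<forall>d\<in>D. (- d) mod int m \<in> D"
    and "edge_coloring.clique_bound (circulant m D i j) i (clique_limit (\<tau> i)) {..<m}"
    and "edge_coloring.clique_bound (circulant m D i j) j (clique_limit (\<tau> j)) {..<m}"
  shows "realizable (m * n) \<tau>"
proof (rule realizable_outer[OF assms(1,2) circulant_sym[OF sym, of i j]])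
  show "circulant m D i j x y \<in> {i, j}" for x y
    by (simp add: circulant_def)
qed (use assms in auto)

text \<open>The Paley coloring: \<open>D\<close> consists of the quadratic residues modulo 17.\<close>

lemma realizable_17:
  assumes "realizable n (\<tau>(i := Absent, j := Absent))" "0 < n" "i \<noteq> j"
      "\<tau> i = Book" "\<tau> j = Book"
  shows "realizable (17 * n) \<tau>"
proof -
  define D :: "int set" where "D = {1, 2, 4, 8, 9, 13, 15, 16}"
  have sym: "\<forall>d\<in>D. (- d) mod int 17 \<in> D"
    by (simp add: D_def)
  let ?D' = "{1..<int 17} - D"
  \<comment> \<open>For consecutive differences \<open>u\<close>, \<open>v\<close>, \<open>w\<close>
    the six edges of a K4 have the differences \<open>u\<close>, \<open>v\<close>, \<open>w\<close>,
    \<open>u + v\<close>, \<open>v + w\<close>, \<open>u + v + w\<close>.\<close>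
  have c1: "\<forall>u\<in>D. \<forall>v\<in>D. (u + v) mod int 17 \<in> D \<longrightarrow>
      (\<forall>w\<in>D. (v + w) mod int 17 \<in> D \<longrightarrow> (u + v + w) mod int 17
      \<notin> D)"
    unfolding D_def of_nat_numeral by code_simp
  have c2: "\<forall>u\<in>?D'. \<forall>v\<in>?D'. (u + v) mod int 17 \<in> ?D' \<longrightarrow>
      (\<forall>w\<in>?D'. (v + w) mod int 17 \<in> ?D' \<longrightarrow> (u + v + w) mod int 17
      \<notin> ?D')"
    unfolding D_def of_nat_numeral by code_simp
  note col = circulant_color[OF assms(3), of _ 17 _ D]
  show ?thesis
  proof (rule realizable_circulant[OF assms(1-3) sym])
    show "edge_coloring.clique_bound (circulant 17 D i j) i (clique_limit (\<tau> i)) {..<17}"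
      unfolding assms(4) clique_limit.simps
      by (rule circulant_clique_bound_3[OF circulant_sym[OF sym] col(1) c1])
    show "edge_coloring.clique_bound (circulant 17 D i j) j (clique_limit (\<tau> j)) {..<17}"
      unfolding assms(5) clique_limit.simps
      by (rule circulant_clique_bound_3[OF circulant_sym[OF sym] col(2) c2])
  qed
qed

text \<open>Color \<open>j\<close> has the differences 1, 4, 7 and forms the Wagner graph, which is
  triangle-free and has no four independent vertices.\<close>

lemma realizable_8:
  assumes "realizable n (\<tau>(i := Absent, j := Absent))" "0 < n" "i \<noteq> j"
      "\<tau> i = Book" "\<tau> j = Triangle"
  shows "realizable (8 * n) \<tau>"
proof -
  define D :: "int set" where "D = {2, 3, 5, 6}"
  have sym: "\<forall>d\<in>D. (- d) mod int 8 \<in> D"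
    by (simp add: D_def)
  let ?D' = "{1..<int 8} - D"
  have c1: "\<forall>u\<in>D. \<forall>v\<in>D. (u + v) mod int 8 \<in> D \<longrightarrow>
      (\<forall>w\<in>D. (v + w) mod int 8 \<in> D \<longrightarrow> (u + v + w) mod int 8 \<notin>
      D)"
    unfolding D_def of_nat_numeral by code_simp
  have c2: "\<forall>u\<in>?D'. \<forall>v\<in>?D'. (u + v) mod int 8 \<notin> ?D'"
    unfolding D_def of_nat_numeral by code_simp
  note col = circulant_color[OF assms(3), of _ 8 _ D]
  show ?thesis
  proof (rule realizable_circulant[OF assms(1-3) sym])
    show "edge_coloring.clique_bound (circulant 8 D i j) i (clique_limit (\<tau> i)) {..<8}"
      unfolding assms(4) clique_limit.simps
      by (rule circulant_clique_bound_3[OF circulant_sym[OF sym] col(1) c1])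
    show "edge_coloring.clique_bound (circulant 8 D i j) j (clique_limit (\<tau> j)) {..<8}"
      unfolding assms(5) clique_limit.simps
      by (rule circulant_clique_bound_2[OF circulant_sym[OF sym] col(2) c2])
  qed
qed

text \<open>The pentagon and its complement, again a pentagon.\<close>

lemma realizable_5:
  assumes "realizable n (\<tau>(i := Absent, j := Absent))" "0 < n" "i \<noteq> j"
      "\<tau> i = Triangle" "\<tau> j = Triangle"
  shows "realizable (5 * n) \<tau>"
proof -
  define D :: "int set" where "D = {1, 4}"
  have sym: "\<forall>d\<in>D. (- d) mod int 5 \<in> D"
    by (simp add: D_def)
  let ?D' = "{1..<int 5} - D"
  have c1: "\<forall>u\<in>D. \<forall>v\<in>D. (u + v) mod int 5 \<notin> D"
    unfolding D_def of_nat_numeral by code_simp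
  have c2: "\<forall>u\<in>?D'. \<forall>v\<in>?D'. (u + v) mod int 5 \<notin> ?D'"
    unfolding D_def of_nat_numeral by code_simp
  note col = circulant_color[OF assms(3), of _ 5 _ D]
  show ?thesis
  proof (rule realizable_circulant[OF assms(1-3) sym])
    show "edge_coloring.clique_bound (circulant 5 D i j) i (clique_limit (\<tau> i)) {..<5}"
      unfolding assms(4) clique_limit.simps
      by (rule circulant_clique_bound_2[OF circulant_sym[OF sym] col(1) c1])
    show "edge_coloring.clique_bound (circulant 5 D i j) j (clique_limit (\<tau> j)) {..<5}"
      unfolding assms(5) clique_limit.simps
      by (rule circulant_clique_bound_2[OF circulant_sym[OF sym] col(2) c2])
  qed
qed

section \<open>Assembling the extremal colorings\<close>

definition has_counts :: "(nat \<Rightarrow> constraint) \<Rightarrow> nat \<Rightarrow> nat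
    \<Rightarrow> nat \<Rightarrow> bool" where
  "has_counts \<tau> r s t \<longleftrightarrow> finite_profile \<tau> \<and> card {i. \<tau> i =
      Book} = r \<and> card {i. \<tau> i = Paw} = s \<and>
     card {i. \<tau> i = Triangle} = t"

lemma has_counts_remove:
  assumes "has_counts \<tau> r s t" "0 < (case a of Book \<Rightarrow> r | Paw \<Rightarrow> s |
      Triangle \<Rightarrow> t | Absent \<Rightarrow> 0)"
  obtains i where "\<tau> i = a"
    "has_counts (\<tau>(i := Absent)) (r - of_bool (a = Book)) (s - of_bool (a = Paw)) (t - of_bool
        (a = Triangle))"
proof -
  have "card {i. \<tau> i = a} \<noteq> 0"
    using assms unfolding has_counts_def by (cases a) auto
  then have "{i. \<tau> i = a} \<noteq> {}"
    by (intro notI) simp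
  then obtain i where i: "\<tau> i = a"
    by blast
  have fin: "finite_profile \<tau>"
    using assms(1) unfolding has_counts_def by blast
  have "card {k. \<tau> k = b} = card {k. (\<tau>(i := Absent)) k = b} + of_bool (a = b)" if
      "b \<noteq> Absent" for b
    using card_profile_upd[OF fin that, of i a] fun_upd_idem[of \<tau> i a] i by simp
  from this[of Book] this[of Paw] this[of Triangle]
  have "has_counts (\<tau>(i := Absent)) (r - of_bool (a = Book)) (s - of_bool (a = Paw)) (t -
      of_bool (a = Triangle))"
    using assms(1) finite_profile_upd[OF fin, of i Absent] unfolding has_counts_def by simp
  then show ?thesis
    using that i by blast
qed

lemma has_counts_remove2:
  assumes "has_counts \<tau> r s t" "0 < (case a of Book \<Rightarrow> r | Paw \<Rightarrow> s |
      Triangle \<Rightarrow> t | Absent \<Rightarrow> 0)"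
    and "0 < (case b of Book \<Rightarrow> r - of_bool (a = Book) | Paw \<Rightarrow> s - of_bool
        (a = Paw)
      | Triangle \<Rightarrow> t - of_bool (a = Triangle) | Absent \<Rightarrow> 0)"
  obtains i j where "i \<noteq> j" "\<tau> i = a" "\<tau> j = b"
    "has_counts (\<tau>(i := Absent, j := Absent)) (r - of_bool (a = Book) - of_bool (b = Book))
      (s - of_bool (a = Paw) - of_bool (b = Paw)) (t - of_bool (a = Triangle) - of_bool (b =
          Triangle))"
proof -
  obtain i where i: "\<tau> i = a"
    "has_counts (\<tau>(i := Absent)) (r - of_bool (a = Book)) (s - of_bool (a = Paw)) (t - of_bool
        (a = Triangle))"
    using has_counts_remove[OF assms(1,2)] .
  obtain j where j: "(\<tau>(i := Absent)) j = b"
    "has_counts (\<tau>(i := Absent, j := Absent)) (r - of_bool (a = Book) - of_bool (b = Book))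
      (s - of_bool (a = Paw) - of_bool (b = Paw)) (t - of_bool (a = Triangle) - of_bool (b =
          Triangle))"
    using has_counts_remove[OF i(2) assms(3)] .
  have "b \<noteq> Absent"
    using assms(3) by auto
  then have "i \<noteq> j" "\<tau> j = b"
    using j(1) by (auto split: if_splits)
  then show ?thesis
    using that i(1) j(2) by blast
qed

text \<open>Each factor 2, 8 or 5 is the size of an outer coloring. From 9 the factor 5 would yield
  only 45, so the value 48 at \<open>t = 2\<close> is reached as 2 * 24.\<close>

lemma gr_bound_recurrences:
  "gr_bound 0 0 0 = 1" "gr_bound (Suc 0) 0 0 = 4" "gr_bound 0 (Suc 0) 0 = 3"
  "gr_bound (Suc 0) (Suc 0) 0 = 9"
  "gr_bound 0 s (Suc 0) = 2 * gr_bound 0 s 0"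
  "gr_bound (Suc 0) s (Suc 0) = 8 * gr_bound 0 s 0"
  "gr_bound 0 s (Suc (Suc t)) = 5 * gr_bound 0 s t"
  "gr_bound (Suc 0) 0 (Suc (Suc t)) = 5 * gr_bound (Suc 0) 0 t"
  "gr_bound (Suc 0) (Suc 0) (Suc (Suc 0)) = 2 * gr_bound (Suc 0) (Suc 0) (Suc 0)"
  "gr_bound (Suc 0) (Suc 0) (Suc (Suc (Suc t))) = 5 * gr_bound (Suc 0) (Suc 0) (Suc t)"
  if "s \<le> 1"
proof -
  have "s = 0 \<or> s = Suc 0"
    using that by auto
  then show "gr_bound 0 0 0 = 1" "gr_bound (Suc 0) 0 0 = 4" "gr_bound 0 (Suc 0) 0 = 3"
    "gr_bound (Suc 0) (Suc 0) 0 = 9"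
    "gr_bound 0 s (Suc 0) = 2 * gr_bound 0 s 0"
    "gr_bound (Suc 0) s (Suc 0) = 8 * gr_bound 0 s 0"
    "gr_bound 0 s (Suc (Suc t)) = 5 * gr_bound 0 s t"
    "gr_bound (Suc 0) 0 (Suc (Suc t)) = 5 * gr_bound (Suc 0) 0 t"
    "gr_bound (Suc 0) (Suc 0) (Suc (Suc 0)) = 2 * gr_bound (Suc 0) (Suc 0) (Suc 0)"
    "gr_bound (Suc 0) (Suc 0) (Suc (Suc (Suc t))) = 5 * gr_bound (Suc 0) (Suc 0) (Suc t)"
    by (auto simp: gr_bound_def)
qed

text \<open>The color under S3+ is kept for the innermost block. Pairs of B3+ colors are removed
  first, so that only \<open>r < 2\<close> remains.\<close>

lemma realizable_one_Paw:
  assumes "has_counts \<tau> r s t" "s \<le> 1"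
  shows "realizable (gr_bound r s t) \<tau>"
  using assms
proof (induction "r + t" arbitrary: r s t \<tau> rule: less_induct)
  case less
  note rec = gr_bound_recurrences[OF less.prems(2)]
  have pos: "0 < gr_bound a b c" for a b c
    using gr_bound_pos[of a b c] by simp
  have rem: ?case if eq: "gr_bound r s t = m * gr_bound r s (t - 1)" "0 < t" "m \<le> 2" for m
  proof -
    obtain i where i: "\<tau> i = Triangle" "has_counts (\<tau>(i := Absent)) r s (t - 1)"
      using has_counts_remove[OF less.prems(1), of Triangle] eq(2) by auto
    have "realizable (gr_bound r s (t - 1)) (\<tau>(i := Absent))"
      using less.hyps[OF _ i(2) less.prems(2)] eq(2) by simp
    then show ?thesis
      using realizable_single[of _ \<tau> i m] pos i(1) eq by simp
  qed
  have rem5: ?case if eq: "gr_bound r s t = 5 * gr_bound r s (t - 2)" "2 \<le> t"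
  proof -
    obtain i j where ij: "i \<noteq> j" "\<tau> i = Triangle" "\<tau> j = Triangle"
      "has_counts (\<tau>(i := Absent, j := Absent)) r s (t - 2)"
      using has_counts_remove2[OF less.prems(1), of Triangle Triangle] eq(2)
      by (auto simp: numeral_2_eq_2)
    have "realizable (gr_bound r s (t - 2)) (\<tau>(i := Absent, j := Absent))"
      using less.hyps[OF _ ij(4) less.prems(2)] eq(2) by simp
    then show ?thesis
      unfolding eq(1) using realizable_5 ij pos by blast
  qed
  have rem8: ?case if eq: "gr_bound r s t = 8 * gr_bound (r - 1) s (t - 1)" "0 < r" "0 < t"
  proof -
    obtain i j where ij: "i \<noteq> j" "\<tau> i = Book" "\<tau> j = Triangle"
      "has_counts (\<tau>(i := Absent, j := Absent)) (r - 1) s (t - 1)"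
      using has_counts_remove2[OF less.prems(1), of Book Triangle] eq by auto
    have "realizable (gr_bound (r - 1) s (t - 1)) (\<tau>(i := Absent, j := Absent))"
      using less.hyps[OF _ ij(4) less.prems(2)] eq(2) by simp
    then show ?thesis
      unfolding eq(1) using realizable_8 ij pos by blast
  qed
  consider "2 \<le> r" | "r < 2" "t = 0" | "r = 0" "t = 1" | "r = 1" "t = 1" | "r = 1" "s = 1"
      "t = 2"
    | "r = 0 \<or> s = 0 \<or> 3 \<le> t" "r < 2" "2 \<le> t"
    using less.prems(2) by linarith
  then show ?case
  proof cases
    case 1
    obtain i j where ij: "i \<noteq> j" "\<tau> i = Book" "\<tau> j = Book"
      "has_counts (\<tau>(i := Absent, j := Absent)) (r - 2) s t"
      using has_counts_remove2[OF less.prems(1), of Book Book] 1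
      by (auto simp: numeral_2_eq_2)
    have eq: "gr_bound r s t = 17 * gr_bound (r - 2) s t"
      using gr_bound_Suc2[of "r - 2" s t] 1 by (simp add: numeral_2_eq_2 Suc_diff_Suc)
    have "realizable (gr_bound (r - 2) s t) (\<tau>(i := Absent, j := Absent))"
      using less.hyps[OF _ ij(4) less.prems(2)] 1 by simp
    then show ?thesis
      unfolding eq using realizable_17 ij pos by blast
  next
    case 2
    have paw: "realizable 3 \<tau>'" if "\<tau>' i = Paw" for \<tau>' i
      using that by (intro realizable_const[of 3 \<tau>' i]) simp
    consider "r = 0" "s = 0" | "r = 1" "s = 0" | "r = 0" "s = 1" | "r = 1" "s = 1"
      using 2 less.prems(2) by linarith
    then show ?thesis
    proof cases
      case 1
      have "1 \<le> clique_limit (\<tau> 0)"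
        by (cases "\<tau> 0") simp_all
      then have "realizable 1 \<tau>"
        by (intro realizable_const[of 1 \<tau> 0]) auto
      then show ?thesis
        using 1 2 rec by simp
    next
      case b: 2
      obtain i where "\<tau> i = Book"
        using has_counts_remove[OF less.prems(1), of Book] b by auto
      then have "realizable 4 \<tau>"
        by (intro realizable_const[of 4 \<tau> i]) auto
      then show ?thesis
        using b 2 rec by simp
    next
      case p: 3
      obtain i where "\<tau> i = Paw"
        using has_counts_remove[OF less.prems(1), of Paw] p by auto
      then show ?thesis
        using paw p 2 rec by simp
    next
      case bp: 4
      obtain i j where ij: "i \<noteq> j" "\<tau> i = Book" "\<tau> j = Paw"
        "has_counts (\<tau>(i := Absent, j := Absent)) 0 0 t"
        using has_counts_remove2[OF less.prems(1), of Book Paw] bp by auto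
      \<comment> \<open>A triangle in the S3+ color, tripled by a triangle in the B3+ color, gives
        the exceptional value 9.\<close>
      then have "realizable 3 (\<tau>(i := Absent))"
        by (intro paw[of _ j]) simp
      then have "realizable (3 * 3) \<tau>"
        using ij by (intro realizable_single[of _ \<tau> i]) auto
      then show ?thesis
        using bp 2 rec by simp
    qed
  next
    case 3
    then show ?thesis
      using rem[of 2] rec by simp
  next
    case 4
    then show ?thesis
      using rem8 rec by simp
  next
    case 5
    then show ?thesis
      using rem[of 2] rec by (simp add: numeral_2_eq_2)
  next
    case 6
    have "gr_bound r s t = 5 * gr_bound r s (t - 2)"
    proof -
      obtain u where u: "t = Suc (Suc u)"
        using 6(3) by (metis One_nat_def Suc_1 Suc_le_D Suc_le_mono)
      show ?thesis
      proof (cases "r = 0 \<or> s = 0")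
        case True
        then show ?thesis
          using 6(2) rec(7)[of u] rec(8)[of u] u by (cases r) auto
      next
        case False
        then have "r = Suc 0" "s = Suc 0"
          using 6(2) less.prems(2) by auto
        moreover obtain v where "u = Suc v"
          using 6(1) False u by (cases u) auto
        ultimately show ?thesis
          using rec(10) u by simp
      qed
    qed
    then show ?thesis
      using rem5 6(3) by blast
  qed
qed

section \<open>Gallai-Ramsey numbers\<close>

text \<open>For \<open>s \<ge> 1\<close> the bound depends on \<open>s\<close> and \<open>t\<close>
  only through \<open>s + t\<close>, so all S3+ colors except one may be treated as K3
  colors.\<close>

lemma realizable_gr_bound:
  assumes "has_counts \<tau> r s t"
  shows "realizable (gr_bound r s t) \<tau>"
proof (cases "s \<le> 1")
  case True
  then show ?thesis
    using realizable_one_Paw assms by blast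
next
  case False
  obtain p where p: "\<tau> p = Paw"
    using has_counts_remove[OF assms, of Paw] False by auto
  define \<sigma> where "\<sigma> i = (if \<tau> i = Paw \<and> i \<noteq> p then Triangle else
      \<tau> i)" for i
  have "finite {i. \<tau> i \<noteq> Absent}"
    using assms unfolding has_counts_def finite_profile_def by blast
  then have fin: "finite {i. \<tau> i = a}" if "a \<noteq> Absent" for a
    by (rule rev_finite_subset) (use that in auto)
  have "{i. \<sigma> i \<noteq> Absent} = {i. \<tau> i \<noteq> Absent}"
      "{i. \<sigma> i = Book} = {i. \<tau> i = Book}"
    "{i. \<sigma> i = Paw} = {p}" "{i. \<sigma> i = Triangle} = {i. \<tau> i = Triangle} \<union>
        ({i. \<tau> i = Paw} - {p})"
    using p by (auto simp: \<sigma>_def)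
  moreover have "card ({i. \<tau> i = Triangle} \<union> ({i. \<tau> i = Paw} - {p})) = t + (s - 1)"
    using assms p fin by (subst card_Un_disjoint) (auto simp: has_counts_def)
  ultimately have "has_counts \<sigma> r 1 (t + (s - 1))"
    using assms by (simp add: has_counts_def finite_profile_def)
  then have "realizable (gr_bound r 1 (t + (s - 1))) \<sigma>"
    by (intro realizable_one_Paw) simp_all
  moreover have "1 + (t + (s - 1)) = s + t"
    using False by simp
  then have "gr_bound r 1 (t + (s - 1)) = gr_bound r s t"
    using False unfolding gr_bound_def by (simp add: add.commute)
  ultimately have "realizable (gr_bound r s t) \<sigma>"
    by simp
  then show ?thesis
    by (rule realizable_weaken) (auto simp: \<sigma>_def)
qed

section \<open>Translation between copies of graphs and constraints on colors\<close>

lemma B3_plus_eq: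
  "B3_plus = ({0, 1, 2, 3, 4}, {{2, 3}, {0, 1}, {1, 2}, {1, 3}, {1, 4}, {0, 2}, {0, 3}, {0, 4}})"
proof -
  have "{..<3 + 2} = {0, 1, 2, 3, 4 :: nat}" "{2..<3 + 2} = {2, 3, 4 :: nat}"
    by auto
  moreover have "{{u, v} | u v. u \<in> A \<and> v \<in> B} = (\<Union>u\<in>A. (\<lambda>v. {u,
      v}) ` B)" for A B :: "nat set"
    by auto
  ultimately show ?thesis
    unfolding B3_plus_def book_graph_def add_edge_def by (simp only: fst_conv snd_conv) simp
qed

lemma S3_plus_eq: "S3_plus = ({0, 1, 2, 3}, {{1, 2}, {0, 1}, {0, 2}, {0, 3}})"
proof -
  have "{0..3} = {0, 1, 2, 3 :: nat}" "{1..3} = {1, 2, 3 :: nat}"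
    by auto
  moreover have "{{0, i} | i. i \<in> A} = (\<lambda>i. {0, i}) ` A" for A :: "nat set"
    by auto
  ultimately show ?thesis
    unfolding S3_plus_def star_graph_def add_edge_def by (simp only: fst_conv snd_conv) simp
qed

locale set_coloring =
  fixes c :: "nat set \<Rightarrow> nat"

sublocale set_coloring \<subseteq> edge_coloring "\<lambda>x y. c {x, y}"
  by unfold_locales (simp add: insert_commute)

context set_coloring
begin

lemma mono_copy_B3_plus: "mono_copy n c i B3_plus \<longleftrightarrow> \<not> book_free i {..<n}"
proof
  assume "mono_copy n c i B3_plus"
  then obtain f where f: "inj_on f {0, 1, 2, 3, 4 :: nat}" "f ` {0, 1, 2, 3, 4} \<subseteq> {..<n}"
    and e: "c {f 0, f 1} = i" "c {f 0, f 2} = i" "c {f 0, f 3} = i" "c {f 1, f 2} = i"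
      "c {f 1, f 3} = i" "c {f 2, f 3} = i" "c {f 0, f 4} = i" "c {f 1, f 4} = i"
    unfolding mono_copy_def B3_plus_eq by auto
  have "distinct [f 0, f 1, f 2, f 3, f 4]"
    using f(1) by (simp add: inj_on_def)
  moreover have "{f 0, f 1, f 2, f 3, f 4} \<subseteq> {..<n}"
    using f(2) by simp
  moreover have "clique i {f 0, f 1, f 2, f 3}"
    using e by simp
  ultimately show "\<not> book_free i {..<n}"
    using e(7,8) book_freeD by metis
next
  assume "\<not> book_free i {..<n}"
  then obtain a b d u v where w: "{a, b, d, u, v} \<subseteq> {..<n}" "distinct [a, b, d, u, v]"
    "clique i {a, b, d, u}" "c {a, v} = i" "c {b, v} = i"
    unfolding book_free_def by blast
  \<comment> \<open>The spine 0, 1 goes to \<open>a\<close>, \<open>b\<close>, the added edge 2, 3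
    to \<open>d\<close>, \<open>u\<close>, and the remaining vertex 4 to \<open>v\<close>.\<close>
  let ?f = "\<lambda>k. [a, b, d, u, v] ! k"
  have "inj_on ?f {0, 1, 2, 3, 4}" "?f ` {0, 1, 2, 3, 4} \<subseteq> {..<n}"
    using w(1,2) by auto
  moreover have "\<forall>e\<in>{{2, 3}, {0, 1}, {1, 2}, {1, 3}, {1, 4}, {0, 2}, {0, 3}, {0, 4}}. c
      (?f ` e) = i"
    using w by auto
  ultimately show "mono_copy n c i B3_plus"
    unfolding mono_copy_def B3_plus_eq fst_conv snd_conv by (intro exI[of _ ?f] conjI)
qed

lemma mono_copy_S3_plus: "mono_copy n c i S3_plus \<longleftrightarrow> \<not> paw_free i {..<n}"
proof
  assume "mono_copy n c i S3_plus"
  then obtain f where f: "inj_on f {0, 1, 2, 3 :: nat}" "f ` {0, 1, 2, 3} \<subseteq> {..<n}"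
    and e: "c {f 0, f 1} = i" "c {f 0, f 2} = i" "c {f 1, f 2} = i" "c {f 0, f 3} = i"
    unfolding mono_copy_def S3_plus_eq by auto
  have "distinct [f 0, f 1, f 2, f 3]"
    using f(1) by (simp add: inj_on_def)
  moreover have "{f 0, f 1, f 2, f 3} \<subseteq> {..<n}"
    using f(2) by simp
  moreover have "clique i {f 0, f 1, f 2}"
    using e by simp
  ultimately show "\<not> paw_free i {..<n}"
    using e(4) paw_freeD by metis
next
  assume "\<not> paw_free i {..<n}"
  then obtain a b d v where w: "{a, b, d, v} \<subseteq> {..<n}" "distinct [a, b, d, v]"
    "clique i {a, b, d}" "c {a, v} = i"
    unfolding paw_free_def by blast
  let ?f = "\<lambda>k. [a, b, d, v] ! k"
  have "inj_on ?f {0, 1, 2, 3}" "?f ` {0, 1, 2, 3} \<subseteq> {..<n}"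
    using w(1,2) by auto
  moreover have "\<forall>e\<in>{{1, 2}, {0, 1}, {0, 2}, {0, 3}}. c (?f ` e) = i"
    using w by auto
  ultimately show "mono_copy n c i S3_plus"
    unfolding mono_copy_def S3_plus_eq fst_conv snd_conv by (intro exI[of _ ?f] conjI)
qed

lemma mono_copy_complete_graph:
  "mono_copy n c i (complete_graph m) \<longleftrightarrow> (\<exists>K. K \<subseteq> {..<n}
      \<and> finite K \<and> clique i K \<and> card K = m)"
proof
  assume "mono_copy n c i (complete_graph m)"
  then obtain f where f: "inj_on f {..<m}" "f ` {..<m} \<subseteq> {..<n}"
    and e: "\<And>A. A \<in> [{..<m}]\<^bsup>2\<^esup> \<Longrightarrow> c (f ` A) = i"
    unfolding mono_copy_def complete_graph_def by auto
  have "c {f x, f y} = i" if "x < m" "y < m" "x \<noteq> y" for x y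
    using e[of "{x, y}"] that by simp
  then have "clique i (f ` {..<m})"
    unfolding clique_def by auto
  then show "\<exists>K. K \<subseteq> {..<n} \<and> finite K \<and> clique i K \<and> card K = m"
    using f by (intro exI[of _ "f ` {..<m}"]) (simp add: card_image)
next
  assume "\<exists>K. K \<subseteq> {..<n} \<and> finite K \<and> clique i K \<and> card K = m"
  then obtain K where K: "K \<subseteq> {..<n}" "finite K" "clique i K" "card K = m"
    by blast
  obtain f where "bij_betw f {..<m} K"
    using ex_bij_betw_nat_finite[OF K(2)] K(4) by (auto simp: atLeast0LessThan)
  then have f: "inj_on f {..<m}" "f ` {..<m} = K"
    by (auto simp: bij_betw_def)
  have "c (f ` A) = i" if A: "A \<in> [{..<m}]\<^bsup>2\<^esup>" for A
  proof -
    obtain x y where xy: "A = {x, y}" "x \<in> {..<m}" "y \<in> {..<m}" "x \<noteq> y"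
      using A by (rule nsets2_E)
    then have "f x \<in> K" "f y \<in> K" "f x \<noteq> f y"
      using f by (auto simp: inj_on_def)
    then show ?thesis
      using K(3) xy(1) unfolding clique_def by simp
  qed
  then show "mono_copy n c i (complete_graph m)"
    unfolding mono_copy_def complete_graph_def using f K(1) by auto
qed

lemma mono_copy_K3: "mono_copy n c i (complete_graph 3) \<longleftrightarrow> \<not> clique_bound i
    2 {..<n}"
proof
  assume "mono_copy n c i (complete_graph 3)"
  then obtain K where K: "K \<subseteq> {..<n}" "finite K" "clique i K" "card K = 3"
    unfolding mono_copy_complete_graph by blast
  then show "\<not> clique_bound i 2 {..<n}"
    using clique_boundD[OF _ K(1-3), of 2] by auto
next
  assume "\<not> clique_bound i 2 {..<n}"
  then obtain K where "K \<subseteq> {..<n}" "finite K" "clique i K" "card K = Suc 2"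
    by (rule not_clique_boundE)
  then show "mono_copy n c i (complete_graph 3)"
    unfolding mono_copy_complete_graph by auto
qed

end

text \<open>\<open>Absent\<close> outside the palette expresses that a coloring takes values in
  \<open>{1..k}\<close>.\<close>

definition block_profile :: "nat \<Rightarrow> nat \<Rightarrow> nat \<Rightarrow> nat
    \<Rightarrow> constraint" where
  "block_profile k r s i = (if i \<notin> {1..k} then Absent else if i \<le> r then Book
     else if i \<le> r + s then Paw else Triangle)"

lemma has_counts_block_profile: "has_counts (block_profile (r + s + t) r s) r s t"
proof -
  have "{i. block_profile (r + s + t) r s i \<noteq> Absent} = {1..r + s + t}"
    "{i. block_profile (r + s + t) r s i = Book} = {1..r}"
    "{i. block_profile (r + s + t) r s i = Paw} = {r + 1..r + s}"
    "{i. block_profile (r + s + t) r s i = Triangle} = {r + s + 1..r + s + t}"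
    by (auto simp: block_profile_def split: if_splits)
  then show ?thesis
    by (simp add: has_counts_def finite_profile_def)
qed

lemma (in set_coloring) gallai_coloring_iff:
  "gallai_coloring n k c \<and> (\<forall>i\<in>{1..k}. \<not> mono_copy n c i (three_blocks r
      B3_plus s S3_plus (complete_graph 3) i))
    \<longleftrightarrow> gallai {..<n} \<and> obeys_all (block_profile k r s) {..<n}"
proof -
  have "gallai_coloring n k c \<longleftrightarrow> gallai {..<n} \<and> (\<forall>i. i \<notin>
      {1..k} \<longrightarrow> clique_bound i 1 {..<n})"
  proof -
    have "c \<in> [{..<n}]\<^bsup>2\<^esup> \<rightarrow> {1..k} \<longleftrightarrow>
        (\<forall>x<n. \<forall>y<n. x \<noteq> y \<longrightarrow> c {x, y} \<in> {1..k})"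
      by (auto simp: Pi_iff nsets_2_eq)
    also have "\<dots> \<longleftrightarrow> (\<forall>i. i \<notin> {1..k} \<longrightarrow>
        clique_bound i 1 {..<n})"
      unfolding clique_bound_1 by (metis lessThan_iff)
    finally show ?thesis
      unfolding gallai_coloring_def gallai_def by blast
  qed
  moreover have "obeys (block_profile k r s i) i {..<n} \<longleftrightarrow>
    (if i \<in> {1..k} then \<not> mono_copy n c i (three_blocks r B3_plus s S3_plus
        (complete_graph 3) i)
     else clique_bound i 1 {..<n})" for i
    by (simp add: block_profile_def three_blocks_def mono_copy_B3_plus mono_copy_S3_plus
        mono_copy_K3)
  ultimately show ?thesis
    unfolding obeys_all_def by auto
qed

lemma gallai_ramsey_eq:
  "gallai_ramsey (r + s + t) (three_blocks r B3_plus s S3_plus (complete_graph 3)) = gr_bound r s t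
      + 1"
  unfolding gallai_ramsey_def
proof (rule Least_equality)
  let ?k = "r + s + t" and ?H = "three_blocks r B3_plus s S3_plus (complete_graph 3)"
  let ?\<tau> = "block_profile ?k r s"
  have counts: "has_counts ?\<tau> r s t"
    by (rule has_counts_block_profile)
  then have bound: "profile_bound ?\<tau> = gr_bound r s t" and fin: "finite_profile ?\<tau>"
    by (simp_all add: has_counts_def profile_bound_def)
  show "\<forall>c. gallai_coloring (gr_bound r s t + 1) ?k c \<longrightarrow>
    (\<exists>i\<in>{1..?k}. mono_copy (gr_bound r s t + 1) c i (?H i))"
  proof (intro allI impI, rule ccontr)
    fix c
    interpret set_coloring c .
    assume "gallai_coloring (gr_bound r s t + 1) ?k c"
      "\<not> (\<exists>i\<in>{1..?k}. mono_copy (gr_bound r s t + 1) c i (?H i))"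
    then have "gallai {..<gr_bound r s t + 1} \<and> obeys_all ?\<tau> {..<gr_bound r s t + 1}"
      using gallai_coloring_iff by blast
    then have "card {..<gr_bound r s t + 1} \<le> profile_bound ?\<tau>"
      using fin by (intro gallai_card_le) auto
    then show False
      using bound by simp
  qed
  fix n
  assume forced: "\<forall>c. gallai_coloring n ?k c \<longrightarrow> (\<exists>i\<in>{1..?k}.
      mono_copy n c i (?H i))"
  show "gr_bound r s t + 1 \<le> n"
  proof (rule ccontr)
    assume "\<not> gr_bound r s t + 1 \<le> n"
    then have "realizable n ?\<tau>"
      using realizable_le[OF realizable_gr_bound[OF counts], of n] by simp
    then obtain e where e: "edge_coloring e" "edge_coloring.gallai e {..<n}"
      "edge_coloring.obeys_all e ?\<tau> {..<n}"
      unfolding realizable_def by blast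
    \<comment> \<open>Turns the symmetric function \<open>e\<close> into a function on two-element
      sets; they agree by symmetry of \<open>e\<close>.\<close>
    define c where "c A = e (Min A) (Max A)" for A
    interpret set_coloring c .
    have "c {x, y} = e x y" for x y
      using edge_coloring.sym[OF e(1)] by (cases "x \<le> y") (simp_all add: c_def min_def max_def)
    then have ce: "(\<lambda>x y. c {x, y}) = e"
      by presburger
    have "gallai_coloring n ?k c \<and> (\<forall>i\<in>{1..?k}. \<not> mono_copy n c i (?H i))"
      using e(2,3) gallai_coloring_iff unfolding ce by blast
    then show False
      using forced by blast
  qed
qed

theorem theorem1:
  fixes r s t k :: nat
  assumes "k = r + s + t"
  shows "let g = gallai_ramsey k (three_blocks r B3_plus s S3_plus (complete_graph 3)) in
    (s = 0 \<and> even r \<and> even t \<longrightarrow>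
       g = 17 ^ (r div 2) * 5 ^ (t div 2) + 1) \<and>
    (s = 0 \<and> even r \<and> odd t \<longrightarrow>
       g = 2 * 17 ^ (r div 2) * 5 ^ ((t - 1) div 2) + 1) \<and>
    (s = 0 \<and> odd r \<and> odd t \<longrightarrow>
       g = 8 * 17 ^ ((r - 1) div 2) * 5 ^ ((t - 1) div 2) + 1) \<and>
    (s = 0 \<and> odd r \<and> even t \<longrightarrow>
       g = 4 * 17 ^ ((r - 1) div 2) * 5 ^ (t div 2) + 1) \<and>
    (s \<ge> 1 \<and> even r \<and> even (s + t) \<longrightarrow>
       g = 6 * 17 ^ (r div 2) * 5 ^ ((s + t - 2) div 2) + 1) \<and>
    (s \<ge> 1 \<and> even r \<and> odd (s + t) \<longrightarrow>
       g = 3 * 17 ^ (r div 2) * 5 ^ ((s + t - 1) div 2) + 1) \<and>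
    (s \<ge> 1 \<and> odd r \<and> t \<ge> 1 \<and> odd (s + t) \<longrightarrow>
       g = 48 * 17 ^ ((r - 1) div 2) * 5 ^ ((s + t - 3) div 2) + 1) \<and>
    (odd r \<and> odd s \<and> s \<ge> 3 \<and> t = 0 \<longrightarrow>
       g = 48 * 17 ^ ((r - 1) div 2) * 5 ^ ((s - 3) div 2) + 1) \<and>
    (odd r \<and> s = 1 \<and> t = 0 \<longrightarrow>
       g = 9 * 17 ^ ((r - 1) div 2) + 1) \<and>
    (s \<ge> 1 \<and> odd r \<and> even (s + t) \<longrightarrow>
       g = 24 * 17 ^ ((r - 1) div 2) * 5 ^ ((s + t - 2) div 2) + 1)"
proof -
  have g: "gallai_ramsey k (three_blocks r B3_plus s S3_plus (complete_graph 3)) = gr_bound r s t +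
      1"
    unfolding assms by (rule gallai_ramsey_eq)
  have r: "(r - 1) div 2 = r div 2" if "odd r"
    using that by presburger
  have t: "(t - 1) div 2 = t div 2" if "odd t"
    using that by presburger
  have even_st: "(s + t - 1) div 2 = (s + t - 2) div 2" "2 \<le> s + t" if "even (s + t)"
      "s \<ge> 1"
    using that by presburger+
  have odd_st: "(s + t - 2) div 2 = (s + t - 3) div 2" if "odd (s + t)"
    using that by presburger
  have s0: "gr_bound r 0 t =
      17 ^ (r div 2) * ((if even r then 1 else 4) * ((if even t then 1 else 2) * 5 ^ (t div 2)))"
    by (simp add: gr_bound_def tri_bound_def)
  have even_r: "gr_bound r s t = 17 ^ (r div 2) *
      (3 * ((if odd (s + t) then 1 else 2) * 5 ^ ((s + t - 1) div 2)))" if "s \<ge> 1" "even r"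
    using that by (simp add: gr_bound_def tri_bound_def)
  \<comment> \<open>The condition \<open>2 \<le> s + t\<close> leaves out the exceptional value
    9.\<close>
  have odd_r: "gr_bound r s t = 17 ^ ((r - 1) div 2) *
      (24 * ((if even (s + t) then 1 else 2) * 5 ^ ((s + t - 2) div 2)))" if "s \<ge> 1" "odd r" "2
          \<le> s + t"
    using that r by (simp add: gr_bound_def tri_bound_def)
  show ?thesis
    unfolding Let_def g
  proof (intro conjI impI; elim conjE)
    assume "s \<ge> 1" "even r" "even (s + t)"
    then show "gr_bound r s t + 1 = 6 * 17 ^ (r div 2) * 5 ^ ((s + t - 2) div 2) + 1"
      unfolding even_r[OF \<open>s \<ge> 1\<close> \<open>even r\<close>] even_st(1)[OF \<open>even
          (s + t)\<close> \<open>s \<ge> 1\<close>] by simp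
  next
    assume "s \<ge> 1" "odd r" "t \<ge> 1" "odd (s + t)"
    then have "2 \<le> s + t"
      by simp
    then show "gr_bound r s t + 1 = 48 * 17 ^ ((r - 1) div 2) * 5 ^ ((s + t - 3) div 2) + 1"
      unfolding odd_r[OF \<open>s \<ge> 1\<close> \<open>odd r\<close> \<open>2 \<le> s +
          t\<close>] odd_st[OF \<open>odd (s + t)\<close>]
      using \<open>odd (s + t)\<close> by simp
  next
    assume "odd r" "odd s" "s \<ge> 3" "t = 0"
    then have "s \<ge> 1" "2 \<le> s + t" "odd (s + t)"
      by simp_all
    then show "gr_bound r s t + 1 = 48 * 17 ^ ((r - 1) div 2) * 5 ^ ((s - 3) div 2) + 1"
      unfolding odd_r[OF \<open>s \<ge> 1\<close> \<open>odd r\<close> \<open>2 \<le> s +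
          t\<close>] odd_st[OF \<open>odd (s + t)\<close>]
      using \<open>odd s\<close> \<open>t = 0\<close> by simp
  next
    assume "s \<ge> 1" "odd r" "even (s + t)"
    then show "gr_bound r s t + 1 = 24 * 17 ^ ((r - 1) div 2) * 5 ^ ((s + t - 2) div 2) + 1"
      unfolding odd_r[OF \<open>s \<ge> 1\<close> \<open>odd r\<close> even_st(2)[OF \<open>even (s
          + t)\<close> \<open>s \<ge> 1\<close>]] by simp
  qed (use s0 even_r r t in \<open>simp_all add: gr_bound_def\<close>)
qed

end
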